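(* Let $0<p<\lambda<1$. For the queue at the cavity of the resource pooling policy with mean-one job sizes, the maximum queue length is minimized by having deterministic job sizes, while for phase-type distributions with $k$ phases the maximum queue length is minimized by having Erlang-$k$ job sizes. Moreover, for deterministic job sizes, the maximum queue length corresponds to the smallest $n\in\mathbb N$ for which $$\frac{1}{1+\rho\left(\sum_{k=0}^{n-1}\frac{(-1)^k}{k!}(n-1-k)^k e^{(n-1-k)\rho}\rho^k\right)}<\frac{1-\lambda}{1-p},\qquad \rho=\frac{\lambda}{1-p}$$ (with $0^0=1$).
   Context: Resource pooling policy at the cavity: for a job size distribution $Z$ with mean $1$ and an integer $n\ge0$, let $P_0(n)$ be the stationary probability that the $M/G/1/n$ queue (Poisson arrivals of rate $\lambda$, first-come-first-served, service times distributed as $Z/(1-p)$, at most $n$ jobs in the system including the one in service, arrivals to a full system are lost) is empty, with $P_0(0)=1$. For phase-type job sizes the queue at the cavity is such a queue with room for $m+1$ jobs and with an additional transition rate $\omega$ from queue length $m+1$ to queue length $m$ (keeping the service phase), where $(m,\omega)$ is the unique pair for which the probability of an empty queue equals $\frac{1-\lambda}{1-p}$. Here $m$ is the smallest integer $m\ge0$ such that $P_0(m+1)<\frac{1-\lambda}{1-p}$, and the maximum queue length is $m+1$; the same definition through $P_0$ is used for other mean-one job size distributions. A phase-type distribution with $k$ phases is the distribution of the absorption time of a continuous-time Markov chain with $k$ transient states and one absorbing state; Erlang-$k$ with mean $1$ is the sum of $k$ independent exponentials of mean $1/k$. Deterministic job sizes are equal to $1$. *)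

theory Defs
  imports "HOL-Probability.Probability" "Jordan_Normal_Form.Matrix"
begin

section \<open>The M/G/1/n queue\<close>

text \<open>
  A sample path is driven by a sequence \<open>w\<close>, where \<open>w i\<close> consists of the time between the
  arrivals of job \<open>i - 1\<close> and job \<open>i\<close> (from time 0 if \<open>i = 0\<close>) and the service time of job \<open>i\<close>.
\<close>

definition arrival_time :: "(nat \<Rightarrow> real \<times> real) \<Rightarrow> nat \<Rightarrow> real" where
  "arrival_time w k = (\<Sum>i\<le>k. fst (w i))"

text \<open>
  \<open>admitted n w k\<close> lists, in order of arrival, the pairs (arrival time, departure time) of those
  among the first \<open>k\<close> arriving jobs that are not lost; the system is empty at time 0.
  A job is admitted iff it finds fewer than \<open>n\<close> admitted jobs that have not yet departed, and
  first-come-first-served order means that its service starts as soon as it has arrived and the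
  previously admitted job has departed.
\<close>

primrec admitted :: "nat \<Rightarrow> (nat \<Rightarrow> real \<times> real) \<Rightarrow> nat \<Rightarrow> (real \<times> real) list" where
  "admitted n w 0 = []"
| "admitted n w (Suc k) =
    (let J = admitted n w k; a = arrival_time w k;
         start = (if J = [] then a else max a (snd (last J)))
     in if length (filter (\<lambda>j. a < snd j) J) < n then J @ [(a, start + snd (w k))] else J)"

definition jobs_present :: "nat \<Rightarrow> (nat \<Rightarrow> real \<times> real) \<Rightarrow> real \<Rightarrow> (real \<times> real) set" where
  "jobs_present n w t = (\<Union>k. {j \<in> set (admitted n w k). fst j \<le> t \<and> t < snd j})"

definition queue_input :: "real \<Rightarrow> real measure \<Rightarrow> (nat \<Rightarrow> real \<times> real) measure" where
  "queue_input lam S =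
    (\<Pi>\<^sub>M i\<in>(UNIV :: nat set). density lborel (exponential_density lam) \<Otimes>\<^sub>M S)"

text \<open>
  The stationary probability of an empty M/G/1/n queue, as the limit of the probability that the
  queue is empty at time \<open>t\<close>.
\<close>

definition MG1n_empty_prob :: "real \<Rightarrow> real measure \<Rightarrow> nat \<Rightarrow> real" where
  "MG1n_empty_prob lam S n =
    Lim at_top (\<lambda>t. measure (queue_input lam S)
                     {w \<in> space (queue_input lam S). jobs_present n w t = {}})"


section \<open>The queue at the cavity\<close>

definition mean_one_job_size :: "real measure \<Rightarrow> bool" where
  "mean_one_job_size Z \<longleftrightarrow>
    real_distribution Z \<and> (AE x in Z. 0 \<le> x) \<and> integrable Z (\<lambda>x. x) \<and> (\<integral>x. x \<partial>Z) = 1"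

definition P0 :: "real \<Rightarrow> real \<Rightarrow> real measure \<Rightarrow> nat \<Rightarrow> real" where
  "P0 lam p Z n = MG1n_empty_prob lam (distr Z borel (\<lambda>x. x / (1 - p))) n"

text \<open>
  The additional service rate at queue length \<open>m + 1\<close>, which tunes the probability of an empty queue
  at the cavity to \<open>(1 - lam) / (1 - p)\<close>, does not enter: the maximum queue length is \<open>m + 1\<close> for the
  least \<open>m\<close> below, which exists for \<open>0 < p < lam < 1\<close>.
\<close>

definition max_queue_length :: "real \<Rightarrow> real \<Rightarrow> real measure \<Rightarrow> nat" where
  "max_queue_length lam p Z = (LEAST m. P0 lam p Z (m + 1) < (1 - lam) / (1 - p)) + 1"


section \<open>Job size distributions\<close>

definition deterministic_size :: "real measure" where
  "deterministic_size = return borel 1"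

text \<open>
  In the library the first argument of the Erlang density is the number of summed independent
  exponentials minus one, the second one is their rate.
\<close>

definition erlang_size :: "nat \<Rightarrow> real measure" where
  "erlang_size k = density lborel (erlang_density (k - 1) (real k))"

text \<open>
  Continuous-time Markov chains on the states \<open>{0..k}\<close>, given by their rate matrix \<open>Q\<close>; the
  transition probabilities are the entries of the matrix exponential of \<open>t Q\<close>.
\<close>

definition rate_matrix :: "nat \<Rightarrow> real mat \<Rightarrow> bool" where
  "rate_matrix k Q \<longleftrightarrow> Q \<in> carrier_mat (k + 1) (k + 1) \<and>
     (\<forall>i\<le>k. \<forall>j\<le>k. i \<noteq> j \<longrightarrow> 0 \<le> Q $$ (i, j)) \<and> (\<forall>i\<le>k. (\<Sum>j\<le>k. Q $$ (i, j)) = 0)"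

definition transition_prob :: "real mat \<Rightarrow> real \<Rightarrow> nat \<Rightarrow> nat \<Rightarrow> real" where
  "transition_prob Q t i j = (\<Sum>m. t ^ m / fact m * (Q ^\<^sub>m m) $$ (i, j))"

definition absorbing_state :: "nat \<Rightarrow> real mat \<Rightarrow> nat \<Rightarrow> bool" where
  "absorbing_state k Q i \<longleftrightarrow> (\<forall>j\<le>k. Q $$ (i, j) = 0)"

text \<open>A state is transient if the expected total time spent there, starting from it, is finite.\<close>

definition transient_state :: "real mat \<Rightarrow> nat \<Rightarrow> bool" where
  "transient_state Q i \<longleftrightarrow> set_integrable lborel {0..} (\<lambda>t. transition_prob Q t i i)"

text \<open>
  The absorption time is at most \<open>t \<ge> 0\<close> iff the chain is in the absorbing state \<open>k\<close> at time \<open>t\<close>.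
  The initial distribution \<open>a\<close> may put mass on the absorbing state.
\<close>

definition phase_type :: "nat \<Rightarrow> real measure \<Rightarrow> bool" where
  "phase_type k Z \<longleftrightarrow> real_distribution Z \<and>
    (\<exists>Q a. rate_matrix k Q \<and> (\<forall>i<k. transient_state Q i) \<and> absorbing_state k Q k \<and>
       (\<forall>i\<le>k. 0 \<le> a i) \<and> (\<Sum>i\<le>k. a i) = 1 \<and>
       (\<forall>t. cdf Z t = (if t < 0 then 0 else \<Sum>i\<le>k. a i * transition_prob Q t i k)))"

end

theory Submission
  imports Defs
begin

text \<open>
  Decomposing at the last arrival that finds the system empty gives the renewal equation
  \<open>u t + lam * (\<integral>s. u (t - s) * g s) = 1\<close> for the probability \<open>u t\<close> of an empty queue, where \<open>g\<close> is the tail of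
  the length of a busy period; hence \<open>u\<close> tends to \<open>1 / (1 + lam * mu * b)\<close>, with \<open>b\<close> the mean number of jobs
  served in a busy period and \<open>mu\<close> the mean service time. The number \<open>b\<close> satisfies a recursion in the
  capacity whose coefficients are the probabilities of more than \<open>l\<close> arrivals during a service, and it
  increases with their partial sums. These partial sums are the means of \<open>min N m\<close>, \<open>N\<close> being the
  number of arrivals during a service, which are concave in the job size. So deterministic job sizes
  are extremal by Jensen's inequality, and a generating function gives the explicit formula.

  For a phase-type job size, sort the states by their mean absorption times \<open>h\<close>. A minimum principle
  for the rate matrix shows that the concave mean only increases when the chain is replaced by the one
  that visits all lower states in turn, spending exponential times with means \<open>h\<^sub>r - h\<^sub>r\<^sub>-\<^sub>1\<close>. By symmetrising
  over cyclic shifts of these phases it increases further to the value for equal phases, an Erlang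
  variable with the same mean; a final application of concavity handles the initial distribution.
\<close>

text \<open>Jensen's inequality cannot be applied to one arrival probability at a time: for l at
  least 1 the chance of more than l arrivals is not concave in the job size. Only the partial sums
  over l are, so the monotonicity of b has to follow from partial sums alone; it does, because the
  other factors of the recursion decrease along the sum. The equation for \<open>u\<close> yields
  the limit only once convergence is known. It is therefore studied along sequences realising the
  limit superior and the limit inferior: a value that is an average against a probability density
  can be extremal only if almost all averaged values are. The number b is found from a function of
  the remaining services that predicts later admissions. Corrected by the admissions so far it is a
  martingale along the busy period, and Wald's identity then turns numbers of jobs into time. For
  phase-type sizes the comparison value is a concave function of \<open>h\<close>. The generator
  maps \<open>h\<close> to -1, so concavity makes the comparison value a supersolution of the
  backward equations of the chain, and the minimum principle applies.\<close>

section \<open>The mean number of jobs served in a busy period\<close>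

text \<open>If \<open>q l\<close> is the probability of more than \<open>l\<close> arrivals during a service, then \<open>served q N\<close> is the mean
  number of jobs served in a busy period of the M/G/1/n queue with \<open>n = N + 1\<close>: of the jobs arriving
  during the first service, the one that is served when \<open>l\<close> others are waiting behind it starts a
  sub-busy period in which only \<open>N - l\<close> further jobs fit. The definition solves this recursion,
  \<open>served_rec\<close>, for its leading term.\<close>

fun served :: "(nat \<Rightarrow> real) \<Rightarrow> nat \<Rightarrow> real" where
  "served q 0 = 1"
| "served q (Suc N) = (1 + (\<Sum>l<N. q (Suc l) * served q (N - l))) / (1 - q 0)"

lemma served_rec:
  assumes "q 0 < 1"
  shows "served q N = 1 + (\<Sum>l<N. q l * served q (N - l))"
proof (cases N)
  case (Suc M)
  have "served q N * (1 - q 0) = 1 + (\<Sum>l<M. q (Suc l) * served q (M - l))"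
    using assms by (simp add: Suc)
  moreover have "(\<Sum>l<N. q l * served q (N - l)) = q 0 * served q N + (\<Sum>l<M. q (Suc l) * served q (M - l))"
    unfolding Suc by (subst sum.lessThan_Suc_shift) simp
  ultimately show ?thesis by (simp add: algebra_simps)
qed simp

text \<open>Serves to recognise \<open>served\<close> in the coefficients of a power series, which
  are only known to satisfy the recursion before it is solved for its leading term.\<close>

lemma served_unique:
  assumes "q 0 < 1" and "\<And>N. c N = 1 + (\<Sum>l<N. q l * c (N - l))"
  shows "c N = served q N"
proof (induction N rule: less_induct)
  case (less N)
  show ?case
  proof (cases N)
    case 0
    then show ?thesis using assms(2)[of 0] by simp
  next
    case (Suc M)
    have "c N = 1 + (\<Sum>l<N. q l * c (N - l))" by (rule assms(2))
    also have "(\<Sum>l<N. q l * c (N - l)) = q 0 * c N + (\<Sum>l<M. q (Suc l) * c (M - l))"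
      unfolding Suc by (subst sum.lessThan_Suc_shift) simp
    also have "(\<Sum>l<M. q (Suc l) * c (M - l)) = (\<Sum>l<M. q (Suc l) * served q (M - l))"
      using less Suc by (intro sum.cong refl) auto
    finally have "c N * (1 - q 0) = 1 + (\<Sum>l<M. q (Suc l) * served q (M - l))"
      by (simp add: algebra_simps)
    then show ?thesis using assms(1) by (simp add: Suc field_simps)
  qed
qed

lemma served_ge_1:
  assumes "q 0 < 1" "\<And>l. 0 \<le> q l"
  shows "1 \<le> served q N"
proof (induction N rule: less_induct)
  case (less N)
  show ?case
  proof (cases N)
    case (Suc M)
    have "0 \<le> (\<Sum>l<M. q (Suc l) * served q (M - l))"
    proof (intro sum_nonneg mult_nonneg_nonneg assms(2))
      fix l assume "l \<in> {..<M}"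
      then have "1 \<le> served q (M - l)" by (intro less) (simp add: Suc)
      then show "0 \<le> served q (M - l)" by simp
    qed
    then have "1 \<le> (1 + (\<Sum>l<M. q (Suc l) * served q (M - l))) / (1 - q 0)"
      using assms by (auto simp: field_simps add_increasing2)
    then show ?thesis by (simp add: Suc)
  qed simp
qed

text \<open>A larger capacity adds a nonnegative last term to the sum and, by induction, enlarges
  all the other terms.\<close>

lemma served_mono_Suc:
  assumes "q 0 < 1" "\<And>l. 0 \<le> q l"
  shows "served q N \<le> served q (Suc N)"
proof (induction N rule: less_induct)
  case (less N)
  show ?case
  proof (cases N)
    case 0
    then show ?thesis using served_ge_1[of q, OF assms, of "Suc 0"] by simp
  next
    case (Suc M)
    have "(\<Sum>l<M. q (Suc l) * served q (M - l)) \<le> (\<Sum>l<M. q (Suc l) * served q (Suc M - l))"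
    proof (intro sum_mono mult_left_mono assms(2))
      fix l assume "l \<in> {..<M}"
      then show "served q (M - l) \<le> served q (Suc M - l)"
        using less[of "M - l"] Suc by (auto simp: Suc_diff_le)
    qed
    also have "\<dots> \<le> \<dots> + q (Suc M) * served q (Suc M - M)"
      using assms(2)[of "Suc M"] served_ge_1[of q, OF assms, of "Suc M - M"]
      by (intro add_increasing2 mult_nonneg_nonneg) linarith+
    also have "\<dots> = (\<Sum>l<Suc M. q (Suc l) * served q (Suc M - l))"
      by (rule sum.lessThan_Suc[symmetric])
    finally show ?thesis using assms(1) unfolding Suc served.simps(2)
      by (intro divide_right_mono add_left_mono) linarith+
  qed
qed

lemma served_mono:
  assumes "q 0 < 1" "\<And>l. 0 \<le> q l" "M \<le> N"
  shows "served q M \<le> served q N"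
  using lift_Suc_mono_le[of "served q", OF served_mono_Suc[of q, OF assms(1,2)] assms(3)] .

text \<open>Abel summation: nonnegative decreasing weights are nonnegative combinations of
  indicators of initial segments, and on those the hypothesis applies. The induction peels off the
  last weight \<open>c N\<close>, which multiplies the complete sum.\<close>

lemma sum_mult_antimono_le:
  fixes f g c :: "nat \<Rightarrow> real"
  assumes "\<And>m. m \<le> N \<Longrightarrow> (\<Sum>l<m. f l) \<le> (\<Sum>l<m. g l)"
    and "\<And>l. Suc l < N \<Longrightarrow> c (Suc l) \<le> c l" and "\<And>l. l < N \<Longrightarrow> 0 \<le> c l"
  shows "(\<Sum>l<N. f l * c l) \<le> (\<Sum>l<N. g l * c l)"
  using assms
proof (induction N arbitrary: c)
  case 0
  then show ?case by simp
next
  case (Suc N)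
  have eq: "(\<Sum>l<Suc N. h l * c l) = (\<Sum>l<N. h l * (c l - c N)) + c N * (\<Sum>l<Suc N. h l)"
    for h :: "nat \<Rightarrow> real"
    by (simp add: algebra_simps sum_subtractf sum_distrib_left)
  have dec: "c N \<le> c l" if "l \<le> N" for l
    using that
  proof (induction rule: inc_induct)
    case (step m)
    then show ?case using Suc.prems(2)[of m] by simp
  qed simp
  have "(\<Sum>l<N. f l * (c l - c N)) \<le> (\<Sum>l<N. g l * (c l - c N))"
    by (rule Suc.IH) (use Suc.prems(1,2) dec in \<open>auto simp: less_imp_le\<close>)
  moreover have "c N * (\<Sum>l<Suc N. f l) \<le> c N * (\<Sum>l<Suc N. g l)"
    using Suc.prems(1)[of "Suc N"] Suc.prems(3)[of N] by (intro mult_left_mono) auto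
  ultimately show ?case unfolding eq by linarith
qed

text \<open>The factors \<open>served r (N - l)\<close> decrease in \<open>l\<close>, so Abel
  summation shows that \<open>served r\<close> is at least what the recursion with the coefficients
  \<open>q\<close> produces from it. Induction on \<open>N\<close> then replaces
  \<open>served r\<close> by \<open>served q\<close> at the smaller capacities.\<close>

lemma served_le:
  assumes q: "q 0 < 1" "\<And>l. 0 \<le> q l" and r: "r 0 < 1" "\<And>l. 0 \<le> r l"
    and le: "\<And>m. (\<Sum>l<m. q l) \<le> (\<Sum>l<m. r l)"
  shows "served q N \<le> served r N"
proof (induction N rule: less_induct)
  case (less N)
  show ?case
  proof (cases N)
    case (Suc M)
    have "(\<Sum>l<N. q l * served r (N - l)) \<le> (\<Sum>l<N. r l * served r (N - l))"
    proof (rule sum_mult_antimono_le)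
      show "served r (N - Suc l) \<le> served r (N - l)" for l
        by (rule served_mono[of r, OF r]) simp
      show "0 \<le> served r (N - l)" for l
        using served_ge_1[of r, OF r, of "N - l"] by simp
    qed (rule le)
    then have "1 + (\<Sum>l<N. q l * served r (N - l)) \<le> 1 + (\<Sum>l<N. r l * served r (N - l))"
      by (rule add_left_mono)
    also have "\<dots> = served r N" by (rule served_rec[of r, OF r(1), symmetric])
    also have "(\<Sum>l<N. q l * served r (N - l)) = q 0 * served r N + (\<Sum>l<M. q (Suc l) * served r (M - l))"
      unfolding Suc by (subst sum.lessThan_Suc_shift) simp
    finally have 1: "1 + (\<Sum>l<M. q (Suc l) * served r (M - l)) \<le> (1 - q 0) * served r N"
      by (simp add: left_diff_distrib)
    have 2: "(\<Sum>l<M. q (Suc l) * served q (M - l)) \<le> (\<Sum>l<M. q (Suc l) * served r (M - l))"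
    proof (intro sum_mono mult_left_mono q(2))
      show "served q (M - l) \<le> served r (M - l)" for l
        by (rule less) (simp add: Suc)
    qed
    have "1 + (\<Sum>l<M. q (Suc l) * served q (M - l)) \<le> served r N * (1 - q 0)"
      using 1 2 unfolding mult.commute[of "served r N"] by linarith
    then have "(1 + (\<Sum>l<M. q (Suc l) * served q (M - l))) / (1 - q 0) \<le> served r N"
      using q(1) by (subst pos_divide_le_eq) simp_all
    then show ?thesis by (simp add: Suc)
  qed simp
qed

text \<open>As the capacity grows, a finite limit \<open>B\<close> would satisfy
  \<open>1 + r * B \<le> B\<close>; this forces \<open>r * B\<close> to be at least
  \<open>r / (1 - r)\<close> if \<open>r < 1\<close> and is impossible if \<open>r \<ge> 1\<close>.
  The assumption \<open>t * (1 - r) < r\<close> expresses \<open>t < r / (1 - r)\<close> in a form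
  that covers both cases.\<close>

lemma served_exceeds:
  assumes q: "q 0 < 1" "\<And>l. 0 \<le> q l" and sums: "q sums r" and "0 < r" "t * (1 - r) < r"
  shows "\<exists>N. t < r * served q N"
proof (rule ccontr)
  assume "\<not> ?thesis"
  then have le: "served q N \<le> t / r" for N
    using \<open>0 < r\<close> by (simp add: not_less pos_le_divide_eq mult.commute)
  have "incseq (served q)" using served_mono[of q, OF q] by (auto simp: incseq_def)
  then obtain B where B: "served q \<longlonglongrightarrow> B"
    using incseq_convergent[of "served q" "t / r"] le by (metis (no_types))
  \<comment> \<open>With the sum cut at a fixed \<open>L\<close> the limit in \<open>N\<close> can
    be taken term by term; \<open>L\<close> tends to infinity only afterwards.\<close>
  have step: "1 + (\<Sum>l<L. q l) * B \<le> B" for L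
  proof (rule LIMSEQ_le)
    have "(\<lambda>N. served q (N + l - l)) \<longlonglongrightarrow> B" for l
      using B by simp
    then have "(\<lambda>N. served q (N - l)) \<longlonglongrightarrow> B" for l
      by (rule LIMSEQ_offset)
    then show "(\<lambda>N. 1 + (\<Sum>l<L. q l * served q (N - l))) \<longlonglongrightarrow> 1 + (\<Sum>l<L. q l) * B"
      unfolding sum_distrib_right by (intro tendsto_intros)
    show "\<exists>M. \<forall>N\<ge>M. 1 + (\<Sum>l<L. q l * served q (N - l)) \<le> served q N"
    proof (intro exI[of _ L] allI impI)
      fix N assume "L \<le> N"
      then have "(\<Sum>l<L. q l * served q (N - l)) \<le> (\<Sum>l<N. q l * served q (N - l))"
      proof (intro sum_mono2)
        fix l
        show "0 \<le> q l * served q (N - l)"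
          using q(2)[of l] served_ge_1[of q, OF q, of "N - l"] by simp
      qed auto
      then show "1 + (\<Sum>l<L. q l * served q (N - l)) \<le> served q N"
        using served_rec[of q, OF q(1), of N] by simp
    qed
  qed (use B in auto)
  have "(\<lambda>L. 1 + (\<Sum>l<L. q l) * B) \<longlonglongrightarrow> 1 + r * B"
    using sums unfolding sums_def by (intro tendsto_intros)
  then have "1 + r * B \<le> B" by (rule LIMSEQ_le_const2) (use step in simp)
  then have "r * (1 + r * B) \<le> r * B" using \<open>0 < r\<close> by (intro mult_left_mono) auto
  then have *: "r \<le> (1 - r) * (r * B)" by (simp add: algebra_simps)
  have "1 \<le> B" by (rule LIMSEQ_le_const[OF B]) (use served_ge_1[of q, OF q] in simp)
  moreover have "B \<le> t / r" by (rule LIMSEQ_le_const2[OF B]) (use le in simp)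
  ultimately have rB: "0 < r * B" "r * B \<le> t"
    using \<open>0 < r\<close> by (auto simp: pos_le_divide_eq mult.commute)
  show False
  proof (cases "r < 1")
    case True
    then have "(1 - r) * (r * B) \<le> (1 - r) * t" using rB by (intro mult_left_mono) auto
    then show False using * assms(5) by (simp add: mult.commute)
  next
    case False
    then have "(1 - r) * (r * B) \<le> 0" using rB by (intro mult_nonpos_nonneg) auto
    then show False using * \<open>0 < r\<close> by simp
  qed
qed

section \<open>Measurability of list-valued functions\<close>

text \<open>Queue contents are lists of random length. Length and padded entries capture their
  measurability without a sigma-algebra on lists, and list operations become case distinctions on
  the length.\<close>

definition list_measurable :: "'w measure \<Rightarrow> ('w \<Rightarrow> 'a::topological_space list) \<Rightarrow> bool" where
  "list_measurable M f \<longleftrightarrow> (\<lambda>w. length (f w)) \<in> measurable M (count_space UNIV) \<and>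
    (\<forall>i. (\<lambda>w. if i < length (f w) then f w ! i else undefined) \<in> borel_measurable M)"

lemma list_measurable_length:
  "list_measurable M f \<Longrightarrow> (\<lambda>w. length (f w)) \<in> measurable M (count_space UNIV)"
  by (simp add: list_measurable_def)

lemma list_measurable_nth:
  "list_measurable M f \<Longrightarrow> (\<lambda>w. if i < length (f w) then f w ! i else undefined) \<in> borel_measurable M"
  by (simp add: list_measurable_def)

lemma list_measurable_const: "list_measurable M (\<lambda>w. xs)"
  by (simp add: list_measurable_def)

lemma list_measurable_pred_Nil:
  assumes "list_measurable M f"
  shows "Measurable.pred M (\<lambda>w. f w = [])"
proof -
  note [measurable] = list_measurable_length[OF assms]
  have "Measurable.pred M (\<lambda>w. length (f w) = 0)" by measurable
  then show ?thesis by simp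
qed

lemma list_measurable_If:
  assumes [measurable]: "Measurable.pred M P" and f: "list_measurable M f" and g: "list_measurable M g"
  shows "list_measurable M (\<lambda>w. if P w then f w else g w)"
  unfolding list_measurable_def
proof (intro conjI allI)
  note [measurable] = list_measurable_length[OF f] list_measurable_length[OF g]
    list_measurable_nth[OF f] list_measurable_nth[OF g]
  have "(\<lambda>w. if P w then length (f w) else length (g w)) \<in> measurable M (count_space UNIV)"
    by measurable
  then show "(\<lambda>w. length (if P w then f w else g w)) \<in> measurable M (count_space UNIV)"
    by (simp add: if_distrib)
  fix i
  have "(\<lambda>w. if P w then (if i < length (f w) then f w ! i else undefined)
      else (if i < length (g w) then g w ! i else undefined)) \<in> borel_measurable M"
    by measurable
  then show "(\<lambda>w. if i < length (if P w then f w else g w) then (if P w then f w else g w) ! i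
      else undefined) \<in> borel_measurable M"
    by (rule measurable_cong[THEN iffD1, rotated]) simp
qed

lemma list_measurable_snoc:
  assumes f: "list_measurable M f" and [measurable]: "x \<in> borel_measurable M"
  shows "list_measurable M (\<lambda>w. f w @ [x w])"
  unfolding list_measurable_def
proof (intro conjI allI)
  note [measurable] = list_measurable_length[OF f] list_measurable_nth[OF f]
  show "(\<lambda>w. length (f w @ [x w])) \<in> measurable M (count_space UNIV)" by simp
  fix i
  have "(\<lambda>w. if length (f w) = i then x w else (if i < length (f w) then f w ! i else undefined))
    \<in> borel_measurable M" by measurable
  then show "(\<lambda>w. if i < length (f w @ [x w]) then (f w @ [x w]) ! i else undefined) \<in> borel_measurable M"
    by (rule measurable_cong[THEN iffD1, rotated]) (auto simp: nth_append)
qed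

lemma list_measurable_Cons:
  assumes f: "list_measurable M f" and [measurable]: "x \<in> borel_measurable M"
  shows "list_measurable M (\<lambda>w. x w # f w)"
  unfolding list_measurable_def
proof (intro conjI allI)
  note [measurable] = list_measurable_length[OF f] list_measurable_nth[OF f]
  show "(\<lambda>w. length (x w # f w)) \<in> measurable M (count_space UNIV)" by simp
  fix i
  show "(\<lambda>w. if i < length (x w # f w) then (x w # f w) ! i else undefined) \<in> borel_measurable M"
  proof (cases i)
    case (Suc j)
    show ?thesis
      using list_measurable_nth[OF f, of j]
      by (rule measurable_cong[THEN iffD1, rotated]) (simp add: Suc)
  qed simp
qed

lemma list_measurable_tl:
  assumes f: "list_measurable M f"
  shows "list_measurable M (\<lambda>w. tl (f w))"
  unfolding list_measurable_def
proof (intro conjI allI)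
  note [measurable] = list_measurable_length[OF f]
  show "(\<lambda>w. length (tl (f w))) \<in> measurable M (count_space UNIV)" by simp
  fix i
  show "(\<lambda>w. if i < length (tl (f w)) then tl (f w) ! i else undefined) \<in> borel_measurable M"
    using list_measurable_nth[OF f, of "Suc i"]
    by (rule measurable_cong[THEN iffD1, rotated]) (auto simp: nth_tl)
qed

lemma list_measurable_hd:
  assumes f: "list_measurable M f"
  shows "(\<lambda>w. hd (f w)) \<in> borel_measurable M"
proof -
  note [measurable] = list_measurable_pred_Nil[OF f] list_measurable_nth[OF f, of 0]
  have "(\<lambda>w. if f w = [] then hd [] else (if 0 < length (f w) then f w ! 0 else undefined)) \<in> borel_measurable M"
    by measurable
  then show ?thesis
    by (rule measurable_cong[THEN iffD1, rotated]) (auto simp: hd_conv_nth)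
qed

lemma list_measurable_last:
  assumes f: "list_measurable M f"
  shows "(\<lambda>w. last (f w)) \<in> borel_measurable M"
proof -
  note [measurable] = list_measurable_pred_Nil[OF f] list_measurable_length[OF f] list_measurable_nth[OF f]
  have [measurable]: "(\<lambda>w. (\<lambda>j w. if j - 1 < length (f w) then f w ! (j - 1) else undefined) (length (f w)) w) \<in> borel_measurable M"
    by (rule measurable_compose_countable) simp_all
  have "(\<lambda>w. if f w = [] then last [] else
      (if length (f w) - 1 < length (f w) then f w ! (length (f w) - 1) else undefined)) \<in> borel_measurable M"
    by measurable
  then show ?thesis
    by (rule measurable_cong[THEN iffD1, rotated]) (auto simp: last_conv_nth)
qed

lemma list_measurable_sum_list:
  fixes f :: "'w \<Rightarrow> real list"
  assumes f: "list_measurable M f"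
  shows "(\<lambda>w. sum_list (f w)) \<in> borel_measurable M"
proof -
  note [measurable] = list_measurable_length[OF f] list_measurable_nth[OF f]
  have "(\<lambda>w. (\<lambda>j w. \<Sum>i<j. if i < length (f w) then f w ! i else undefined) (length (f w)) w) \<in> borel_measurable M"
    by (rule measurable_compose_countable) simp_all
  then show ?thesis
    by (rule measurable_cong[THEN iffD1, rotated])
      (auto simp: sum_list_sum_nth atLeast0LessThan intro!: sum.cong)
qed

text \<open>The predicate may depend on the outcome because departure times will be compared with a
  random arrival time.\<close>

lemma list_measurable_length_filter:
  assumes f: "list_measurable M f" and P: "Measurable.pred (M \<Otimes>\<^sub>M borel) (\<lambda>(w, x). P w x)"
  shows "(\<lambda>w. real (length (filter (P w) (f w)))) \<in> borel_measurable M"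
proof -
  note [measurable] = list_measurable_length[OF f] list_measurable_nth[OF f] P
  have [measurable]: "Measurable.pred M (\<lambda>w. P w (if i < length (f w) then f w ! i else undefined))" for i
    using measurable_compose[OF measurable_Pair[OF measurable_ident list_measurable_nth[OF f, of i]] P] by simp
  have "(\<lambda>w. (\<lambda>j w. \<Sum>i<j. if P w (if i < length (f w) then f w ! i else undefined) then 1 else (0::real))
      (length (f w)) w) \<in> borel_measurable M"
    by (rule measurable_compose_countable) simp_all
  moreover have "real (length (filter (P w) (f w))) =
     (\<Sum>i<length (f w). if P w (if i < length (f w) then f w ! i else undefined) then 1 else 0)" for w
  proof -
    have "(\<Sum>i<length (f w). if P w (if i < length (f w) then f w ! i else undefined) then 1 else (0::real))
        = (\<Sum>i<length (f w). if P w (f w ! i) then 1 else 0)"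
      by (intro sum.cong) auto
    also have "\<dots> = real (card {i. i < length (f w) \<and> P w (f w ! i)})"
      by (subst sum.If_cases) (auto intro!: arg_cong[of _ _ card])
    finally show ?thesis by (simp add: length_filter_conv_card)
  qed
  ultimately show ?thesis by simp
qed

lemma list_measurable_Ball:
  assumes f: "list_measurable M f" and P: "Measurable.pred borel P"
  shows "Measurable.pred M (\<lambda>w. \<forall>x\<in>set (f w). P x)"
proof -
  define F where "F w = real (length (filter (\<lambda>x. \<not> P x) (f w)))" for w
  have "Measurable.pred (M \<Otimes>\<^sub>M borel) (\<lambda>(w, x). \<not> P x)"
    using measurable_compose[OF measurable_snd P, of M] by simp
  then have [measurable]: "F \<in> borel_measurable M"
    unfolding F_def by (rule list_measurable_length_filter[OF f])
  have "Measurable.pred M (\<lambda>w. F w = 0)" by measurable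
  moreover have "(\<forall>x\<in>set (f w). P x) \<longleftrightarrow> F w = 0" for w
    by (simp add: F_def filter_empty_conv)
  ultimately show ?thesis by simp
qed

section \<open>A renewal equation\<close>

text \<open>\<open>L\<close> is the limit superior at infinity: the suprema over
  \<open>{T..}\<close> decrease to it, and near-maximisers beyond each \<open>n\<close> form the
  sequence.\<close>

lemma limsup_sequence:
  fixes f :: "real \<Rightarrow> real"
  assumes "\<And>t. \<bar>f t\<bar> \<le> B"
  obtains L t where "filterlim t at_top sequentially" "(\<lambda>n. f (t n)) \<longlonglongrightarrow> L"
    "\<And>e. 0 < e \<Longrightarrow> \<forall>\<^sub>F t in at_top. f t \<le> L + e"
proof -
  define S where "S T = (SUP t\<in>{T..}. f t)" for T :: real
  have bdd: "bdd_above (f ` {T..})" for T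
    by (rule bdd_aboveI2[of _ _ B]) (use assms in \<open>auto simp: abs_le_iff\<close>)
  have le_S: "f t \<le> S T" if "T \<le> t" for t T
    unfolding S_def using that by (intro cSUP_upper bdd) auto
  have "S T' \<le> S T" if "T \<le> T'" for T T'
    unfolding S_def using that by (intro cSUP_subset_mono bdd) auto
  then have "decseq (\<lambda>n. S (real n))" by (auto simp: decseq_def)
  moreover have "- B \<le> S T" for T
    using le_S[of T T] assms[of T] by (auto simp: abs_le_iff)
  ultimately obtain L where L: "(\<lambda>n. S (real n)) \<longlonglongrightarrow> L"
    using decseq_convergent[of "\<lambda>n. S (real n)" "- B"] by blast
  have "\<exists>t\<ge>real n. S (real n) - 1 / real (Suc n) < f t" for n
  proof -
    have "S (real n) - 1 / real (Suc n) < S (real n)" by simp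
    then show ?thesis
      unfolding S_def[of "real n"] by (subst (asm) less_cSUP_iff[OF _ bdd]) auto
  qed
  then obtain t where t: "\<And>n. real n \<le> t n" "\<And>n. S (real n) - 1 / real (Suc n) < f (t n)"
    by metis
  show thesis
  proof
    show "filterlim t at_top sequentially"
      by (rule filterlim_at_top_mono[OF filterlim_real_sequentially]) (use t in auto)
    show "(\<lambda>n. f (t n)) \<longlonglongrightarrow> L"
    proof (rule tendsto_sandwich)
      show "(\<lambda>n. S (real n) - 1 / real (Suc n)) \<longlonglongrightarrow> L"
        using tendsto_diff[OF L LIMSEQ_Suc[OF lim_1_over_n]] by simp
    qed (use t le_S L less_imp_le in \<open>auto intro!: always_eventually less_imp_le\<close>)
    fix e :: real assume "0 < e"
    then have "\<forall>\<^sub>F n in sequentially. S (real n) < L + e"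
      by (intro order_tendstoD(2)[OF L]) simp
    then obtain n where n: "S (real n) < L + e"
      by (auto simp: eventually_sequentially)
    show "\<forall>\<^sub>F t in at_top. f t \<le> L + e"
      using eventually_ge_at_top[of "real n"] by eventually_elim (use n le_S in force)
  qed
qed

lemma AE_lborel_shift:
  fixes c :: real
  assumes "AE x in lborel. P x"
  shows "AE x in lborel. P (c + x)"
proof -
  have "AE x in distr lborel borel ((+) c). P x"
    by (subst lborel_distr_plus) (rule assms)
  then show ?thesis by (rule AE_distrD[rotated]) simp
qed

lemma has_bochner_integral_exponential_density:
  assumes "0 < l"
  shows "has_bochner_integral lborel (exponential_density l) 1"
proof (rule has_bochner_integral_nn_integral)
  show "(\<integral>\<^sup>+x. ennreal (exponential_density l x) \<partial>lborel) = ennreal 1"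
    using prob_space.emeasure_space_1[OF prob_space_exponential_density[OF assms]]
    by (simp add: emeasure_density)
qed (use assms in auto)

lemma integral_exponential_density: "0 < l \<Longrightarrow> (\<integral>x. exponential_density l x \<partial>lborel) = 1"
  using has_bochner_integral_exponential_density[of l] by (simp add: has_bochner_integral_iff)

text \<open>Both functions vanish at negative times, so the convolution over \<open>[0, t]\<close>
  can be written as an integral over the whole line.\<close>

locale renewal_equation =
  fixes lam :: real and u g :: "real \<Rightarrow> real"
  assumes lam: "0 < lam"
    and u_meas [measurable]: "u \<in> borel_measurable borel"
    and u_bounds: "\<And>t. 0 \<le> u t" "\<And>t. u t \<le> 1" and u_neg: "\<And>t. t < 0 \<Longrightarrow> u t = 0"
    and g_int [measurable]: "integrable lborel g"
    and g_bounds: "\<And>t. 0 \<le> g t" "\<And>t. g t \<le> 1" and g_neg: "\<And>t. t < 0 \<Longrightarrow> g t = 0"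
    and g_anti: "\<And>s t. 0 \<le> s \<Longrightarrow> s \<le> t \<Longrightarrow> g t \<le> g s"
    and eq: "\<And>t. 0 \<le> t \<Longrightarrow> u t + lam * (\<integral>s. u (t - s) * g s \<partial>lborel) = 1"
begin

definition expd :: "real \<Rightarrow> real" where "expd = exponential_density lam"

lemma expd_meas [measurable]: "expd \<in> borel_measurable borel"
  unfolding expd_def by simp

lemma expd_nonneg: "0 \<le> expd x"
  using lam by (simp add: expd_def exponential_density_def)

lemma expd_int: "integrable lborel expd" "(\<integral>x. expd x \<partial>lborel) = 1"
  using has_bochner_integral_exponential_density[OF lam] by (simp_all add: expd_def has_bochner_integral_iff)

lemma expd_le: "expd x \<le> lam"
  using lam by (simp add: expd_def exponential_density_def)

lemma expd_g_int: "integrable lborel (\<lambda>r. expd (x - r) * g r)"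
proof (rule Bochner_Integration.integrable_bound)
  show "integrable lborel (\<lambda>r. lam * g r)" using g_int by simp
  show "AE r in lborel. norm (expd (x - r) * g r) \<le> norm (lam * g r)"
    using expd_le expd_nonneg g_bounds lam by (auto simp: abs_mult intro!: mult_mono)
qed simp

text \<open>Convolving the renewal equation with the exponential density turns it into
  \<open>u t = exp (- lam * t) + (u * kern) t\<close>, where \<open>kern\<close> is a probability density.\<close>

definition conv :: "real \<Rightarrow> real" where
  "conv x = (\<integral>r. expd (x - r) * g r \<partial>lborel)"

definition kern :: "real \<Rightarrow> real" where
  "kern x = expd x - lam * g x + lam * conv x"

lemma conv_nn: "ennreal (conv x) = (\<integral>\<^sup>+r. ennreal (expd (x - r) * g r) \<partial>lborel)"
  unfolding conv_def
  by (rule nn_integral_eq_integral[symmetric, OF expd_g_int]) (simp add: expd_nonneg g_bounds)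

lemma conv_meas [measurable]: "conv \<in> borel_measurable borel"
  unfolding conv_def by measurable

lemma conv_nonneg: "0 \<le> conv x"
  unfolding conv_def by (intro Bochner_Integration.integral_nonneg) (simp add: expd_nonneg g_bounds)

lemma conv_int: "integrable lborel conv" "(\<integral>x. conv x \<partial>lborel) = (\<integral>x. g x \<partial>lborel)"
proof -
  have "(\<integral>\<^sup>+x. ennreal (conv x) \<partial>lborel) = (\<integral>\<^sup>+r. (\<integral>\<^sup>+x. ennreal (expd (x - r) * g r) \<partial>lborel) \<partial>lborel)"
    unfolding conv_nn by (rule lborel_pair.Fubini') measurable
  also have "\<dots> = (\<integral>\<^sup>+r. ennreal (g r) \<partial>lborel)"
  proof (rule nn_integral_cong)
    fix r
    have "(\<integral>\<^sup>+x. ennreal (expd (x - r) * g r) \<partial>lborel) = (\<integral>\<^sup>+x. ennreal (expd x * g r) \<partial>lborel)"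
      by (subst nn_integral_real_affine[of _ 1 r]) simp_all
    also have "\<dots> = (\<integral>\<^sup>+x. ennreal (expd x) \<partial>lborel) * ennreal (g r)"
      by (simp add: ennreal_mult g_bounds expd_nonneg nn_integral_multc)
    also have "(\<integral>\<^sup>+x. ennreal (expd x) \<partial>lborel) = 1"
      using nn_integral_eq_integral[OF expd_int(1)] expd_int(2) by (simp add: expd_nonneg)
    finally show "(\<integral>\<^sup>+x. ennreal (expd (x - r) * g r) \<partial>lborel) = ennreal (g r)" by simp
  qed
  also have "\<dots> = ennreal (\<integral>x. g x \<partial>lborel)"
    by (rule nn_integral_eq_integral[OF g_int]) (simp add: g_bounds)
  finally have "has_bochner_integral lborel conv (\<integral>x. g x \<partial>lborel)"
    by (intro has_bochner_integral_nn_integral) (auto simp: conv_nonneg g_bounds)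
  then show "integrable lborel conv" "(\<integral>x. conv x \<partial>lborel) = (\<integral>x. g x \<partial>lborel)"
    by (simp_all add: has_bochner_integral_iff)
qed

text \<open>As \<open>g\<close> decreases, \<open>conv x\<close> is at least \<open>g x\<close>
  times the mass of the exponential law on \<open>{..x}\<close>. Probabilistically,
  \<open>kern\<close> is the density of an idle period followed by a busy period with tail
  \<open>g\<close>; the bound shows that it is positive at every \<open>x \<ge> 0\<close> with
  \<open>g x < 1\<close>.\<close>

lemma kern_ge: "0 \<le> x \<Longrightarrow> expd x * (1 - g x) \<le> kern x"
proof -
  assume x: "0 \<le> x"
  have "ennreal (g x * (1 - exp (- lam * x))) = ennreal (g x) * (\<integral>\<^sup>+y. ennreal (expd y) * indicator {..x} y \<partial>lborel)"
    using x lam unfolding expd_def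
    by (subst nn_integral_erlang_density) (auto simp: erlang_CDF_def ennreal_mult g_bounds)
  also have "(\<integral>\<^sup>+y. ennreal (expd y) * indicator {..x} y \<partial>lborel)
      = (\<integral>\<^sup>+r. ennreal (expd (x - r)) * indicator {..x} (x - r) \<partial>lborel)"
    by (subst nn_integral_real_affine[of _ "-1" x]) simp_all
  also have "ennreal (g x) * \<dots> = (\<integral>\<^sup>+r. ennreal (g x) * (ennreal (expd (x - r)) * indicator {..x} (x - r)) \<partial>lborel)"
    by (rule nn_integral_cmult[symmetric]) measurable
  also have "\<dots> \<le> (\<integral>\<^sup>+r. ennreal (expd (x - r) * g r) \<partial>lborel)"
  proof (rule nn_integral_mono)
    fix r
    show "ennreal (g x) * (ennreal (expd (x - r)) * indicator {..x} (x - r)) \<le> ennreal (expd (x - r) * g r)"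
    proof (cases "0 \<le> r \<and> r \<le> x")
      case True
      then show ?thesis using g_anti[of r x] expd_nonneg[of "x - r"] g_bounds
        by (auto simp: ennreal_mult[symmetric] mult.commute intro!: ennreal_leI mult_right_mono)
    next
      case False
      then show ?thesis
        by (auto simp: indicator_def expd_def exponential_density_def)
    qed
  qed
  also have "\<dots> = ennreal (conv x)" by (rule conv_nn[symmetric])
  finally have "g x * (1 - exp (- lam * x)) \<le> conv x" by (simp add: conv_nonneg)
  then have "lam * (g x * (1 - exp (- lam * x))) \<le> lam * conv x"
    using lam by (intro mult_left_mono) auto
  moreover have "expd x = lam * exp (- lam * x)"
    using x by (simp add: expd_def exponential_density_def mult.commute)
  ultimately show "expd x * (1 - g x) \<le> kern x"
    unfolding kern_def by (simp add: algebra_simps)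
qed

text \<open>The equation at time \<open>t - y\<close> is multiplied by the exponential density at
  \<open>y\<close> and integrated. By Fubini the double integral is \<open>u\<close> convolved with
  \<open>conv\<close>; evaluating its inner integral by the equation leaves only \<open>u\<close>
  convolved with the exponential density.\<close>

lemma u_renewal:
  assumes "0 \<le> t"
  shows "u t = exp (- lam * t) + (\<integral>s. u (t - s) * kern s \<partial>lborel)"
proof -
  have ug: "integrable lborel (\<lambda>r. u (c - r) * f r)" if "integrable lborel f" for f c
  proof (rule Bochner_Integration.integrable_bound[OF that])
    show "(\<lambda>r. u (c - r) * f r) \<in> borel_measurable lborel"
      using borel_measurable_integrable[OF that] by measurable
    show "AE r in lborel. norm (u (c - r) * f r) \<le> norm (f r)"
      using u_bounds by (auto simp: abs_mult intro!: mult_left_le_one_le)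
  qed
  have inner: "lam * (\<integral>r. u (t - y - r) * g r \<partial>lborel) = (if y \<le> t then 1 - u (t - y) else 0)" if "0 \<le> y" for y
  proof (cases "y \<le> t")
    case True
    then show ?thesis using eq[of "t - y"] by simp
  next
    case False
    have "(\<lambda>r. u (t - y - r) * g r) = (\<lambda>r. 0)"
    proof
      show "u (t - y - r) * g r = 0" for r
        using False by (cases "0 \<le> r") (auto simp: u_neg g_neg)
    qed
    then show ?thesis using False by (simp only: Bochner_Integration.integral_zero) simp
  qed
  have "(\<integral>\<^sup>+s. ennreal (u (t - s) * conv s) \<partial>lborel)
      = (\<integral>\<^sup>+s. (\<integral>\<^sup>+r. ennreal (u (t - s) * (expd (s - r) * g r)) \<partial>lborel) \<partial>lborel)"
    by (simp add: ennreal_mult u_bounds conv_nonneg expd_nonneg g_bounds conv_nn nn_integral_cmult)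
  also have "\<dots> = (\<integral>\<^sup>+r. (\<integral>\<^sup>+s. ennreal (u (t - s) * (expd (s - r) * g r)) \<partial>lborel) \<partial>lborel)"
    by (rule lborel_pair.Fubini') measurable
  also have "\<dots> = (\<integral>\<^sup>+r. (\<integral>\<^sup>+y. ennreal (u (t - y - r) * (expd y * g r)) \<partial>lborel) \<partial>lborel)"
  proof (rule nn_integral_cong)
    fix r
    show "(\<integral>\<^sup>+s. ennreal (u (t - s) * (expd (s - r) * g r)) \<partial>lborel) = (\<integral>\<^sup>+y. ennreal (u (t - y - r) * (expd y * g r)) \<partial>lborel)"
      by (subst nn_integral_real_affine[of _ 1 r]) (simp_all add: algebra_simps)
  qed
  also have "\<dots> = (\<integral>\<^sup>+y. (\<integral>\<^sup>+r. ennreal (u (t - y - r) * (expd y * g r)) \<partial>lborel) \<partial>lborel)"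
    by (rule lborel_pair.Fubini') measurable
  also have "\<dots> = (\<integral>\<^sup>+y. ennreal (expd y * (indicator {..t} y - u (t - y)) / lam) \<partial>lborel)"
  proof (rule nn_integral_cong)
    fix y
    have "(\<integral>\<^sup>+r. ennreal (u (t - y - r) * (expd y * g r)) \<partial>lborel) = (\<integral>\<^sup>+r. ennreal (expd y) * ennreal (u (t - y - r) * g r) \<partial>lborel)"
      by (intro nn_integral_cong) (simp add: ennreal_mult[symmetric] expd_nonneg u_bounds g_bounds ac_simps)
    also have "\<dots> = ennreal (expd y) * (\<integral>\<^sup>+r. ennreal (u (t - y - r) * g r) \<partial>lborel)"
      by (rule nn_integral_cmult) measurable
    also have "(\<integral>\<^sup>+r. ennreal (u (t - y - r) * g r) \<partial>lborel) = ennreal (\<integral>r. u (t - y - r) * g r \<partial>lborel)"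
      by (rule nn_integral_eq_integral[OF ug[OF g_int]]) (simp add: u_bounds g_bounds)
    also have "ennreal (expd y) * \<dots> = ennreal (expd y * (\<integral>r. u (t - y - r) * g r \<partial>lborel))"
      by (simp add: ennreal_mult'' expd_nonneg Bochner_Integration.integral_nonneg u_bounds g_bounds)
    also have "expd y * (\<integral>r. u (t - y - r) * g r \<partial>lborel) = expd y * (indicator {..t} y - u (t - y)) / lam"
    proof (cases "0 \<le> y")
      case True
      have "(\<integral>r. u (t - y - r) * g r \<partial>lborel) = (if y \<le> t then 1 - u (t - y) else 0) / lam"
        using inner[OF True] lam by (simp add: field_simps)
      then show ?thesis by (simp add: u_neg)
    qed (simp add: expd_def exponential_density_def)
    finally show "(\<integral>\<^sup>+r. ennreal (u (t - y - r) * (expd y * g r)) \<partial>lborel) = ennreal (expd y * (indicator {..t} y - u (t - y)) / lam)" .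
  qed
  finally have nn: "(\<integral>\<^sup>+s. ennreal (u (t - s) * conv s) \<partial>lborel) = (\<integral>\<^sup>+y. ennreal (expd y * (indicator {..t} y - u (t - y)) / lam) \<partial>lborel)" .
  have int1: "integrable lborel (\<lambda>y. expd y * indicator {..t} y)"
    by (rule Bochner_Integration.integrable_bound[OF expd_int(1)]) (auto simp: indicator_def)
  have int2: "integrable lborel (\<lambda>y. expd y * (indicator {..t} y - u (t - y)) / lam)"
    using int1 ug[OF expd_int(1), of t] by (simp add: right_diff_distrib mult.commute)
  have nonneg2: "0 \<le> expd y * (indicator {..t} y - u (t - y)) / lam" for y
    using lam expd_nonneg u_bounds u_neg by (auto simp: indicator_def not_le)
  have "ennreal (\<integral>s. u (t - s) * conv s \<partial>lborel) = ennreal (\<integral>y. expd y * (indicator {..t} y - u (t - y)) / lam \<partial>lborel)"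
    using nn nn_integral_eq_integral[OF ug[OF conv_int(1)], of t] nn_integral_eq_integral[OF int2] nonneg2
    by (simp add: u_bounds conv_nonneg)
  then have "(\<integral>s. u (t - s) * conv s \<partial>lborel) = (\<integral>y. expd y * (indicator {..t} y - u (t - y)) / lam \<partial>lborel)"
    by (rule ennreal_inj[THEN iffD1, rotated 2]; intro Bochner_Integration.integral_nonneg)
      (simp_all only: nonneg2 mult_nonneg_nonneg u_bounds conv_nonneg)
  also have "\<dots> = ((\<integral>y. expd y * indicator {..t} y \<partial>lborel) - (\<integral>y. u (t - y) * expd y \<partial>lborel)) / lam"
    using int1 ug[OF expd_int(1), of t] by (simp add: right_diff_distrib mult.commute)
  also have "(\<integral>y. expd y * indicator {..t} y \<partial>lborel) = 1 - exp (- lam * t)"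
  proof -
    have "(\<integral>\<^sup>+y. ennreal (expd y * indicator {..t} y) \<partial>lborel) = ennreal (1 - exp (- lam * t))"
    proof -
      have "ennreal (expd y * indicator {..t} y) = ennreal (expd y) * indicator {..t} y" for y
        by (auto simp: indicator_def)
      then show ?thesis
        using nn_integral_erlang_density[OF lam, of 0 t] assms
        by (simp add: expd_def erlang_CDF_def)
    qed
    then have "has_bochner_integral lborel (\<lambda>y. expd y * indicator {..t} y) (1 - exp (- lam * t))"
      by (rule has_bochner_integral_nn_integral[rotated 3]) (use lam assms in \<open>auto simp: expd_nonneg\<close>)
    then show ?thesis by (simp add: has_bochner_integral_iff)
  qed
  finally have conv: "lam * (\<integral>s. u (t - s) * conv s \<partial>lborel)
      = 1 - exp (- lam * t) - (\<integral>y. u (t - y) * expd y \<partial>lborel)"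
    using lam by (simp add: field_simps)
  have "(\<integral>s. u (t - s) * kern s \<partial>lborel) = (\<integral>s. u (t - s) * expd s \<partial>lborel)
      - lam * (\<integral>s. u (t - s) * g s \<partial>lborel) + lam * (\<integral>s. u (t - s) * conv s \<partial>lborel)"
    using ug[OF expd_int(1), of t] ug[OF g_int, of t] ug[OF conv_int(1), of t]
    by (simp add: kern_def algebra_simps)
  then show ?thesis using conv eq[OF assms] by simp
qed

lemma kern_nonneg: "0 \<le> kern x"
proof (cases "0 \<le> x")
  case True
  have "0 \<le> expd x * (1 - g x)" using expd_nonneg g_bounds by simp
  then show ?thesis using kern_ge[OF True] by simp
next
  case False
  then show ?thesis using conv_nonneg[of x] lam by (simp add: kern_def g_neg expd_nonneg)
qed

lemma kern_int: "integrable lborel kern" "(\<integral>x. kern x \<partial>lborel) = 1"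
  unfolding kern_def using expd_int g_int conv_int by simp_all

text \<open>An antitone \<open>g\<close> that never drops below 1 would not be integrable.\<close>

lemma eventually_g_less_1: "\<exists>b\<ge>0. \<forall>x\<ge>b. g x < 1"
proof (rule ccontr)
  assume "\<not> ?thesis"
  then have "\<exists>x\<ge>b. 1 \<le> g x" if "0 \<le> b" for b using that by (auto simp: not_less)
  then have "1 \<le> g b" if "0 \<le> b" for b using that g_anti by (meson order_trans)
  then have "(\<integral>\<^sup>+x. indicator {0<..<real n} x \<partial>lborel) \<le> (\<integral>\<^sup>+x. ennreal (g x) \<partial>lborel)" for n
    by (intro nn_integral_mono) (auto simp: indicator_def)
  also have "(\<integral>\<^sup>+x. ennreal (g x) \<partial>lborel) = ennreal (\<integral>x. g x \<partial>lborel)"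
    by (rule nn_integral_eq_integral[OF g_int]) (simp add: g_bounds)
  finally have "ennreal (real n) \<le> ennreal (\<integral>x. g x \<partial>lborel)" for n by simp
  then have "real n \<le> (\<integral>x. g x \<partial>lborel)" for n
    by (subst (asm) ennreal_le_iff) (auto intro!: Bochner_Integration.integral_nonneg simp: g_bounds)
  then show False using reals_Archimedean2[of "\<integral>x. g x \<partial>lborel"] by (meson not_less)
qed

text \<open>With \<open>\<sigma> = 1\<close> the value \<open>L\<close> is a limit superior of
  \<open>u\<close>, with \<open>\<sigma> = -1\<close> a limit inferior. At time \<open>t n\<close>
  it is asymptotically the average of \<open>u (t n - x)\<close> over \<open>x\<close> with density
  \<open>kern\<close>, while none of these values can be more extreme in the limit. Hence along a
  subsequence they tend to \<open>L\<close> for almost every \<open>x\<close> where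
  \<open>kern\<close> is positive, and the original equation can be evaluated in the limit.\<close>

lemma extremal_limit:
  assumes t: "filterlim t at_top sequentially" and L: "(\<lambda>n. u (t n)) \<longlonglongrightarrow> L"
    and \<sigma>: "\<sigma> = 1 \<or> \<sigma> = -1"
    and ext: "\<And>e. 0 < e \<Longrightarrow> \<forall>\<^sub>F t in at_top. \<sigma> * u t \<le> \<sigma> * L + e"
  shows "L * (1 + lam * (\<integral>x. g x \<partial>lborel)) = 1"
proof -
  have \<sigma>2: "\<sigma> * (\<sigma> * x) = x" "\<bar>\<sigma> * x\<bar> = \<bar>x\<bar>" for x using \<sigma> by auto
  have [measurable]: "kern \<in> borel_measurable borel" using kern_int(1) by auto
  have L01: "0 \<le> L" "L \<le> 1"
    by (rule LIMSEQ_le_const[OF L], use u_bounds in auto) (rule LIMSEQ_le_const2[OF L], use u_bounds in auto)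
  define d where "d n x = \<sigma> * L - \<sigma> * u (t n - x)" for n x
  have d_meas [measurable]: "d n \<in> borel_measurable borel" for n unfolding d_def by measurable
  have d_bound: "\<bar>d n x\<bar> \<le> 1" for n x
    unfolding d_def using \<sigma> L01 u_bounds[of "t n - x"] by auto
  have kint: "integrable lborel (\<lambda>x. f x * kern x)"
    if [measurable]: "f \<in> borel_measurable borel" and "\<And>x. \<bar>f x\<bar> \<le> 1" for f
    by (rule Bochner_Integration.integrable_bound[OF kern_int(1)])
      (use that(2) in \<open>auto simp: abs_mult intro!: mult_left_le_one_le\<close>)
  have t_shift: "filterlim (\<lambda>n. t n - x) at_top sequentially" for x
    using filterlim_tendsto_add_at_top[OF tendsto_const[of "-x"] t] by simp
  \<comment> \<open>The average of the deficit vanishes: by \<open>u_renewal\<close> it is, up to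
    sign and the term \<open>exp (- lam * t n)\<close>, the difference of \<open>L\<close> and
    \<open>u (t n)\<close>.\<close>
  have lim1: "(\<lambda>n. \<integral>x. d n x * kern x \<partial>lborel) \<longlonglongrightarrow> 0"
  proof -
    have "filterlim (\<lambda>n. lam * t n) at_top sequentially"
      by (rule filterlim_tendsto_pos_mult_at_top[OF tendsto_const lam t])
    then have "(\<lambda>n. exp (- (lam * t n))) \<longlonglongrightarrow> 0"
      by (intro filterlim_compose[OF exp_at_bot] filterlim_uminus_at_top[THEN iffD1])
    then have "(\<lambda>n. \<sigma> * L - \<sigma> * (u (t n) - exp (- lam * t n))) \<longlonglongrightarrow> \<sigma> * L - \<sigma> * (L - 0)"
      by (intro tendsto_intros L) simp
    moreover have "\<forall>\<^sub>F n in sequentially. \<sigma> * L - \<sigma> * (u (t n) - exp (- lam * t n)) = (\<integral>x. d n x * kern x \<partial>lborel)"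
      using filterlim_at_top[THEN iffD1, OF t, rule_format, of 0]
    proof eventually_elim
      fix n assume "0 \<le> t n"
      have "(\<integral>x. d n x * kern x \<partial>lborel) = (\<integral>x. \<sigma> * L * kern x - \<sigma> * (u (t n - x) * kern x) \<partial>lborel)"
        by (simp add: d_def left_diff_distrib mult.assoc)
      also have "\<dots> = \<sigma> * L - \<sigma> * (\<integral>x. u (t n - x) * kern x \<partial>lborel)"
        using kern_int kint[of "\<lambda>x. u (t n - x)"] u_bounds by simp
      finally show "\<sigma> * L - \<sigma> * (u (t n) - exp (- lam * t n)) = (\<integral>x. d n x * kern x \<partial>lborel)"
        using u_renewal[OF \<open>0 \<le> t n\<close>] by simp
    qed
    ultimately show ?thesis by (simp add: tendsto_cong)
  qed
  \<comment> \<open>By extremality the deficit is asymptotically nonnegative, so its negative part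
    vanishes pointwise and, being dominated by \<open>kern\<close>, in mean.\<close>
  have lim2: "(\<lambda>n. \<integral>x. max 0 (- d n x) * kern x \<partial>lborel) \<longlonglongrightarrow> (\<integral>x. 0 \<partial>(lborel :: real measure))"
  proof (rule integral_dominated_convergence[where w = kern])
    show "AE x in lborel. (\<lambda>n. max 0 (- d n x) * kern x) \<longlonglongrightarrow> 0"
    proof (rule AE_I2)
      fix x
      have "(\<lambda>n. max 0 (- d n x)) \<longlonglongrightarrow> 0"
      proof (rule order_tendstoI)
        fix e :: real assume "0 < e"
        then have "\<forall>\<^sub>F s in at_top. \<sigma> * u s \<le> \<sigma> * L + e / 2" by (intro ext) simp
        then have "\<forall>\<^sub>F n in sequentially. \<sigma> * u (t n - x) \<le> \<sigma> * L + e / 2"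
          by (rule eventually_compose_filterlim[OF _ t_shift])
        then show "\<forall>\<^sub>F n in sequentially. max 0 (- d n x) < e"
          by eventually_elim (use \<open>0 < e\<close> in \<open>simp add: d_def\<close>)
      qed (auto simp: max_def not_le intro!: always_eventually)
      from tendsto_mult_left_zero[OF this, of "kern x"]
      show "(\<lambda>n. max 0 (- d n x) * kern x) \<longlonglongrightarrow> 0" by simp
    qed
    show "AE x in lborel. norm (max 0 (- d n x) * kern x) \<le> kern x" for n
    proof (rule AE_I2)
      fix x
      have "\<bar>max 0 (- d n x)\<bar> \<le> 1" using d_bound[of n x] by auto
      then show "norm (max 0 (- d n x) * kern x) \<le> kern x"
        using kern_nonneg[of x] by (auto simp: abs_mult intro!: mult_left_le_one_le)
    qed
  qed (use kern_int in auto)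
  have "(\<integral>x. norm (d n x * kern x) \<partial>lborel)
      = (\<integral>x. d n x * kern x \<partial>lborel) + 2 * (\<integral>x. max 0 (- d n x) * kern x \<partial>lborel)" for n
  proof -
    have b: "\<bar>max 0 (- d n x)\<bar> \<le> 1" for x using d_bound[of n x] by auto
    have "norm (d n x * kern x) = d n x * kern x + 2 * (max 0 (- d n x) * kern x)" for x
      using kern_nonneg[of x] by (auto simp: abs_mult max_def)
    then show ?thesis
      using kint[OF d_meas d_bound, of n] kint[of "\<lambda>x. max 0 (- d n x)", OF _ b] by simp
  qed
  then have "(\<lambda>n. \<integral>x. norm (d n x * kern x) \<partial>lborel) \<longlonglongrightarrow> 0"
    using tendsto_add[OF lim1 tendsto_mult_left[OF lim2, of 2]] by simp
  then obtain r :: "nat \<Rightarrow> nat" where r: "strict_mono r" "AE x in lborel. (\<lambda>n. d (r n) x * kern x) \<longlonglongrightarrow> 0"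
    using tendsto_L1_AE_subseq[of lborel "\<lambda>n x. d n x * kern x"] kint[OF d_meas d_bound] by blast
  obtain b where b: "0 \<le> b" "\<And>x. b \<le> x \<Longrightarrow> g x < 1" using eventually_g_less_1 by blast
  have ae: "AE x in lborel. b \<le> x \<longrightarrow> (\<lambda>n. u (t (r n) - x)) \<longlonglongrightarrow> L"
    using r(2)
  proof eventually_elim
    fix x assume lim: "(\<lambda>n. d (r n) x * kern x) \<longlonglongrightarrow> 0"
    show "b \<le> x \<longrightarrow> (\<lambda>n. u (t (r n) - x)) \<longlonglongrightarrow> L"
    proof
      assume "b \<le> x"
      have "0 < expd x * (1 - g x)"
        using b \<open>b \<le> x\<close> lam by (simp add: expd_def exponential_density_def)
      then have "0 < kern x" using kern_ge[of x] b \<open>b \<le> x\<close> by linarith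
      then have "(\<lambda>n. d (r n) x) \<longlonglongrightarrow> 0"
        using tendsto_divide[OF lim tendsto_const[of "kern x"]] by simp
      then have "(\<lambda>n. L - \<sigma> * d (r n) x) \<longlonglongrightarrow> L - \<sigma> * 0" by (intro tendsto_intros)
      then show "(\<lambda>n. u (t (r n) - x)) \<longlonglongrightarrow> L"
        by (simp add: d_def right_diff_distrib \<sigma>2)
    qed
  qed
  \<comment> \<open>Going back by some \<open>x0 \<ge> b\<close> makes \<open>x0 + s \<ge> b\<close>
    for all \<open>s \<ge> 0\<close>, so convergence holds at almost all arguments of the
    convolution.\<close>
  have "\<exists>x0\<ge>b. (\<lambda>n. u (t (r n) - x0)) \<longlonglongrightarrow> L"
  proof (rule ccontr)
    assume neg: "\<not> ?thesis"
    have "AE x in lborel. x \<notin> {b<..<b + 1}" using ae by eventually_elim (use neg in auto)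
    then have "{b<..<b + 1} \<in> null_sets lborel"
      by (subst AE_iff_null_sets) auto
    then have "emeasure lborel {b<..<b + 1} = 0" by (rule null_setsD1)
    then show False by (subst (asm) emeasure_lborel_Ioo) auto
  qed
  then obtain x0 where x0: "b \<le> x0" "(\<lambda>n. u (t (r n) - x0)) \<longlonglongrightarrow> L" by blast
  have t_x0: "filterlim (\<lambda>n. t (r n) - x0) at_top sequentially"
    using filterlim_compose[OF t_shift[of x0] filterlim_subseq[OF r(1)]] .
  have "(\<lambda>n. \<integral>s. u (t (r n) - x0 - s) * g s \<partial>lborel) \<longlonglongrightarrow> (\<integral>s. L * g s \<partial>lborel)"
  proof (rule integral_dominated_convergence[where w = g])
    show "AE s in lborel. (\<lambda>n. u (t (r n) - x0 - s) * g s) \<longlonglongrightarrow> L * g s"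
      using AE_lborel_shift[OF ae, of x0]
    proof eventually_elim
      fix s assume *: "b \<le> x0 + s \<longrightarrow> (\<lambda>n. u (t (r n) - (x0 + s))) \<longlonglongrightarrow> L"
      show "(\<lambda>n. u (t (r n) - x0 - s) * g s) \<longlonglongrightarrow> L * g s"
      proof (cases "0 \<le> s")
        case True
        then have "(\<lambda>n. u (t (r n) - x0 - s)) \<longlonglongrightarrow> L"
          using * x0 by (simp add: diff_diff_eq)
        then show ?thesis by (rule tendsto_mult_right)
      qed (simp add: g_neg)
    qed
    show "AE s in lborel. norm (u (t (r n) - x0 - s) * g s) \<le> g s" for n
      using u_bounds g_bounds by (auto simp: abs_mult intro!: mult_left_le_one_le)
  qed (use g_int in auto)
  then have lim: "(\<lambda>n. u (t (r n) - x0) + lam * (\<integral>s. u (t (r n) - x0 - s) * g s \<partial>lborel))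
      \<longlonglongrightarrow> L + lam * (\<integral>s. L * g s \<partial>lborel)"
    by (intro tendsto_intros x0)
  have "\<forall>\<^sub>F n in sequentially. u (t (r n) - x0) + lam * (\<integral>s. u (t (r n) - x0 - s) * g s \<partial>lborel) = 1"
    using filterlim_at_top[THEN iffD1, OF t_x0, rule_format, of 0]
    by eventually_elim (rule eq)
  from tendsto_cong[OF this] lim have "(\<lambda>n. 1) \<longlonglongrightarrow> L + lam * (\<integral>s. L * g s \<partial>lborel)" by simp
  then have "L + lam * (\<integral>s. L * g s \<partial>lborel) = 1" by (simp add: LIMSEQ_const_iff)
  then show ?thesis by (simp add: algebra_simps)
qed

text \<open>Limit superior and limit inferior solve the same linear equation, hence agree.\<close>

theorem tendsto_u: "(u \<longlongrightarrow> 1 / (1 + lam * (\<integral>x. g x \<partial>lborel))) at_top"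
proof -
  let ?l = "1 / (1 + lam * (\<integral>x. g x \<partial>lborel))"
  have "0 \<le> (\<integral>x. g x \<partial>lborel)" by (intro Bochner_Integration.integral_nonneg) (simp add: g_bounds)
  then have pos: "0 < 1 + lam * (\<integral>x. g x \<partial>lborel)"
    using lam by (intro add_pos_nonneg) auto
  have *: "\<forall>\<^sub>F t in at_top. \<sigma> * u t \<le> \<sigma> * ?l + e" if \<sigma>: "\<sigma> = 1 \<or> \<sigma> = -1" and "0 < e" for \<sigma> e :: real
  proof -
    have "\<bar>\<sigma> * u t\<bar> \<le> 1" for t using \<sigma> u_bounds[of t] by auto
    then obtain L t where Lt: "filterlim t at_top sequentially" "(\<lambda>n. \<sigma> * u (t n)) \<longlonglongrightarrow> L"
      "\<And>e. 0 < e \<Longrightarrow> \<forall>\<^sub>F t in at_top. \<sigma> * u t \<le> L + e"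
      using limsup_sequence[of "\<lambda>t. \<sigma> * u t" 1] by metis
    have \<sigma>2: "\<sigma> * (\<sigma> * x) = x" for x using \<sigma> by auto
    have "(\<lambda>n. u (t n)) \<longlonglongrightarrow> \<sigma> * L" using tendsto_mult_left[OF Lt(2), of \<sigma>] by (simp add: \<sigma>2)
    then have "\<sigma> * L * (1 + lam * (\<integral>x. g x \<partial>lborel)) = 1"
      by (rule extremal_limit[OF Lt(1) _ \<sigma>]) (use Lt(3) in \<open>simp add: \<sigma>2\<close>)
    then have "\<sigma> * L = ?l" using pos by (simp add: field_simps)
    then have "L = \<sigma> * ?l" using \<sigma>2[of L] by simp
    then show ?thesis using Lt(3)[OF \<open>0 < e\<close>] by simp
  qed
  show ?thesis
  proof (rule tendstoI)
    fix e :: real assume "0 < e"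
    then have "0 < e / 2" by simp
    from *[of 1, OF _ this] *[of "-1", OF _ this]
    have "\<forall>\<^sub>F t in at_top. u t \<le> ?l + e / 2" "\<forall>\<^sub>F t in at_top. - u t \<le> - ?l + e / 2"
      by simp_all
    then show "\<forall>\<^sub>F t in at_top. dist (u t) ?l < e"
      by eventually_elim (use \<open>0 < e\<close> in \<open>simp add: dist_real_def abs_less_iff\<close>)
  qed
qed

end

section \<open>Truncated Poisson means\<close>

text \<open>\<open>capped_mean r m x\<close> is the mean of \<open>min N m\<close> for a Poisson variable \<open>N\<close> with mean \<open>r * x\<close>; its
  derivative \<open>capped_rate r m x\<close> is \<open>r\<close> times the probability of \<open>N < m\<close>.\<close>

definition capped_mean :: "real \<Rightarrow> nat \<Rightarrow> real \<Rightarrow> real" where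
  "capped_mean r m x = (\<Sum>l<m. 1 - exp (- (r * x)) * (\<Sum>a\<le>l. (r * x) ^ a / fact a))"

definition capped_rate :: "real \<Rightarrow> nat \<Rightarrow> real \<Rightarrow> real" where
  "capped_rate r m x = r * exp (- (r * x)) * (\<Sum>a<m. (r * x) ^ a / fact a)"

lemma capped_mean_eq_erlang_CDF: "0 \<le> x \<Longrightarrow> capped_mean r m x = (\<Sum>l<m. erlang_CDF l r x)"
  unfolding capped_mean_def erlang_CDF_def
  by (intro sum.cong refl) (simp add: sum_distrib_left mult.commute sum_divide_distrib)

text \<open>Differentiating a power cancels what the exponential factor produces from the preceding
  power, so only the last power survives.\<close>

lemma DERIV_exp_partial_sum:
  "((\<lambda>x. exp (- (r * x)) * (\<Sum>a\<le>l. (r * x) ^ a / fact a)) has_real_derivative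
    - r * exp (- (r * x)) * ((r * x) ^ l / fact l)) (at x)"
proof (induction l)
  case 0
  show ?case by (auto intro!: derivative_eq_intros)
next
  case (Suc l)
  have "((\<lambda>x. exp (- (r * x)) * ((r * x) ^ Suc l / fact (Suc l))) has_real_derivative
      exp (- (r * x)) * (- r) * ((r * x) ^ Suc l / fact (Suc l)) +
      real (Suc l) * (r * x) ^ l * r / fact (Suc l) * exp (- (r * x))) (at x)"
    by (rule derivative_eq_intros refl | simp)+
  also have "real (Suc l) * (r * x) ^ l * r / fact (Suc l) = r * ((r * x) ^ l / fact l)"
    by (simp add: field_simps del: of_nat_Suc)
  finally have "((\<lambda>x. exp (- (r * x)) * (\<Sum>a\<le>l. (r * x) ^ a / fact a) + exp (- (r * x)) * ((r * x) ^ Suc l / fact (Suc l)))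
      has_real_derivative - r * exp (- (r * x)) * ((r * x) ^ l / fact l) +
      (exp (- (r * x)) * (- r) * ((r * x) ^ Suc l / fact (Suc l)) + r * ((r * x) ^ l / fact l) * exp (- (r * x)))) (at x)"
    by (intro DERIV_add Suc)
  then show ?case by (simp add: algebra_simps del: fact_Suc power_Suc)
qed

lemma DERIV_capped_mean: "(capped_mean r m has_real_derivative capped_rate r m x) (at x)"
proof -
  have "((\<lambda>x. \<Sum>l<m. 1 - exp (- (r * x)) * (\<Sum>a\<le>l. (r * x) ^ a / fact a)) has_real_derivative
      (\<Sum>l<m. 0 - (- r * exp (- (r * x)) * ((r * x) ^ l / fact l)))) (at x)"
    by (intro DERIV_sum DERIV_diff DERIV_const DERIV_exp_partial_sum)
  then show ?thesis
    by (simp add: capped_mean_def[abs_def] capped_rate_def sum_distrib_left)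
qed

text \<open>The increment of \<open>capped_mean\<close> from \<open>m\<close> to
  \<open>m + 1\<close> is the probability of more than \<open>m\<close> arrivals.\<close>

lemma capped_rate_eq: "capped_rate r (Suc m) x = r * (1 + capped_mean r m x - capped_mean r (Suc m) x)"
proof -
  have "capped_mean r (Suc m) x = capped_mean r m x + (1 - exp (- (r * x)) * (\<Sum>a\<le>m. (r * x) ^ a / fact a))"
    by (simp add: capped_mean_def)
  then show ?thesis by (simp add: capped_rate_def lessThan_Suc_atMost)
qed

text \<open>In this form the derivative couples neighbouring caps; it becomes the arrival term in
  \<open>capped_eq\<close>.\<close>

lemma DERIV_capped_rate:
  "(capped_rate r (Suc m) has_real_derivative r * (capped_rate r m x - capped_rate r (Suc m) x)) (at x)"
proof -
  have "((\<lambda>x. r * (1 + capped_mean r m x - capped_mean r (Suc m) x)) has_real_derivative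
      r * (0 + capped_rate r m x - capped_rate r (Suc m) x)) (at x)"
    by (intro DERIV_cmult DERIV_diff DERIV_add DERIV_const DERIV_capped_mean)
  then show ?thesis by (simp add: capped_rate_eq[abs_def])
qed

lemma capped_rate_0 [simp]: "capped_rate r 0 x = 0"
  by (simp add: capped_rate_def)

lemma capped_mean_0 [simp]: "capped_mean r 0 x = 0"
  by (simp add: capped_mean_def)

lemma capped_mean_at_0 [simp]: "capped_mean r m 0 = 0"
proof -
  have "(\<Sum>a\<le>l. (0 :: real) ^ a / fact a) = 1" for l by (induction l) simp_all
  then show ?thesis by (simp add: capped_mean_def)
qed

lemma capped_rate_at_0: "capped_rate r (Suc m) 0 = r"
  by (simp add: capped_rate_eq)

lemma capped_rate_antimono:
  assumes "0 \<le> r" "0 \<le> x" "x \<le> y"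
  shows "capped_rate r m y \<le> capped_rate r m x"
proof (cases m)
  case (Suc l)
  show ?thesis
  proof (rule DERIV_nonpos_imp_nonincreasing[OF \<open>x \<le> y\<close>])
    fix z assume "x \<le> z" "z \<le> y"
    then have "0 \<le> z" using assms by simp
    have "capped_rate r l z \<le> capped_rate r m z"
      unfolding capped_rate_def Suc using assms \<open>0 \<le> z\<close> by (intro mult_left_mono) auto
    then have "r * (capped_rate r l z - capped_rate r m z) \<le> 0"
      using assms by (intro mult_nonneg_nonpos) auto
    then show "\<exists>y. (capped_rate r m has_real_derivative y) (at z) \<and> y \<le> 0"
      using DERIV_capped_rate[of r l z] Suc by blast
  qed
qed simp

lemma capped_rate_nonneg: "0 \<le> r \<Longrightarrow> 0 \<le> x \<Longrightarrow> 0 \<le> capped_rate r m x"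
  unfolding capped_rate_def by (intro mult_nonneg_nonneg sum_nonneg) auto

lemma capped_rate_le: "0 \<le> r \<Longrightarrow> 0 \<le> x \<Longrightarrow> capped_rate r m x \<le> r"
  by (cases m) (use capped_rate_antimono[of r 0 x m] capped_rate_at_0 in \<open>auto simp: le_less\<close>)

lemma concave_capped_mean:
  assumes "0 \<le> r"
  shows "convex_on {0..} (\<lambda>x. - capped_mean r m x)"
proof (rule convex_on_realI)
  show "((\<lambda>x. - capped_mean r m x) has_real_derivative - capped_rate r m x) (at x)" for x
    by (intro DERIV_minus DERIV_capped_mean)
qed (use capped_rate_antimono[OF assms] in auto)

lemma capped_mean_bounds:
  assumes "0 < r" "0 \<le> x"
  shows "0 \<le> capped_mean r m x" "capped_mean r m x \<le> real m"
proof -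
  have "erlang_CDF l r x \<le> 1" for l
    using assms by (auto simp: erlang_CDF_def intro!: sum_nonneg)
  then have "(\<Sum>l<m. erlang_CDF l r x) \<le> (\<Sum>l<m. 1)" by (intro sum_mono)
  then show "0 \<le> capped_mean r m x" "capped_mean r m x \<le> real m"
    using assms by (simp_all add: capped_mean_eq_erlang_CDF sum_nonneg)
qed

text \<open>The contact point 1 is the mean job size, so integrating the tangent over a job size law
  leaves just its value at 1: this is Jensen's inequality.\<close>

lemma capped_mean_tangent:
  assumes "0 \<le> r" "0 \<le> x"
  shows "capped_mean r m x \<le> capped_mean r m 1 + capped_rate r m 1 * (x - 1)"
proof -
  have "- capped_rate r m 1 * (x - 1) \<le> - capped_mean r m x - - capped_mean r m 1"
  proof (rule convex_on_imp_above_tangent[OF concave_capped_mean[OF assms(1)]])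
    show "((\<lambda>x. - capped_mean r m x) has_real_derivative - capped_rate r m 1) (at 1 within {0..})"
      by (intro DERIV_minus DERIV_subset[OF DERIV_capped_mean]) simp
  qed (use assms in \<open>auto simp: interior_real_atLeast\<close>)
  then show ?thesis by simp
qed

lemma continuous_on_capped_mean: "continuous_on A (capped_mean r m)"
  using DERIV_capped_mean by (intro continuous_at_imp_continuous_on ballI DERIV_isCont) blast

lemma borel_measurable_capped_mean [measurable]: "capped_mean r m \<in> borel_measurable borel"
  by (intro borel_measurable_continuous_onI continuous_on_capped_mean)

lemma borel_measurable_capped_rate [measurable]: "capped_rate r m \<in> borel_measurable borel"
  unfolding capped_rate_def[abs_def] by measurable

text \<open>Multiplication by \<open>1 - fps_X\<close> undoes partial summation, and the terms
  \<open>exp (- r) * r ^ a / fact a\<close> have the generating function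
  \<open>exp (r * (X - 1))\<close>.\<close>

lemma exp_partial_sum_fps:
  fixes r :: real
  shows "(1 - fps_X) * Abs_fps (\<lambda>l. 1 - exp (- r) * (\<Sum>a\<le>l. r ^ a / fact a)) = 1 - fps_const (exp (- r)) * fps_exp r"
proof (rule fps_ext)
  fix n
  show "fps_nth ((1 - fps_X) * Abs_fps (\<lambda>l. 1 - exp (- r) * (\<Sum>a\<le>l. r ^ a / fact a))) n = fps_nth (1 - fps_const (exp (- r)) * fps_exp r) n"
    by (cases n) (simp_all add: left_diff_distrib algebra_simps del: fact_Suc power_Suc)
qed

text \<open>With \<open>al = exp (r * (X - 1))\<close>, the generating function of the arrivals
  during a unit service, the recursion of \<open>served\<close> is solved by
  \<open>al / (al - X)\<close>. Written as \<open>1 / (1 - X * y)\<close> with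
  \<open>y = 1 / al\<close> this is a geometric series, and the powers of \<open>y\<close> are
  explicit exponentials.\<close>

lemma served_deterministic:
  fixes r :: real
  defines "q \<equiv> \<lambda>l. 1 - exp (- r) * (\<Sum>a\<le>l. r ^ a / fact a)"
  shows "served q N = (\<Sum>k\<le>N. (- 1) ^ k / fact k * real (N - k) ^ k * exp (real (N - k) * r) * r ^ k)"
proof -
  define y where "y = fps_const (exp r) * fps_exp (- r)"
  define al where "al = fps_const (exp (- r)) * fps_exp r"
  define ga where "ga = Abs_fps (\<lambda>n. 1 :: real) oo (fps_X * y)"
  have al_y: "al * y = 1"
  proof -
    have "al * y = fps_const (exp (- r) * exp r) * (fps_exp r * fps_exp (- r))"
      unfolding al_def y_def fps_const_mult[symmetric] by (simp only: ac_simps)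
    also have "\<dots> = 1" by (simp add: mult_exp_exp fps_exp_add_mult[symmetric])
    finally show ?thesis .
  qed
  have X0: "fps_nth (fps_X * y) 0 = 0" by simp
  have "ga * (1 - fps_X * y) = (Abs_fps (\<lambda>n. 1) * (1 - fps_X)) oo (fps_X * y)"
    unfolding ga_def by (simp add: fps_compose_mult_distrib[OF X0] fps_compose_sub_distrib fps_compose_1)
  also have "Abs_fps (\<lambda>n. 1 :: real) * (1 - fps_X) = 1"
  proof (rule fps_ext)
    fix n show "fps_nth (Abs_fps (\<lambda>n. 1 :: real) * (1 - fps_X)) n = fps_nth 1 n"
      by (cases n) (simp_all add: right_diff_distrib mult.commute[of _ fps_X])
  qed
  finally have "ga * (1 - fps_X * y) = 1" by (simp add: fps_compose_1)
  then have "ga - ga * (fps_X * y) = 1" by (simp only: right_diff_distrib mult_1_right)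
  then have ga_eq: "ga = 1 + ga * (fps_X * y)" by (simp only: diff_eq_eq)
  have "al * ga = al * (1 + ga * (fps_X * y))" using ga_eq by (rule arg_cong)
  also have "\<dots> = al + fps_X * (al * y) * ga" by (simp only: distrib_left mult_1_right mult_1_left ac_simps)
  finally have al_ga: "al * ga = al + fps_X * ga" by (simp only: al_y mult_1_right mult_1_left)
  define qf where "qf = Abs_fps q"
  have qf: "(1 - fps_X) * qf = 1 - al"
    unfolding qf_def q_def al_def by (rule exp_partial_sum_fps)
  have "(1 - fps_X) * ga = 1 + (1 - al) * (ga - 1)"
    using al_ga by (simp add: algebra_simps)
  also have "\<dots> = (1 - fps_X) * (Abs_fps (\<lambda>n. 1) + qf * (ga - 1))"
  proof -
    have "(1 - fps_X) * Abs_fps (\<lambda>n. 1 :: real) = 1"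
      using \<open>Abs_fps (\<lambda>n. 1 :: real) * (1 - fps_X) = 1\<close> by (simp only: mult.commute)
    then show ?thesis unfolding qf[symmetric] by (simp only: distrib_left mult.assoc)
  qed
  finally have eq: "(1 - fps_X) * ga = (1 - fps_X) * (Abs_fps (\<lambda>n. 1) + qf * (ga - 1))" .
  have nz: "(1 - fps_X :: real fps) \<noteq> 0"
  proof
    assume "(1 - fps_X :: real fps) = 0"
    then have "fps_nth (1 - fps_X :: real fps) 0 = fps_nth 0 0" by (rule arg_cong)
    then show False by simp
  qed
  have ga_rec: "ga = Abs_fps (\<lambda>n. 1) + qf * (ga - 1)"
    using eq unfolding mult_left_cancel[OF nz] .
  have ga_0: "fps_nth ga 0 = 1" by (simp add: ga_def fps_compose_nth_0)
  have rec: "fps_nth ga n = 1 + (\<Sum>l<n. q l * fps_nth ga (n - l))" for n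
  proof -
    have "fps_nth ga n = fps_nth (Abs_fps (\<lambda>n. 1) + qf * (ga - 1)) n" using ga_rec by (rule arg_cong)
    also have "\<dots> = 1 + (\<Sum>i=0..n. q i * fps_nth (ga - 1) (n - i))"
      by (simp add: fps_mult_nth qf_def)
    also have "(\<Sum>i=0..n. q i * fps_nth (ga - 1) (n - i)) = (\<Sum>l<n. q l * fps_nth (ga - 1) (n - l)) + q n * fps_nth (ga - 1) (n - n)"
      by (simp only: atLeast0AtMost lessThan_Suc_atMost[symmetric] sum.lessThan_Suc)
    also have "(\<Sum>l<n. q l * fps_nth (ga - 1) (n - l)) = (\<Sum>l<n. q l * fps_nth ga (n - l))"
      by (intro sum.cong refl) auto
    finally show ?thesis by (simp add: ga_0)
  qed
  have "served q N = fps_nth ga N"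
    by (rule served_unique[symmetric]) (simp add: q_def, rule rec)
  also have "\<dots> = (\<Sum>j\<le>N. fps_nth ((fps_X * y) ^ j) N)"
    by (simp add: ga_def fps_compose_nth atLeast0AtMost)
  also have "\<dots> = (\<Sum>j\<le>N. exp (real j * r) * ((- (real j * r)) ^ (N - j) / fact (N - j)))"
  proof (intro sum.cong refl)
    fix j assume "j \<in> {..N}"
    have "(fps_X * y) ^ j = fps_X ^ j * (fps_const (exp (real j * r)) * fps_exp (real j * (- r)))"
      unfolding y_def power_mult_distrib by (simp add: fps_const_power exp_of_nat_mult fps_exp_power_mult)
    then show "fps_nth ((fps_X * y) ^ j) N = exp (real j * r) * ((- (real j * r)) ^ (N - j) / fact (N - j))"
      using \<open>j \<in> {..N}\<close> by (simp add: fps_X_power_mult_nth)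
  qed
  also have "\<dots> = (\<Sum>k\<le>N. exp (real (N - k) * r) * ((- (real (N - k) * r)) ^ k / fact k))"
    by (rule sum.reindex_bij_witness[of _ "\<lambda>k. N - k" "\<lambda>k. N - k"]) auto
  also have "\<dots> = (\<Sum>k\<le>N. (- 1) ^ k / fact k * real (N - k) ^ k * exp (real (N - k) * r) * r ^ k)"
  proof (intro sum.cong refl)
    fix k
    have "(- (real (N - k) * r)) ^ k = (- 1) ^ k * real (N - k) ^ k * r ^ k"
      by (simp only: power_minus[of "real (N - k) * r"] power_mult_distrib mult.assoc)
    then show "exp (real (N - k) * r) * ((- (real (N - k) * r)) ^ k / fact k) = (- 1) ^ k / fact k * real (N - k) ^ k * exp (real (N - k) * r) * r ^ k"
      by simp
  qed
  finally show ?thesis .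
qed

section \<open>The remaining work found by an arrival\<close>

text \<open>Service is given in list order. A job whose remaining service is exactly
  \<open>x\<close> has left, in accordance with the strict \<open>t < snd j\<close> in
  \<open>jobs_present\<close>.\<close>

fun consume :: "real \<Rightarrow> real list \<Rightarrow> real list" where
  "consume x [] = []"
| "consume x (r # gs) = (if x < r then (r - x) # gs else consume (x - r) gs)"

lemma length_consume_le: "length (consume x gs) \<le> length gs"
  by (induction x gs rule: consume.induct) auto

lemma consume_nonneg:
  "0 \<le> x \<Longrightarrow> \<forall>r\<in>set gs. 0 \<le> r \<Longrightarrow> \<forall>r\<in>set (consume x gs). 0 \<le> r"
  by (induction x gs rule: consume.induct) auto

lemma sum_list_consume:
  "0 \<le> x \<Longrightarrow> \<forall>r\<in>set gs. 0 \<le> r \<Longrightarrow> sum_list (consume x gs) = max 0 (sum_list gs - x)"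
proof (induction x gs rule: consume.induct)
  case (2 x r gs)
  have "0 \<le> sum_list gs" using 2 by (intro sum_list_nonneg) auto
  then show ?case using 2 by (auto simp: max_def)
qed simp

lemma consume_eq_Nil_iff:
  "0 \<le> x \<Longrightarrow> \<forall>r\<in>set gs. 0 \<le> r \<Longrightarrow> consume x gs = [] \<longleftrightarrow> sum_list gs \<le> x"
proof (induction x gs rule: consume.induct)
  case (2 x r gs)
  have "0 \<le> sum_list gs" using 2 by (intro sum_list_nonneg) auto
  then show ?case using 2 by auto
qed simp

lemma list_measurable_consume:
  assumes "list_measurable M f" "x \<in> borel_measurable M" "\<And>w. length (f w) \<le> m"
  shows "list_measurable M (\<lambda>w. consume (x w) (f w))"
  using assms
proof (induction m arbitrary: f x)
  case 0
  then have "f w = []" for w by simp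
  then show ?case by (simp add: list_measurable_const)
next
  case (Suc m)
  note [measurable] = list_measurable_pred_Nil[OF Suc.prems(1)] list_measurable_hd[OF Suc.prems(1)] Suc.prems(2)
  have "list_measurable M (\<lambda>w. consume (x w - hd (f w)) (tl (f w)))"
    by (rule Suc.IH) (use Suc.prems(3) in \<open>simp_all add: list_measurable_tl[OF Suc.prems(1)] le_diff_conv\<close>)
  moreover have "list_measurable M (\<lambda>w. (hd (f w) - x w) # tl (f w))"
    by (intro list_measurable_Cons list_measurable_tl Suc.prems) measurable
  ultimately have "list_measurable M (\<lambda>w. if f w = [] then [] else
      if x w < hd (f w) then (hd (f w) - x w) # tl (f w) else consume (x w - hd (f w)) (tl (f w)))"
    by (intro list_measurable_If list_measurable_const) measurable
  moreover have "consume (x w) (f w) = (if f w = [] then [] else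
      if x w < hd (f w) then (hd (f w) - x w) # tl (f w) else consume (x w - hd (f w)) (tl (f w)))" for w
    by (cases "f w") auto
  ultimately show ?case by simp
qed

lemma erlang_CDF_le_1: "0 < l \<Longrightarrow> erlang_CDF k l x \<le> 1"
  by (auto simp: erlang_CDF_def intro!: sum_nonneg)

lemma borel_measurable_erlang_CDF [measurable]: "erlang_CDF k l \<in> borel_measurable borel"
  unfolding erlang_CDF_def[abs_def] by measurable

locale service_law =
  fixes lam :: real and S :: "real measure"
  assumes lam: "0 < lam" and prob_space_S: "prob_space S" and sets_S: "sets S = sets borel"
begin

sublocale S: prob_space S by (rule prob_space_S)

lemma measurable_S [simp]: "measurable S M = measurable borel M"
  by (rule measurable_cong_sets[OF sets_S refl])

text \<open>\<open>erlang_CDF l lam s\<close> is the probability that arrival number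
  \<open>l + 1\<close> occurs within time \<open>s\<close>; averaging over \<open>s\<close> gives
  the probability of more than \<open>l\<close> arrivals during a service.\<close>

definition arrivals_tail :: "nat \<Rightarrow> real" where
  "arrivals_tail l = (\<integral>s. erlang_CDF l lam s \<partial>S)"

lemma erlang_CDF_int: "integrable S (erlang_CDF l lam)"
  by (rule S.integrable_const_bound[of _ 1])
    (use lam in \<open>auto simp: erlang_CDF_le_1 abs_of_nonneg\<close>)

lemma arrivals_tail_nonneg: "0 \<le> arrivals_tail l"
  unfolding arrivals_tail_def using lam by (intro Bochner_Integration.integral_nonneg) simp

lemma arrivals_tail_0_less_1: "arrivals_tail 0 < 1"
proof -
  have "AE s in S. erlang_CDF 0 lam s < 1"
    using lam by (intro AE_I2) (simp add: erlang_CDF_def)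
  then show ?thesis unfolding arrivals_tail_def by (rule S.expectation_less[OF erlang_CDF_int])
qed

end

locale finite_queue = service_law +
  fixes n :: nat
  assumes n: "1 \<le> n"
begin

text \<open>The mean number of jobs served in the rest of the current busy period, not counting those whose
  remaining services are listed (job in service first), when \<open>i\<close> more jobs of unlisted service time
  wait behind them.\<close>

fun expected_joins :: "real list \<Rightarrow> nat \<Rightarrow> real" where
  "expected_joins [] i = (\<Sum>l<i. served arrivals_tail (n - 1 - l))"
| "expected_joins (r # gs) i = expected_joins gs i + (\<Sum>l<n - 1 - length gs - i.
      erlang_CDF l lam r * (expected_joins gs (i + l + 1) - expected_joins gs (i + l)))"

lemma expected_joins_measurable:
  assumes "list_measurable M f" "\<And>w. length (f w) \<le> m"
  shows "(\<lambda>w. expected_joins (f w) i) \<in> borel_measurable M"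
  using assms
proof (induction m arbitrary: f i)
  case 0
  then have "f w = []" for w by simp
  then show ?case by simp
next
  case (Suc m)
  note [measurable] = list_measurable_pred_Nil[OF Suc.prems(1)] list_measurable_hd[OF Suc.prems(1)]
    list_measurable_length[OF Suc.prems(1)]
  have [measurable]: "(\<lambda>w. expected_joins (tl (f w)) j) \<in> borel_measurable M" for j
    by (rule Suc.IH) (use Suc.prems(2) in \<open>simp_all add: list_measurable_tl[OF Suc.prems(1)] le_diff_conv\<close>)
  have [measurable]: "(\<lambda>w. (\<lambda>k w. \<Sum>l<n - 1 - (k - 1) - i. erlang_CDF l lam (hd (f w)) * (expected_joins (tl (f w)) (i + l + 1) - expected_joins (tl (f w)) (i + l)))
      (length (f w)) w) \<in> borel_measurable M"
    by (rule measurable_compose_countable) measurable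
  have "(\<lambda>w. if f w = [] then expected_joins [] i else expected_joins (tl (f w)) i + (\<Sum>l<n - 1 - (length (f w) - 1) - i.
      erlang_CDF l lam (hd (f w)) * (expected_joins (tl (f w)) (i + l + 1) - expected_joins (tl (f w)) (i + l)))) \<in> borel_measurable M"
    by measurable
  moreover have "expected_joins (f w) i = (if f w = [] then expected_joins [] i else expected_joins (tl (f w)) i + (\<Sum>l<n - 1 - (length (f w) - 1) - i.
      erlang_CDF l lam (hd (f w)) * (expected_joins (tl (f w)) (i + l + 1) - expected_joins (tl (f w)) (i + l))))" for w
    by (cases "f w") simp_all
  ultimately show ?case by simp
qed

lemma expected_joins_bounded: "\<exists>C. \<forall>gs i. length gs = m \<longrightarrow> i \<le> n \<longrightarrow> \<bar>expected_joins gs i\<bar> \<le> C"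
proof (induction m)
  case 0
  have "\<bar>expected_joins [] i\<bar> \<le> Max ((\<lambda>i. \<bar>expected_joins [] i\<bar>) ` {..n})" if "i \<le> n" for i
    by (rule Max_ge) (use that in auto)
  then show ?case by blast
next
  case (Suc m)
  then obtain C where C: "\<And>gs i. length gs = m \<Longrightarrow> i \<le> n \<Longrightarrow> \<bar>expected_joins gs i\<bar> \<le> C" by blast
  have "\<bar>expected_joins (r # gs) i\<bar> \<le> C + real n * (2 * C)" if gs: "length gs = m" and i: "i \<le> n" for r gs i
  proof -
    have C0: "0 \<le> C" using C[OF gs i] by linarith
    have "\<bar>\<Sum>l<n - 1 - length gs - i. erlang_CDF l lam r * (expected_joins gs (i + l + 1) - expected_joins gs (i + l))\<bar>
      \<le> (\<Sum>l<n - 1 - length gs - i. \<bar>erlang_CDF l lam r * (expected_joins gs (i + l + 1) - expected_joins gs (i + l))\<bar>)"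
      by (rule sum_abs)
    also have "\<dots> \<le> (\<Sum>l<n - 1 - length gs - i. 2 * C)"
    proof (rule sum_mono)
      fix l assume "l \<in> {..<n - 1 - length gs - i}"
      then have "\<bar>expected_joins gs (i + l + 1)\<bar> \<le> C" "\<bar>expected_joins gs (i + l)\<bar> \<le> C" by (intro C gs; simp)+
      then have "\<bar>expected_joins gs (i + l + 1) - expected_joins gs (i + l)\<bar> \<le> 2 * C" by linarith
      moreover have "\<bar>erlang_CDF l lam r\<bar> \<le> 1" using lam by (simp add: erlang_CDF_le_1)
      ultimately show "\<bar>erlang_CDF l lam r * (expected_joins gs (i + l + 1) - expected_joins gs (i + l))\<bar> \<le> 2 * C"
        unfolding abs_mult using mult_mono[of "\<bar>erlang_CDF l lam r\<bar>" 1 _ "2 * C"] by simp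
    qed
    also have "\<dots> \<le> real n * (2 * C)" using C0 by (auto intro!: mult_right_mono)
    finally show ?thesis using C[OF gs i] by simp
  qed
  then have "\<forall>gs i. length gs = Suc m \<longrightarrow> i \<le> n \<longrightarrow> \<bar>expected_joins gs i\<bar> \<le> C + real n * (2 * C)"
    by (metis length_Suc_conv)
  then show ?case by blast
qed

text \<open>The bound makes the prediction integrable along a path and controls it when the busy
  period dies out.\<close>

lemma expected_joins_bounded_uniform: "\<exists>C. \<forall>gs i. length gs \<le> n \<longrightarrow> i \<le> n \<longrightarrow> \<bar>expected_joins gs i\<bar> \<le> C"
proof -
  from expected_joins_bounded obtain C where C: "\<And>m gs i. length gs = m \<Longrightarrow> i \<le> n \<Longrightarrow> \<bar>expected_joins gs i\<bar> \<le> C m" by metis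
  have "\<bar>expected_joins gs i\<bar> \<le> Max (C ` {..n})" if "length gs \<le> n" "i \<le> n" for gs i
    by (rule order_trans[OF C[OF refl]]) (use that in auto)
  then show ?thesis by blast
qed

lemma expected_joins_snoc_int:
  assumes "length gs < n" "i \<le> n"
  shows "integrable S (\<lambda>s. expected_joins (gs @ [s]) i)"
proof -
  obtain C where C: "\<And>gs i. length gs \<le> n \<Longrightarrow> i \<le> n \<Longrightarrow> \<bar>expected_joins gs i\<bar> \<le> C"
    using expected_joins_bounded_uniform by blast
  have "(\<lambda>s. expected_joins (gs @ [s]) i) \<in> borel_measurable borel"
    by (rule expected_joins_measurable[of _ _ "Suc (length gs)"])
      (simp_all add: list_measurable_snoc list_measurable_const)
  then show ?thesis using C assms by (intro S.integrable_const_bound[of _ C]) auto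
qed

text \<open>Replacing an unlisted job by a listed one with averaged service time changes the count
  only by that job itself, hence the \<open>- 1\<close>. The sum in
  \<open>expected_joins (r # gs) i\<close> arises from the mean of \<open>expected_joins gs\<close>
  at \<open>i\<close> plus the arrivals during \<open>r\<close> that find room, written through the
  tails of their number. For the empty list the claim is \<open>served_rec\<close>.\<close>

lemma integral_expected_joins_snoc:
  "length gs + i < n \<Longrightarrow> (\<integral>s. expected_joins (gs @ [s]) i \<partial>S) = expected_joins gs (i + 1) - 1"
proof (induction gs arbitrary: i)
  case Nil
  have "(\<integral>s. expected_joins ([] @ [s]) i \<partial>S) = expected_joins [] i + (\<Sum>l<n - 1 - i. arrivals_tail l * served arrivals_tail (n - 1 - i - l))"
    using erlang_CDF_int by (simp add: arrivals_tail_def S.prob_space diff_diff_eq add.commute)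
  also have "(\<Sum>l<n - 1 - i. arrivals_tail l * served arrivals_tail (n - 1 - i - l)) = served arrivals_tail (n - 1 - i) - 1"
    using served_rec[of arrivals_tail "n - 1 - i", OF arrivals_tail_0_less_1] by simp
  finally show ?case by simp
next
  case (Cons r gs)
  have int: "integrable S (\<lambda>s. expected_joins (gs @ [s]) j)" if "j \<le> n" for j
    using Cons.prems that by (intro expected_joins_snoc_int) auto
  have "(\<integral>s. expected_joins ((r # gs) @ [s]) i \<partial>S) = (\<integral>s. expected_joins (gs @ [s]) i + (\<Sum>l<n - 2 - length gs - i.
      erlang_CDF l lam r * (expected_joins (gs @ [s]) (i + l + 1) - expected_joins (gs @ [s]) (i + l))) \<partial>S)"
    by (simp add: numeral_2_eq_2)
  also have "\<dots> = (\<integral>s. expected_joins (gs @ [s]) i \<partial>S) + (\<Sum>l<n - 2 - length gs - i.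
      erlang_CDF l lam r * ((\<integral>s. expected_joins (gs @ [s]) (i + l + 1) \<partial>S) - (\<integral>s. expected_joins (gs @ [s]) (i + l) \<partial>S)))"
  proof -
    have iX: "integrable S (\<lambda>s. erlang_CDF l lam r * (expected_joins (gs @ [s]) (i + l + 1) - expected_joins (gs @ [s]) (i + l)))"
      if "l \<in> {..<n - 2 - length gs - i}" for l
      using that by (intro integrable_mult_right Bochner_Integration.integrable_diff int) auto
    have "(\<integral>s. erlang_CDF l lam r * (expected_joins (gs @ [s]) (i + l + 1) - expected_joins (gs @ [s]) (i + l)) \<partial>S)
      = erlang_CDF l lam r * ((\<integral>s. expected_joins (gs @ [s]) (i + l + 1) \<partial>S) - (\<integral>s. expected_joins (gs @ [s]) (i + l) \<partial>S))"
      if "l \<in> {..<n - 2 - length gs - i}" for l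
      using that int[of "i + l + 1"] int[of "i + l"] by simp
    note eX = this
    have "(\<integral>s. expected_joins (gs @ [s]) i + (\<Sum>l<n - 2 - length gs - i.
        erlang_CDF l lam r * (expected_joins (gs @ [s]) (i + l + 1) - expected_joins (gs @ [s]) (i + l))) \<partial>S)
      = (\<integral>s. expected_joins (gs @ [s]) i \<partial>S) + (\<integral>s. (\<Sum>l<n - 2 - length gs - i.
        erlang_CDF l lam r * (expected_joins (gs @ [s]) (i + l + 1) - expected_joins (gs @ [s]) (i + l))) \<partial>S)"
      using Cons.prems
      by (intro Bochner_Integration.integral_add int Bochner_Integration.integrable_sum iX) auto
    also have "(\<integral>s. (\<Sum>l<n - 2 - length gs - i.
        erlang_CDF l lam r * (expected_joins (gs @ [s]) (i + l + 1) - expected_joins (gs @ [s]) (i + l))) \<partial>S)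
      = (\<Sum>l<n - 2 - length gs - i. \<integral>s.
        erlang_CDF l lam r * (expected_joins (gs @ [s]) (i + l + 1) - expected_joins (gs @ [s]) (i + l)) \<partial>S)"
      by (rule Bochner_Integration.integral_sum) (rule iX)
    also have "\<dots> = (\<Sum>l<n - 2 - length gs - i.
      erlang_CDF l lam r * ((\<integral>s. expected_joins (gs @ [s]) (i + l + 1) \<partial>S) - (\<integral>s. expected_joins (gs @ [s]) (i + l) \<partial>S)))"
      by (intro sum.cong refl) (rule eX)
    finally show ?thesis .
  qed
  also have "(\<Sum>l<n - 2 - length gs - i. erlang_CDF l lam r * ((\<integral>s. expected_joins (gs @ [s]) (i + l + 1) \<partial>S) - (\<integral>s. expected_joins (gs @ [s]) (i + l) \<partial>S)))
    = (\<Sum>l<n - 2 - length gs - i. erlang_CDF l lam r * (expected_joins gs (i + l + 2) - expected_joins gs (i + l + 1)))"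
    using Cons.prems by (intro sum.cong refl; subst Cons.IH, simp; subst Cons.IH, simp; simp add: numeral_2_eq_2)
  also have "(\<integral>s. expected_joins (gs @ [s]) i \<partial>S) = expected_joins gs (i + 1) - 1"
    using Cons.prems by (intro Cons.IH) simp
  finally show ?case by (simp add: numeral_2_eq_2)
qed

end

lemma has_bochner_integral_exponential_lessThan:
  assumes "0 < lam" "0 \<le> r"
  shows "has_bochner_integral lborel (\<lambda>x. exponential_density lam x * indicator {..<r} x) (erlang_CDF 0 lam r)"
proof -
  have "(\<integral>\<^sup>+x. ennreal (exponential_density lam x * indicator {..<r} x) \<partial>lborel)
    = (\<integral>\<^sup>+x. ennreal (exponential_density lam x) * indicator {..r} x \<partial>lborel)"
  proof (rule nn_integral_cong_AE)
    show "AE x in lborel. ennreal (exponential_density lam x * indicator {..<r} x)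
      = ennreal (exponential_density lam x) * indicator {..r} x"
      using AE_lborel_singleton[of r] by eventually_elim (auto simp: indicator_def)
  qed
  also have "\<dots> = ennreal (erlang_CDF 0 lam r)"
    by (rule nn_integral_erlang_density) (use assms in auto)
  finally show ?thesis
    using assms by (intro has_bochner_integral_nn_integral) (auto simp: erlang_CDF_def)
qed

text \<open>Conditioning on the first arrival at \<open>x\<close>: more than \<open>l + 1\<close>
  arrivals before \<open>r\<close> means more than \<open>l\<close> further ones in the remaining
  time \<open>r - x\<close>.\<close>

lemma has_bochner_integral_exponential_erlang_CDF:
  assumes lam: "0 < lam" and r: "0 \<le> r"
  shows "has_bochner_integral lborel
    (\<lambda>x. exponential_density lam x * indicator {..<r} x * erlang_CDF l lam (r - x)) (erlang_CDF (Suc l) lam r)"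
proof -
  define f where "f x = lam * exp (- lam * x) - lam * exp (- lam * r) * (\<Sum>a\<le>l. (lam * (r - x)) ^ a / fact a)" for x
  \<comment> \<open>An antiderivative of \<open>f\<close>: the exponentials of \<open>x\<close> and
    of \<open>r - x\<close> multiply to the constant \<open>exp (- lam * r)\<close>, so that apart
    from the density only powers of \<open>r - x\<close> remain.\<close>
  define F where "F x = - exp (- lam * x) + exp (- lam * r) * (\<Sum>a\<le>l. (lam * (r - x)) ^ Suc a / fact (Suc a))" for x
  have "(F has_real_derivative f x) (at x)" for x
  proof -
    have 1: "((\<lambda>x. (lam * (r - x)) ^ Suc a / fact (Suc a)) has_real_derivative - lam * ((lam * (r - x)) ^ a / fact a)) (at x)" for a
    proof -
      have "((\<lambda>x. (lam * (r - x)) ^ Suc a / fact (Suc a)) has_real_derivative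
          (real (Suc a) * (lam * (r - x)) ^ a * (- lam)) / fact (Suc a)) (at x)"
        by (rule derivative_eq_intros refl | simp)+
      also have "(real (Suc a) * (lam * (r - x)) ^ a * (- lam)) / fact (Suc a) = - lam * ((lam * (r - x)) ^ a / fact a)"
        by (simp add: field_simps del: of_nat_Suc)
      finally show ?thesis .
    qed
    have 2: "((\<lambda>x. - exp (- lam * x)) has_real_derivative lam * exp (- lam * x)) (at x)"
      by (auto intro!: derivative_eq_intros)
    have "(F has_real_derivative lam * exp (- lam * x) + exp (- lam * r) * (\<Sum>a\<le>l. - lam * ((lam * (r - x)) ^ a / fact a))) (at x)"
      unfolding F_def by (intro DERIV_add 2 DERIV_cmult DERIV_sum 1)
    also have "(\<Sum>a\<le>l. - lam * ((lam * (r - x)) ^ a / fact a)) = - lam * (\<Sum>a\<le>l. (lam * (r - x)) ^ a / fact a)"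
      by (simp only: sum_distrib_left)
    finally show ?thesis
      by (simp add: f_def algebra_simps)
  qed
  then have "has_bochner_integral lborel (\<lambda>x. f x * indicator {0..r} x) (F r - F 0)"
    using r by (intro has_bochner_integral_FTC_Icc_real)
      (auto simp: f_def intro!: continuous_intros)
  also have "F r - F 0 = erlang_CDF (Suc l) lam r"
    using r by (simp add: F_def erlang_CDF_def sum.atMost_Suc_shift sum_distrib_left algebra_simps power_mult_distrib del: sum.atMost_Suc)
  finally show ?thesis
  proof (rule has_bochner_integral_cong_AE[THEN iffD1, rotated 3])
    show "AE x in lborel. f x * indicator {0..r} x = exponential_density lam x * indicator {..<r} x * erlang_CDF l lam (r - x)"
      using AE_lborel_singleton[of r]
    proof eventually_elim
      fix x assume "x \<noteq> r"
      have "exp (- lam * x) * exp (- (lam * (r - x))) = exp (- lam * r)"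
        by (simp add: mult_exp_exp algebra_simps)
      note e = this
      have "(\<Sum>a\<le>l. (lam * (r - x)) ^ a * exp (- (lam * (r - x))) / fact a)
        = (\<Sum>a\<le>l. (lam * (r - x)) ^ a / fact a) * exp (- (lam * (r - x)))"
        unfolding sum_distrib_right by (intro sum.cong refl) simp
      moreover have "f x = lam * (exp (- lam * x) - (\<Sum>a\<le>l. (lam * (r - x)) ^ a / fact a) * exp (- lam * r))"
        by (simp add: f_def algebra_simps)
      ultimately have "f x = lam * exp (- lam * x) * (1 - (\<Sum>a\<le>l. (lam * (r - x)) ^ a * exp (- (lam * (r - x))) / fact a))"
        unfolding e[symmetric] by (simp only: right_diff_distrib mult_1_right mult_ac)
      then show "f x * indicator {0..r} x = exponential_density lam x * indicator {..<r} x * erlang_CDF l lam (r - x)"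
        using \<open>x \<noteq> r\<close> by (auto simp: indicator_def exponential_density_def erlang_CDF_def mult.commute)
    qed
  qed (auto simp: f_def)
qed

context finite_queue
begin

text \<open>The prediction at the next arrival, which finds the services \<open>c\<close>. If
  \<open>c\<close> is empty the busy period is over; otherwise the newcomer counts as one unlisted
  job, provided that there is room.\<close>

definition joins_after :: "real list \<Rightarrow> real" where
  "joins_after c = (if c = [] then 0 else expected_joins c (min 1 (n - length c)))"

text \<open>In mean the prediction does not change up to the next arrival. Either that arrival falls
  into the first service and then waits as an unlisted job, or by memorylessness the situation
  starts afresh with the list \<open>gs\<close>.\<close>

lemma integral_joins_after_consume:
  assumes "length gs \<le> n" "\<forall>r\<in>set gs. 0 \<le> r"
  shows "has_bochner_integral lborel (\<lambda>x. exponential_density lam x * joins_after (consume x gs)) (expected_joins gs 0)"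
  using assms
proof (induction gs)
  case Nil
  then show ?case by (simp add: joins_after_def has_bochner_integral_zero)
next
  case (Cons r gs)
  \<comment> \<open>\<open>c\<close> is the room behind the listed jobs. \<open>A\<close> covers an
    arrival during the service \<open>r\<close> and \<open>B\<close> one after it, where shifting
    the time axis by \<open>r\<close> costs the factor \<open>exp (- lam * r)\<close>.\<close>
  define c where "c = n - 1 - length gs"
  define A where "A x = exponential_density lam x * indicator {..<r} x * expected_joins ((r - x) # gs) (min 1 c)" for x
  define B where "B x = exponential_density lam (x - r) * joins_after (consume (x - r) gs)" for x
  have r: "0 \<le> r" using Cons.prems by simp
  note e0 = has_bochner_integral_exponential_lessThan[OF lam r]
  note e1 = has_bochner_integral_exponential_erlang_CDF[OF lam r]
  have "has_bochner_integral lborel (\<lambda>y. exponential_density lam y * joins_after (consume y gs)) (expected_joins gs 0)"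
    using Cons by simp
  then have B: "has_bochner_integral lborel B (expected_joins gs 0)"
    unfolding B_def by (subst lborel_has_bochner_integral_real_affine_iff[of 1 _ _ r]) simp_all
  have A: "has_bochner_integral lborel A (expected_joins (r # gs) 0 - exp (- lam * r) * expected_joins gs 0)"
  proof (cases "c = 0")
    case True
    have "A = (\<lambda>x. exponential_density lam x * indicator {..<r} x * expected_joins gs 0)"
      using True by (simp add: A_def c_def fun_eq_iff)
    moreover have "expected_joins (r # gs) 0 - exp (- lam * r) * expected_joins gs 0 = erlang_CDF 0 lam r * expected_joins gs 0"
      using True r by (simp add: c_def erlang_CDF_def algebra_simps)
    ultimately show ?thesis using has_bochner_integral_mult_left[OF e0, of "expected_joins gs 0"] by simp
  next
    case False
    then obtain d where d: "c = Suc d" by (cases c) auto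
    have "A = (\<lambda>x. exponential_density lam x * indicator {..<r} x * expected_joins gs 1
        + (\<Sum>l<d. exponential_density lam x * indicator {..<r} x * erlang_CDF l lam (r - x) * (expected_joins gs (l + 2) - expected_joins gs (l + 1))))"
      using d by (simp add: A_def c_def fun_eq_iff sum_distrib_left algebra_simps)
    moreover have "has_bochner_integral lborel \<dots> (erlang_CDF 0 lam r * expected_joins gs 1
        + (\<Sum>l<d. erlang_CDF (Suc l) lam r * (expected_joins gs (l + 2) - expected_joins gs (l + 1))))"
      by (intro has_bochner_integral_add has_bochner_integral_sum has_bochner_integral_mult_left e0 e1)
    moreover have "erlang_CDF 0 lam r * expected_joins gs 1 + (\<Sum>l<d. erlang_CDF (Suc l) lam r * (expected_joins gs (l + 2) - expected_joins gs (l + 1)))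
      = expected_joins (r # gs) 0 - exp (- lam * r) * expected_joins gs 0"
    proof -
      have "expected_joins (r # gs) 0 = expected_joins gs 0 + (\<Sum>l<Suc d. erlang_CDF l lam r * (expected_joins gs (l + 1) - expected_joins gs l))"
        using d by (simp add: c_def)
      also have "\<dots> = expected_joins gs 0 + erlang_CDF 0 lam r * (expected_joins gs 1 - expected_joins gs 0)
          + (\<Sum>l<d. erlang_CDF (Suc l) lam r * (expected_joins gs (l + 2) - expected_joins gs (l + 1)))"
        by (subst sum.lessThan_Suc_shift) simp
      also have "erlang_CDF 0 lam r = 1 - exp (- lam * r)"
        using r by (simp add: erlang_CDF_def)
      finally show ?thesis using r by (simp add: erlang_CDF_def algebra_simps)
    qed
    ultimately show ?thesis by simp
  qed
  have "exponential_density lam x * joins_after (consume x (r # gs)) = A x + exp (- lam * r) * B x" for x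
  proof (cases "x < r")
    case True
    then show ?thesis
      by (simp add: A_def B_def joins_after_def c_def exponential_density_def)
  next
    case False
    have "exp (- (x * lam)) = exp (- (lam * r)) * exp (- ((x - r) * lam))"
      by (simp add: mult_exp_exp algebra_simps)
    then show ?thesis
      using False r by (simp add: A_def B_def exponential_density_def algebra_simps)
  qed
  then show ?case
    using has_bochner_integral_add[OF A has_bochner_integral_mult_right[OF B, of "exp (- lam * r)"]] by simp
qed

end

section \<open>Sample paths\<close>

text \<open>\<open>backlog n w k\<close> lists the remaining services, job in service first, right after the arrival of
  job \<open>k\<close>; \<open>alive\<close> and \<open>busy_until\<close> refer to the busy period started by job 0, with time counted from its
  arrival.\<close>

definition admit :: "nat \<Rightarrow> real \<Rightarrow> real list \<Rightarrow> real list" where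
  "admit n s gs = (if length gs < n then gs @ [s] else gs)"

primrec backlog :: "nat \<Rightarrow> (nat \<Rightarrow> real \<times> real) \<Rightarrow> nat \<Rightarrow> real list" where
  "backlog n w 0 = admit n (snd (w 0)) []"
| "backlog n w (Suc k) = admit n (snd (w (Suc k))) (consume (fst (w (Suc k))) (backlog n w k))"

definition good_path :: "(nat \<Rightarrow> real \<times> real) \<Rightarrow> bool" where
  "good_path w \<longleftrightarrow> (\<forall>i. 0 < fst (w i) \<and> 0 \<le> snd (w i)) \<and> (\<forall>t. \<exists>k. t < arrival_time w k)"

lemma good_pathD:
  assumes "good_path w"
  shows "0 < fst (w i)" "0 \<le> fst (w i)" "0 \<le> snd (w i)"
  using assms by (auto simp: good_path_def less_imp_le)

primrec departures :: "real \<Rightarrow> real list \<Rightarrow> real list" where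
  "departures a [] = []"
| "departures a (r # gs) = (a + r) # departures (a + r) gs"

lemma departures_eq_Nil_iff [simp]: "departures a gs = [] \<longleftrightarrow> gs = []"
  by (cases gs) auto

lemma length_departures [simp]: "length (departures a gs) = length gs"
  by (induction gs arbitrary: a) auto

lemma departures_ge: "\<forall>r\<in>set gs. 0 \<le> r \<Longrightarrow> d \<in> set (departures a gs) \<Longrightarrow> a \<le> d"
  by (induction gs arbitrary: a) fastforce+

lemma last_departures: "gs \<noteq> [] \<Longrightarrow> last (departures a gs) = a + sum_list gs"
  by (induction gs arbitrary: a) auto

lemma departures_snoc: "departures a (gs @ [s]) = departures a gs @ [a + sum_list gs + s]"
  by (induction gs arbitrary: a) auto

text \<open>Ties the two descriptions of the queue together: departure times on the one hand,
  remaining services on the other.\<close>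

lemma filter_departures:
  "0 \<le> x \<Longrightarrow> \<forall>r\<in>set gs. 0 \<le> r \<Longrightarrow> filter (\<lambda>d. a + x < d) (departures a gs) = departures (a + x) (consume x gs)"
proof (induction x gs arbitrary: a rule: consume.induct)
  case (2 x r gs)
  show ?case
  proof (cases "x < r")
    case True
    have "filter (\<lambda>d. a + x < d) (departures (a + r) gs) = departures (a + r) gs"
      using departures_ge[of gs _ "a + r"] 2(3) True by (intro filter_True) fastforce
    then show ?thesis using True by simp
  next
    case False
    then show ?thesis using 2(1)[of "a + r"] 2(2,3) by simp
  qed
qed simp

lemma admit_nonneg: "0 \<le> s \<Longrightarrow> \<forall>r\<in>set gs. 0 \<le> r \<Longrightarrow> \<forall>r\<in>set (admit n s gs). 0 \<le> r"
  by (simp add: admit_def)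

lemma backlog_nonneg: "good_path w \<Longrightarrow> \<forall>r\<in>set (backlog n w k). 0 \<le> r"
proof (induction k)
  case 0
  then show ?case unfolding backlog.simps by (intro admit_nonneg) (auto dest: good_pathD)
next
  case (Suc k)
  then show ?case unfolding backlog.simps by (intro admit_nonneg consume_nonneg) (auto dest: good_pathD)
qed

lemma length_backlog: "length (backlog n w k) \<le> n"
proof (induction k)
  case (Suc k)
  then show ?case using length_consume_le[of "fst (w (Suc k))" "backlog n w k"] by (auto simp: admit_def)
qed (simp add: admit_def)

lemma arrival_time_Suc: "arrival_time w (Suc k) = arrival_time w k + fst (w (Suc k))"
  by (simp add: arrival_time_def)

lemma arrival_time_strict_mono: "good_path w \<Longrightarrow> strict_mono (arrival_time w)"
  by (rule strict_monoI_Suc) (simp add: arrival_time_Suc good_pathD)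

lemma last_filter_sorted:
  fixes xs :: "'a::linorder list"
  assumes "sorted xs" "filter (\<lambda>d. y < d) xs \<noteq> []"
  shows "y < last xs" "last (filter (\<lambda>d. y < d) xs) = last xs"
proof -
  from assms(2) have "xs \<noteq> []" by auto
  then obtain ys z where xs: "xs = ys @ [z]" by (metis rev_exhaust)
  show "y < last xs" using assms unfolding xs
    by (auto simp: sorted_append filter_empty_conv split: if_splits dest: less_le_trans)
  then show "last (filter (\<lambda>d. y < d) xs) = last xs" by (simp add: xs)
qed

lemma admitted_backlog:
  assumes w: "good_path w"
  shows "sorted (map snd (admitted n w (Suc k))) \<and>
    (\<forall>y\<ge>arrival_time w k. filter (\<lambda>d. y < d) (map snd (admitted n w (Suc k)))
      = filter (\<lambda>d. y < d) (departures (arrival_time w k) (backlog n w k)))"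
proof (induction k)
  case 0
  then show ?case by (simp add: admit_def Let_def)
next
  case (Suc k)
  define D where "D = map snd (admitted n w (Suc k))"
  define a where "a = arrival_time w (Suc k)"
  define c where "c = consume (fst (w (Suc k))) (backlog n w k)"
  define s where "s = snd (w (Suc k))"
  have s: "0 \<le> s" using w by (simp add: s_def good_pathD)
  have sorted: "sorted D" and IH: "\<And>y. arrival_time w k \<le> y \<Longrightarrow>
      filter (\<lambda>d. y < d) D = filter (\<lambda>d. y < d) (departures (arrival_time w k) (backlog n w k))"
    using Suc by (auto simp: D_def)
  have a_ge: "arrival_time w k \<le> a" using w by (simp add: a_def arrival_time_Suc good_pathD)
  have fil: "filter (\<lambda>d. a < d) D = departures a c"
    unfolding IH[OF a_ge] unfolding a_def c_def arrival_time_Suc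
    using w by (intro filter_departures backlog_nonneg) (auto dest: good_pathD)
  have filter_D: "filter (\<lambda>d. y < d) D = filter (\<lambda>d. y < d) (departures a c)" if "a \<le> y" for y
    unfolding fil[symmetric] using that by (auto intro!: filter_cong)
  have len: "length (filter (\<lambda>j. a < snd j) (admitted n w (Suc k))) = length c"
  proof -
    have "length (filter (\<lambda>d. a < d) D) = length c" unfolding fil by simp
    then show ?thesis by (simp add: D_def filter_map comp_def)
  qed
  define start where "start = (if admitted n w (Suc k) = [] then a else max a (snd (last (admitted n w (Suc k)))))"
  have start_D: "start = (if D = [] then a else max a (last D))"
    by (simp add: start_def D_def last_map)
  have start: "start = a + sum_list c"
  proof (cases "c = []")
    case True
    then have "filter (\<lambda>d. a < d) D = []" using fil by simp
    then have "last D \<le> a" if "D \<noteq> []"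
      using last_in_set[OF that] by (auto simp: filter_empty_conv not_less)
    then show ?thesis using True by (auto simp: start_D)
  next
    case False
    then have ne: "filter (\<lambda>d. a < d) D \<noteq> []" using fil by simp
    note last = last_filter_sorted[OF sorted ne]
    have "last D = a + sum_list c" using last(2) fil last_departures[OF False, of a] by simp
    then show ?thesis using last(1) ne by (auto simp: start_D)
  qed
  have step: "map snd (admitted n w (Suc (Suc k))) = (if length c < n then D @ [a + sum_list c + s] else D)"
    unfolding admitted.simps(2)[of n w "Suc k"] Let_def a_def[symmetric] start_def[symmetric] len start
    by (simp add: D_def s_def)
  have backlog_Suc: "backlog n w (Suc k) = (if length c < n then c @ [s] else c)"
    by (simp add: c_def s_def admit_def)
  have "d \<le> a + sum_list c" if "d \<in> set D" for d
  proof -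
    have "d \<le> last D" using sorted that
      by (cases D rule: rev_cases) (auto simp: sorted_append)
    then show ?thesis using start start_D that by (auto split: if_splits)
  qed
  then have "sorted (map snd (admitted n w (Suc (Suc k))))"
    unfolding step using sorted s by (fastforce simp: sorted_append)
  moreover have "filter (\<lambda>d. y < d) (map snd (admitted n w (Suc (Suc k))))
      = filter (\<lambda>d. y < d) (departures a (backlog n w (Suc k)))" if "a \<le> y" for y
    unfolding step backlog_Suc by (simp add: departures_snoc filter_D[OF that])
  ultimately show ?case unfolding a_def by blast
qed

lemma admitted_mono: "i \<le> j \<Longrightarrow> set (admitted n w i) \<subseteq> set (admitted n w j)"
  by (induction rule: dec_induct) (auto simp: Let_def)

lemma fst_admitted: "j \<in> set (admitted n w k) \<Longrightarrow> \<exists>i<k. fst j = arrival_time w i"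
  by (induction k) (auto simp: Let_def less_Suc_eq split: if_splits)

text \<open>Jobs beyond the first \<open>k\<close> arrive after time \<open>t\<close>, so the union
  over all \<open>k\<close> in \<open>jobs_present\<close> is attained at one index.\<close>

lemma admitted_arrived:
  assumes w: "good_path w" and "t < arrival_time w k" "j \<in> set (admitted n w i)" "fst j \<le> t"
  shows "j \<in> set (admitted n w k)"
  using assms(3)
proof (induction i)
  case (Suc i)
  show ?case
  proof (cases "j \<in> set (admitted n w i)")
    case False
    then have "fst j = arrival_time w i" using Suc by (auto simp: Let_def split: if_splits)
    then have "arrival_time w i < arrival_time w k" using assms by simp
    then have "i < k" using strict_mono_less[OF arrival_time_strict_mono[OF w]] by simp
    then show ?thesis using Suc admitted_mono[of "Suc i" k n w] by auto
  qed (use Suc in auto)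
qed simp

lemma no_jobs_before_first_arrival:
  assumes w: "good_path w" and "t < arrival_time w 0"
  shows "jobs_present n w t = {}"
  using admitted_arrived[OF w assms(2)] by (auto simp: jobs_present_def)

lemma jobs_present_empty_iff:
  assumes w: "good_path w" and t: "arrival_time w k \<le> t" "t < arrival_time w (Suc k)"
  shows "jobs_present n w t = {} \<longleftrightarrow> sum_list (backlog n w k) \<le> t - arrival_time w k"
proof -
  let ?D = "map snd (admitted n w (Suc k))"
  have "fst j \<le> t" if j: "j \<in> set (admitted n w (Suc k))" for j
  proof -
    obtain i where "i \<le> k" "fst j = arrival_time w i" using fst_admitted[OF j] unfolding less_Suc_eq_le by blast
    then show ?thesis using t strict_mono_less_eq[OF arrival_time_strict_mono[OF w], of i k] by simp
  qed
  then have "jobs_present n w t = {} \<longleftrightarrow> (\<forall>j\<in>set (admitted n w (Suc k)). \<not> t < snd j)"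
    using admitted_arrived[OF w t(2), where n = n] unfolding jobs_present_def by blast
  also have "\<dots> \<longleftrightarrow> filter (\<lambda>d. t < d) ?D = []"
    by (simp add: filter_empty_conv)
  also have "\<dots> \<longleftrightarrow> filter (\<lambda>d. arrival_time w k + (t - arrival_time w k) < d)
      (departures (arrival_time w k) (backlog n w k)) = []"
    using admitted_backlog[OF w, of n k] t by simp
  also have "\<dots> \<longleftrightarrow> consume (t - arrival_time w k) (backlog n w k) = []"
    using t backlog_nonneg[OF w, of n k] by (subst filter_departures) simp_all
  also have "\<dots> \<longleftrightarrow> sum_list (backlog n w k) \<le> t - arrival_time w k"
    using t by (intro consume_eq_Nil_iff backlog_nonneg w) auto
  finally show ?thesis .
qed

text \<open>Time 0 acts as a fictitious arrival that leaves no work, so that job 0 can be treated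
  like any other job.\<close>

definition prev_arrival :: "(nat \<Rightarrow> real \<times> real) \<Rightarrow> nat \<Rightarrow> real" where
  "prev_arrival w k = (case k of 0 \<Rightarrow> 0 | Suc j \<Rightarrow> arrival_time w j)"

definition prev_work :: "nat \<Rightarrow> (nat \<Rightarrow> real \<times> real) \<Rightarrow> nat \<Rightarrow> real" where
  "prev_work n w k = (case k of 0 \<Rightarrow> 0 | Suc j \<Rightarrow> sum_list (backlog n w j))"

definition since_first :: "(nat \<Rightarrow> real \<times> real) \<Rightarrow> nat \<Rightarrow> real" where
  "since_first w i = arrival_time w i - fst (w 0)"

text \<open>For the last arrival up to \<open>y\<close> the minimum is the time elapsed until
  \<open>y\<close>, for an earlier one it is the gap to the next arrival. In both cases the work
  present must outlast it.\<close>

definition busy_until :: "nat \<Rightarrow> (nat \<Rightarrow> real \<times> real) \<Rightarrow> real \<Rightarrow> bool" where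
  "busy_until n w y \<longleftrightarrow> (\<forall>i. since_first w i \<le> y \<longrightarrow>
     min (y - since_first w i) (fst (w (Suc i))) < sum_list (backlog n w i))"

definition alive :: "nat \<Rightarrow> (nat \<Rightarrow> real \<times> real) \<Rightarrow> nat \<Rightarrow> bool" where
  "alive n w i \<longleftrightarrow> (\<forall>j<i. fst (w (Suc j)) < sum_list (backlog n w j))"

definition is_admitted :: "nat \<Rightarrow> (nat \<Rightarrow> real \<times> real) \<Rightarrow> nat \<Rightarrow> bool" where
  "is_admitted n w i = (case i of 0 \<Rightarrow> 0 < n
     | Suc j \<Rightarrow> length (consume (fst (w (Suc j))) (backlog n w j)) < n)"

lemma arrival_time_eq_prev: "arrival_time w k = prev_arrival w k + fst (w k)"
  by (cases k) (simp_all add: prev_arrival_def arrival_time_def)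

lemma mono_prev_arrival: "good_path w \<Longrightarrow> mono (prev_arrival w)"
  by (rule incseq_SucI) (simp add: prev_arrival_def arrival_time_eq_prev[unfolded prev_arrival_def] good_pathD split: nat.split)

lemma prev_arrival_Suc: "prev_arrival w (Suc k) = arrival_time w k"
  by (simp add: prev_arrival_def)

lemma ex_prev_arrival:
  assumes w: "good_path w" and "0 \<le> y"
  shows "\<exists>k. prev_arrival w k \<le> y \<and> y < arrival_time w k"
proof -
  obtain k0 where "y < arrival_time w k0" using w by (auto simp: good_path_def)
  define k where "k = (LEAST k. y < arrival_time w k)"
  have k: "y < arrival_time w k" unfolding k_def by (rule LeastI) fact
  have "prev_arrival w k \<le> y"
  proof (cases k)
    case (Suc j)
    then have "\<not> y < arrival_time w j" using not_less_Least[of j "\<lambda>k. y < arrival_time w k"] k_def by simp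
    then show ?thesis by (simp add: Suc prev_arrival_def)
  qed (simp add: prev_arrival_def assms)
  with k show ?thesis by blast
qed

lemma prev_arrival_unique:
  assumes w: "good_path w" and "prev_arrival w k \<le> y" "y < arrival_time w k"
    "prev_arrival w k' \<le> y" "y < arrival_time w k'"
  shows "k = k'"
proof -
  have "\<not> k < k'" if "prev_arrival w k' \<le> y" "y < arrival_time w k" for k k'
  proof
    assume "k < k'"
    then have "prev_arrival w (Suc k) \<le> prev_arrival w k'"
      using monoD[OF mono_prev_arrival[OF w]] by (simp add: Suc_leI)
    then show False using that by (simp add: prev_arrival_Suc)
  qed
  then show ?thesis using assms by (metis nat_neq_iff)
qed

lemma jobs_present_empty_iff_prev:
  assumes w: "good_path w" and k: "prev_arrival w k \<le> y" "y < arrival_time w k" and "0 \<le> y"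
  shows "jobs_present n w y = {} \<longleftrightarrow> prev_work n w k \<le> y - prev_arrival w k"
proof (cases k)
  case 0
  then show ?thesis using no_jobs_before_first_arrival[OF w] k \<open>0 \<le> y\<close>
    by (simp add: prev_work_def prev_arrival_def)
next
  case (Suc j)
  then show ?thesis using jobs_present_empty_iff[OF w, of j y n] k
    by (simp add: prev_work_def prev_arrival_def)
qed

lemma jobs_present_empty_iff_ex:
  assumes w: "good_path w" and "0 \<le> y"
  shows "jobs_present n w y = {} \<longleftrightarrow>
    (\<exists>k. prev_arrival w k \<le> y \<and> y < arrival_time w k \<and> prev_work n w k \<le> y - prev_arrival w k)"
  using ex_prev_arrival[OF assms] jobs_present_empty_iff_prev[OF w _ _ assms(2)] by blast

lemma since_first_shift: "since_first (\<lambda>i. w (k + i)) i = arrival_time w (k + i) - arrival_time w k"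
  by (induction i) (simp_all add: since_first_def arrival_time_Suc, simp add: arrival_time_def)

text \<open>\<open>prev_work n w k \<le> fst (w k)\<close> says that job \<open>k\<close> finds the
  system empty; from then on the backlog is that of a fresh path. This is the regeneration that
  yields the renewal equation.\<close>

lemma backlog_shift:
  assumes w: "good_path w" and idle: "prev_work n w k \<le> fst (w k)"
  shows "backlog n (\<lambda>i. w (k + i)) i = backlog n w (k + i)"
proof (induction i)
  case 0
  show ?case
  proof (cases k)
    case (Suc j)
    then have "consume (fst (w (Suc j))) (backlog n w j) = []"
      using idle w by (subst consume_eq_Nil_iff) (auto simp: prev_work_def good_pathD backlog_nonneg[OF w, rule_format])
    then show ?thesis by (simp add: Suc)
  qed simp
qed simp

text \<open>The witness is the last job up to time \<open>t\<close> that found the system empty; one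
  exists, since job 0 did. That no later job up to \<open>t\<close> did so is what
  \<open>busy_until\<close> demands of the shifted path.\<close>

lemma jobs_present_nonempty_iff:
  assumes w: "good_path w" and t: "0 \<le> t"
  shows "jobs_present n w t \<noteq> {} \<longleftrightarrow> (\<exists>k. prev_work n w k \<le> fst (w k) \<and> arrival_time w k \<le> t \<and>
    busy_until n (\<lambda>i. w (k + i)) (t - arrival_time w k))"
proof -
  obtain m where m: "prev_arrival w m \<le> t" "t < arrival_time w m" using ex_prev_arrival[OF assms] by blast
  note empty = jobs_present_empty_iff_prev[OF w m t, of n]
  note less = strict_mono_less[OF arrival_time_strict_mono[OF w]]
    strict_mono_less_eq[OF arrival_time_strict_mono[OF w]]
  show ?thesis
  proof
    assume "jobs_present n w t \<noteq> {}"
    then have work: "t - prev_arrival w m < prev_work n w m" using empty by simp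
    then obtain K where K: "m = Suc K" using m t by (cases m) (auto simp: prev_work_def prev_arrival_def)
    define k where "k = (GREATEST k. k \<le> K \<and> prev_work n w k \<le> fst (w k))"
    have ex: "0 \<le> K \<and> prev_work n w 0 \<le> fst (w 0)" using w by (simp add: prev_work_def good_pathD)
    have k: "k \<le> K \<and> prev_work n w k \<le> fst (w k)"
      unfolding k_def by (rule GreatestI_nat[of "\<lambda>k. k \<le> K \<and> prev_work n w k \<le> fst (w k)", OF ex, of K]) simp
    have not_idle: "fst (w j) < prev_work n w j" if "k < j" "j \<le> K" for j
    proof (rule ccontr)
      assume "\<not> ?thesis"
      then have "j \<le> k" unfolding k_def using that by (intro Greatest_le_nat[of _ _ K]) auto
      then show False using that by simp
    qed
    have "busy_until n (\<lambda>i. w (k + i)) (t - arrival_time w k)"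
      unfolding busy_until_def since_first_shift
    proof (intro allI impI)
      fix i assume "arrival_time w (k + i) - arrival_time w k \<le> t - arrival_time w k"
      then have "arrival_time w (k + i) < arrival_time w (Suc K)" using m K by simp
      then have i: "k + i \<le> K" using less by (simp add: less_Suc_eq_le)
      show "min (t - arrival_time w k - (arrival_time w (k + i) - arrival_time w k)) (fst (w (k + Suc i)))
          < sum_list (backlog n (\<lambda>i. w (k + i)) i)"
      proof (cases "k + i = K")
        case True
        then show ?thesis using work K k
          by (auto simp: backlog_shift[OF w] prev_work_def prev_arrival_def)
      next
        case False
        then show ?thesis using not_idle[of "Suc (k + i)"] i k
          by (auto simp: backlog_shift[OF w] prev_work_def)
      qed
    qed
    moreover have "arrival_time w k \<le> t"
      using k less m K by (simp add: prev_arrival_def) (meson order_trans)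
    ultimately show "\<exists>k. prev_work n w k \<le> fst (w k) \<and> arrival_time w k \<le> t \<and>
        busy_until n (\<lambda>i. w (k + i)) (t - arrival_time w k)" using k by blast
  next
    assume "\<exists>k. prev_work n w k \<le> fst (w k) \<and> arrival_time w k \<le> t \<and>
      busy_until n (\<lambda>i. w (k + i)) (t - arrival_time w k)"
    then obtain k where k: "prev_work n w k \<le> fst (w k)" "arrival_time w k \<le> t"
      "busy_until n (\<lambda>i. w (k + i)) (t - arrival_time w k)" by blast
    have "k < m" using k(2) m less by (metis order.strict_trans1)
    then obtain i where i: "m = Suc (k + i)" using less_iff_Suc_add[of k m] by auto
    then have mi: "arrival_time w (k + i) \<le> t" using m by (simp add: prev_arrival_def)
    then have "min (t - arrival_time w k - since_first (\<lambda>i. w (k + i)) i) (fst (w (k + Suc i)))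
        < sum_list (backlog n (\<lambda>i. w (k + i)) i)"
      using k(3) unfolding busy_until_def since_first_shift by auto
    then have "min (t - arrival_time w (k + i)) (fst (w m)) < prev_work n w m"
      by (simp add: since_first_shift backlog_shift[OF w k(1)] i prev_work_def)
    moreover have "t - arrival_time w (k + i) < fst (w m)"
      using m by (simp add: i arrival_time_Suc)
    ultimately show "jobs_present n w t \<noteq> {}" using empty by (simp add: i prev_arrival_def)
  qed
qed

text \<open>Makes the preceding decomposition disjoint, so that probabilities add: if the busy
  period begun by job \<open>k\<close> lasts until \<open>t\<close>, then job \<open>k'\<close>
  arrives while work is left.\<close>

lemma idle_arrival_unique:
  assumes w: "good_path w" and "k < k'"
    and k: "prev_work n w k \<le> fst (w k)" "busy_until n (\<lambda>i. w (k + i)) (t - arrival_time w k)"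
    and k': "prev_work n w k' \<le> fst (w k')" "arrival_time w k' \<le> t"
  shows False
proof -
  obtain i where i: "k' = Suc (k + i)" using less_iff_Suc_add[of k k'] \<open>k < k'\<close> by auto
  have "arrival_time w (k + i) \<le> t - fst (w k')"
    using k'(2) by (simp add: i arrival_time_Suc)
  moreover have "0 < fst (w k')" using w by (simp add: good_pathD)
  ultimately have "min (t - arrival_time w (k + i)) (fst (w k')) < sum_list (backlog n w (k + i))"
    using k(2) unfolding busy_until_def since_first_shift
    by (auto simp: i backlog_shift[OF w k(1)] dest!: spec[of _ i])
  then show False using k'(1) \<open>arrival_time w (k + i) \<le> t - fst (w k')\<close>
    by (simp add: i prev_work_def)
qed

lemma busy_until_mono: "y' \<le> y \<Longrightarrow> busy_until n w y \<Longrightarrow> busy_until n w y'"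
  unfolding busy_until_def by (meson diff_right_mono min.mono order.refl order.strict_trans1 order.trans)

lemma since_first_Suc: "since_first w (Suc i) = since_first w i + fst (w (Suc i))"
  by (simp add: since_first_def arrival_time_Suc)

lemma since_first_0 [simp]: "since_first w 0 = 0"
  by (simp add: since_first_def arrival_time_def)

lemma alive_Suc: "alive n w (Suc i) \<longleftrightarrow> alive n w i \<and> fst (w (Suc i)) < sum_list (backlog n w i)"
  by (auto simp: alive_def less_Suc_eq)

lemma alive_mono: "i \<le> j \<Longrightarrow> alive n w j \<Longrightarrow> alive n w i"
  by (auto simp: alive_def)

lemma strict_mono_since_first: "good_path w \<Longrightarrow> strict_mono (since_first w)"
  by (rule strict_monoI_Suc) (simp add: since_first_Suc good_pathD)

definition busy_interval :: "nat \<Rightarrow> (nat \<Rightarrow> real \<times> real) \<Rightarrow> nat \<Rightarrow> real set" where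
  "busy_interval n w i = (if alive n w i then
     {since_first w i..<since_first w i + min (fst (w (Suc i))) (sum_list (backlog n w i))} else {})"

text \<open>Cutting the busy period at the arrivals makes its length a series with one term per
  interarrival gap.\<close>

lemma busy_until_eq_UN:
  assumes w: "good_path w"
  shows "{y. 0 \<le> y \<and> busy_until n w y} = (\<Union>i. busy_interval n w i)"
proof (intro Set.set_eqI iffI)
  note less = strict_mono_less_eq[OF strict_mono_since_first[OF w]]
  fix y assume y: "y \<in> {y. 0 \<le> y \<and> busy_until n w y}"
  then have "0 \<le> y + fst (w 0)" using w by (simp add: good_pathD)
  from ex_prev_arrival[OF w this] obtain m where m: "prev_arrival w m \<le> y + fst (w 0)" "y + fst (w 0) < arrival_time w m" by blast
  then obtain i where i: "m = Suc i" using y by (cases m) (auto simp: arrival_time_def)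
  have yi: "since_first w i \<le> y" "y < since_first w (Suc i)"
    using m by (simp_all add: i since_first_def prev_arrival_def)
  have "alive n w i" unfolding alive_def
  proof (intro allI impI)
    fix j assume "j < i"
    then have "since_first w (Suc j) \<le> y" "since_first w j \<le> y"
      using yi less[of "Suc j" i] less[of j i] by auto
    then show "fst (w (Suc j)) < sum_list (backlog n w j)"
      using y by (auto simp: busy_until_def since_first_Suc min_def dest!: spec[of _ j] split: if_splits)
  qed
  moreover have "y - since_first w i < sum_list (backlog n w i)"
    using y yi by (auto simp: busy_until_def since_first_Suc min_def dest!: spec[of _ i] split: if_splits)
  ultimately show "y \<in> (\<Union>i. busy_interval n w i)"
    using yi by (auto simp: busy_interval_def since_first_Suc intro!: exI[of _ i])
next
  note less = strict_mono_less[OF strict_mono_since_first[OF w]] strict_mono_less_eq[OF strict_mono_since_first[OF w]]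
  fix y assume "y \<in> (\<Union>i. busy_interval n w i)"
  then obtain i where i: "alive n w i" "since_first w i \<le> y" "y < since_first w (Suc i)"
    "y - since_first w i < sum_list (backlog n w i)"
    by (auto simp: busy_interval_def since_first_Suc split: if_splits)
  have "0 \<le> y" using i(2) less(2)[of 0 i] by simp
  moreover have "busy_until n w y" unfolding busy_until_def
  proof (intro allI impI)
    fix j assume "since_first w j \<le> y"
    then have "since_first w j < since_first w (Suc i)" using i by simp
    then have "j \<le> i" using less by (simp add: less_Suc_eq_le)
    then show "min (y - since_first w j) (fst (w (Suc j))) < sum_list (backlog n w j)"
      using i by (cases "j = i") (auto simp: alive_def min_less_iff_disj)
  qed
  ultimately show "y \<in> {y. 0 \<le> y \<and> busy_until n w y}" by simp
qed

lemma disjoint_busy_interval: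
  assumes w: "good_path w"
  shows "disjoint_family (busy_interval n w)"
proof -
  have "busy_interval n w i \<inter> busy_interval n w j = {}" if "i < j" for i j
    using strict_mono_less_eq[OF strict_mono_since_first[OF w], of "Suc i" j] that
    by (auto simp: busy_interval_def since_first_Suc)
  then show ?thesis unfolding disjoint_family_on_def by (metis inf_commute nat_neq_iff)
qed

lemma emeasure_busy_period:
  assumes w: "good_path w"
  shows "emeasure lborel {y. 0 \<le> y \<and> busy_until n w y} =
    (\<Sum>i. indicator {i. alive n w i} i * ennreal (min (fst (w (Suc i))) (sum_list (backlog n w i))))"
proof -
  have nonneg: "0 \<le> sum_list (backlog n w i)" for i
    using backlog_nonneg[OF w] by (intro sum_list_nonneg) auto
  have "emeasure lborel (\<Union>i. busy_interval n w i) = (\<Sum>i. emeasure lborel (busy_interval n w i))"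
    by (rule suminf_emeasure[symmetric, OF _ disjoint_busy_interval[OF w]]) (auto simp: busy_interval_def)
  moreover have "emeasure lborel (busy_interval n w i) =
      indicator {i. alive n w i} i * ennreal (min (fst (w (Suc i))) (sum_list (backlog n w i)))" for i
    using w nonneg[of i] by (simp add: busy_interval_def good_pathD indicator_def)
  ultimately show ?thesis unfolding busy_until_eq_UN[OF w] by simp
qed

lemma busy_work_partial_sum:
  assumes w: "good_path w"
  shows "(\<Sum>i<K. if alive n w i then min (fst (w (Suc i))) (sum_list (backlog n w i)) else 0)
    + (if alive n w K then sum_list (backlog n w K) else 0)
    = (\<Sum>i\<le>K. if alive n w i \<and> is_admitted n w i then snd (w i) else 0)"
proof (induction K)
  case 0
  then show ?case by (simp add: alive_def is_admitted_def admit_def)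
next
  case (Suc K)
  define x where "x = fst (w (Suc K))"
  define L where "L = sum_list (backlog n w K)"
  have x: "0 < x" using w by (simp add: x_def good_pathD)
  have "sum_list (consume x (backlog n w K)) = max 0 (L - x)"
    unfolding L_def using x backlog_nonneg[OF w] by (intro sum_list_consume) auto
  then have "sum_list (backlog n w (Suc K)) = max 0 (L - x) + (if is_admitted n w (Suc K) then snd (w (Suc K)) else 0)"
    by (simp add: admit_def is_admitted_def x_def)
  moreover have "alive n w (Suc K) \<longleftrightarrow> alive n w K \<and> x < L"
    by (simp add: alive_Suc x_def L_def)
  moreover have "0 \<le> L" unfolding L_def using backlog_nonneg[OF w] by (intro sum_list_nonneg) auto
  ultimately show ?case using Suc unfolding x_def[symmetric] sum.lessThan_Suc sum.atMost_Suc L_def[symmetric]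
    by (auto simp: min_def max_def)
qed

section \<open>Busy periods\<close>

text \<open>Resampling one coordinate independently preserves the law; an integral over paths can
  then be evaluated by first integrating out that coordinate.\<close>

lemma (in sequence_space) distr_PiM_fun_upd:
  assumes space_M: "space M = UNIV"
  shows "distr (S \<Otimes>\<^sub>M M) S (\<lambda>(w, y). w(k := y)) = S"
proof (rule PiM_eq[symmetric, THEN sym])
  show "sets (distr (S \<Otimes>\<^sub>M M) S (\<lambda>(w, y). w(k := y))) = sets S" by simp
  fix J F assume J: "finite J" "J \<subseteq> (UNIV :: nat set)" "\<And>j. j \<in> J \<Longrightarrow> F j \<in> sets M"
  have meas: "(\<lambda>(w, y). w(k := y)) \<in> measurable (S \<Otimes>\<^sub>M M) S"
    unfolding split_beta' by (rule measurable_fun_upd[of UNIV UNIV k]) auto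
  let ?E = "prod_emb UNIV (\<lambda>i. M) J (\<Pi>\<^sub>E j\<in>J. F j)"
  let ?A = "prod_emb UNIV (\<lambda>i. M) (J - {k}) (\<Pi>\<^sub>E j\<in>J - {k}. F j)"
  let ?B = "if k \<in> J then F k else space M"
  have E: "?E \<in> sets S" using J by (intro sets_PiM_I) auto
  have A: "?A \<in> sets S" using J by (intro sets_PiM_I) auto
  have B: "?B \<in> sets M" using J(3) sets.top[of M] by (cases "k \<in> J") (simp_all only: if_True if_False)
  have mem: "f \<in> prod_emb UNIV (\<lambda>i. M) K (\<Pi>\<^sub>E j\<in>K. F j) \<longleftrightarrow> (\<forall>j\<in>K. f j \<in> F j)" for f K
    by (simp only: prod_emb_iff space_M) (simp add: PiE_iff)
  have sp: "space (S \<Otimes>\<^sub>M M) = UNIV"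
    by (simp add: space_PiM space_pair_measure space_M)
  have "(w, y) \<in> (\<lambda>(w, y). w(k := y)) -` ?E \<inter> space (S \<Otimes>\<^sub>M M) \<longleftrightarrow> (w, y) \<in> ?A \<times> ?B" for w y
    unfolding Int_iff vimage_eq prod.case mem sp mem_Times_iff fst_conv snd_conv space_M by auto
  then have "(\<lambda>(w, y). w(k := y)) -` ?E \<inter> space (S \<Otimes>\<^sub>M M) = ?A \<times> ?B"
    by (intro Set.set_eqI) (simp only: split_paired_all)
  then have "emeasure (distr (S \<Otimes>\<^sub>M M) S (\<lambda>(w, y). w(k := y))) ?E = emeasure (S \<Otimes>\<^sub>M M) (?A \<times> ?B)"
    using meas E by (subst emeasure_distr) auto
  also have "\<dots> = emeasure S ?A * emeasure M ?B"
    using A B by (rule M.emeasure_pair_measure_Times)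
  also have "emeasure S ?A = (\<Prod>j\<in>J - {k}. emeasure M (F j))"
    using J by (intro emeasure_PiM_emb) auto
  also have "(\<Prod>j\<in>J - {k}. emeasure M (F j)) * emeasure M ?B = (\<Prod>j\<in>J. emeasure M (F j))"
    using J M.emeasure_space_1 by (auto simp: prod.remove mult.commute)
  finally show "emeasure (distr (S \<Otimes>\<^sub>M M) S (\<lambda>(w, y). w(k := y))) ?E = (\<Prod>j\<in>J. emeasure M (F j))" .
qed

lemma (in sequence_space) integral_PiM_fun_upd:
  fixes F :: "(nat \<Rightarrow> 'a) \<Rightarrow> real"
  assumes space_M: "space M = UNIV" and F: "F \<in> borel_measurable S" and bound: "AE w in S. \<bar>F w\<bar> \<le> C"
  shows "(\<integral>w. F w \<partial>S) = (\<integral>w. (\<integral>y. F (w(k := y)) \<partial>M) \<partial>S)"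
    and "AE w in S. integrable M (\<lambda>y. F (w(k := y)))"
proof -
  interpret SM: pair_prob_space S M ..
  have meas: "(\<lambda>(w, y). w(k := y)) \<in> measurable (S \<Otimes>\<^sub>M M) S"
    unfolding split_beta' by (rule measurable_fun_upd[of UNIV UNIV k]) auto
  have F': "(\<lambda>z. F ((fst z)(k := snd z))) \<in> borel_measurable (S \<Otimes>\<^sub>M M)"
    using measurable_compose[OF meas F] by (simp add: split_beta')
  have "integrable S F" by (rule integrable_const_bound[OF bound[folded real_norm_def] F])
  then have "integrable (distr (S \<Otimes>\<^sub>M M) S (\<lambda>(w, y). w(k := y))) F"
    by (simp only: distr_PiM_fun_upd[OF space_M])
  then have int: "integrable (S \<Otimes>\<^sub>M M) (\<lambda>z. F ((fst z)(k := snd z)))"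
    using integrable_distr_eq[OF meas F] by (simp add: split_beta')
  have "(\<integral>w. F w \<partial>S) = (\<integral>w. F w \<partial>distr (S \<Otimes>\<^sub>M M) S (\<lambda>(w, y). w(k := y)))"
    by (simp only: distr_PiM_fun_upd[OF space_M])
  also have "\<dots> = (\<integral>z. F ((fst z)(k := snd z)) \<partial>(S \<Otimes>\<^sub>M M))"
    by (subst integral_distr[OF meas F]) (simp add: split_beta')
  also have "\<dots> = (\<integral>w. (\<integral>y. F (w(k := y)) \<partial>M) \<partial>S)"
    by (subst SM.integral_fst'[OF int, symmetric]) simp
  finally show "(\<integral>w. F w \<partial>S) = (\<integral>w. (\<integral>y. F (w(k := y)) \<partial>M) \<partial>S)" .
  show "AE w in S. integrable M (\<lambda>y. F (w(k := y)))"
    using SM.AE_integrable_fst'[OF int] by simp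
qed

section \<open>Dependence of the queue on single coordinates, and measurability\<close>

lemma backlog_cong:
  "\<lbrakk>\<And>i. i \<le> k \<Longrightarrow> snd (w i) = snd (w' i); \<And>i. 0 < i \<Longrightarrow> i \<le> k \<Longrightarrow> fst (w i) = fst (w' i)\<rbrakk>
    \<Longrightarrow> backlog n w k = backlog n w' k"
  by (induction k) simp_all

text \<open>The service time of job \<open>k\<close> is left free, here and in
  \<open>is_admitted_cong\<close>: this is the independence behind Wald's identity. The interarrival
  time of job 0 is left free as well, since time is counted from its arrival.\<close>

lemma alive_cong:
  "\<lbrakk>\<And>i. i < k \<Longrightarrow> snd (w i) = snd (w' i); \<And>i. 0 < i \<Longrightarrow> i \<le> k \<Longrightarrow> fst (w i) = fst (w' i)\<rbrakk>
    \<Longrightarrow> alive n w k = alive n w' k"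
proof (induction k)
  case (Suc k)
  have "backlog n w k = backlog n w' k" by (rule backlog_cong) (use Suc.prems in auto)
  then show ?case using Suc by (simp add: alive_Suc)
qed (simp add: alive_def)

lemma is_admitted_cong:
  "\<lbrakk>\<And>i. i < k \<Longrightarrow> snd (w i) = snd (w' i); \<And>i. 0 < i \<Longrightarrow> i \<le> k \<Longrightarrow> fst (w i) = fst (w' i)\<rbrakk>
    \<Longrightarrow> is_admitted n w k = is_admitted n w' k"
proof (cases k)
  case (Suc j)
  assume *: "\<And>i. i < k \<Longrightarrow> snd (w i) = snd (w' i)" "\<And>i. 0 < i \<Longrightarrow> i \<le> k \<Longrightarrow> fst (w i) = fst (w' i)"
  have "backlog n w j = backlog n w' j" by (rule backlog_cong) (use * Suc in auto)
  then show ?thesis using * by (simp add: is_admitted_def Suc)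
qed (simp add: is_admitted_def)

lemma arrival_time_cong: "(\<And>i. i \<le> k \<Longrightarrow> fst (w i) = fst (w' i)) \<Longrightarrow> arrival_time w k = arrival_time w' k"
  by (simp add: arrival_time_def)

abbreviation path_space :: "(nat \<Rightarrow> real \<times> real) measure" where
  "path_space \<equiv> \<Pi>\<^sub>M i\<in>UNIV. borel"

lemma measurable_fst_borel [measurable]: "fst \<in> borel_measurable (borel :: (real \<times> real) measure)"
  by (intro borel_measurable_continuous_onI continuous_intros)

lemma measurable_snd_borel [measurable]: "snd \<in> borel_measurable (borel :: (real \<times> real) measure)"
  by (intro borel_measurable_continuous_onI continuous_intros)

lemma measurable_arrival_time [measurable]: "(\<lambda>w. arrival_time w k) \<in> borel_measurable path_space"
  unfolding arrival_time_def by measurable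

lemma list_measurable_admit:
  assumes f: "list_measurable M f" and s: "s \<in> borel_measurable M"
  shows "list_measurable M (\<lambda>w. admit n (s w) (f w))"
proof -
  note [measurable] = list_measurable_length[OF f]
  show ?thesis unfolding admit_def
    by (intro list_measurable_If list_measurable_snoc f s) measurable
qed

lemma list_measurable_backlog: "list_measurable path_space (\<lambda>w. backlog n w k)"
proof (induction k)
  case 0
  then show ?case by (simp add: list_measurable_admit list_measurable_const)
next
  case (Suc k)
  then show ?case unfolding backlog.simps
    by (intro list_measurable_admit list_measurable_consume[of _ _ _ n] length_backlog) measurable
qed

lemma measurable_work [measurable]: "(\<lambda>w. sum_list (backlog n w k)) \<in> borel_measurable path_space"
  by (rule list_measurable_sum_list[OF list_measurable_backlog])

lemma measurable_prev_arrival [measurable]: "(\<lambda>w. prev_arrival w k) \<in> borel_measurable path_space"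
  by (cases k) (simp_all add: prev_arrival_def)

lemma measurable_prev_work [measurable]: "(\<lambda>w. prev_work n w k) \<in> borel_measurable path_space"
  by (cases k) (simp_all add: prev_work_def)

lemma measurable_since_first [measurable]: "(\<lambda>w. since_first w k) \<in> borel_measurable path_space"
  unfolding since_first_def by measurable

lemma pred_alive [measurable]: "Measurable.pred path_space (\<lambda>w. alive n w i)"
  unfolding alive_def by measurable

lemma pred_is_admitted [measurable]: "Measurable.pred path_space (\<lambda>w. is_admitted n w i)"
proof (cases i)
  case (Suc j)
  have "(\<lambda>w. length (consume (fst (w (Suc j))) (backlog n w j))) \<in> measurable path_space (count_space UNIV)"
    by (intro list_measurable_length list_measurable_consume[of _ _ _ n] list_measurable_backlog length_backlog) measurable
  note [measurable] = this
  show ?thesis by (simp add: is_admitted_def Suc)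
qed (simp add: is_admitted_def)

text \<open>Joint measurability in path and time, for Fubini's theorem.\<close>

lemma pred_busy_until [measurable]:
  "Measurable.pred (path_space \<Otimes>\<^sub>M borel) (\<lambda>z. busy_until n (fst z) (snd z))"
proof -
  have [measurable]: "(\<lambda>z. f (fst z)) \<in> borel_measurable (path_space \<Otimes>\<^sub>M borel)"
    if "f \<in> borel_measurable path_space" for f :: "_ \<Rightarrow> real"
    using measurable_compose[OF measurable_fst that] .
  show ?thesis unfolding busy_until_def by measurable
qed

lemma list_measurable_admitted: "list_measurable path_space (\<lambda>w. admitted n w k)"
proof (induction k)
  case 0
  then show ?case by (simp add: list_measurable_const)
next
  case (Suc k)
  note [measurable] = list_measurable_last[OF Suc] list_measurable_pred_Nil[OF Suc] measurable_arrival_time[of k]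
  have [measurable]: "(\<lambda>w. snd (last (admitted n w k))) \<in> borel_measurable path_space"
    by (rule measurable_compose[OF list_measurable_last[OF Suc]]) measurable
  have pr: "Measurable.pred (path_space \<Otimes>\<^sub>M borel) (\<lambda>(w, j). arrival_time w k < snd (j :: real \<times> real))"
    unfolding split_beta' by measurable
  have [measurable]: "(\<lambda>w. real (length (filter (\<lambda>j. arrival_time w k < snd j) (admitted n w k)))) \<in> borel_measurable path_space"
    by (rule list_measurable_length_filter[OF Suc pr])
  have eq: "admitted n w (Suc k) = (if real (length (filter (\<lambda>j. arrival_time w k < snd j) (admitted n w k))) < real n
      then admitted n w k @ [(arrival_time w k, (if admitted n w k = [] then arrival_time w k
        else max (arrival_time w k) (snd (last (admitted n w k)))) + snd (w k))] else admitted n w k)" for w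
    by (simp add: Let_def)
  have "(\<lambda>w. (arrival_time w k, (if admitted n w k = [] then arrival_time w k
        else max (arrival_time w k) (snd (last (admitted n w k)))) + snd (w k))) \<in> borel_measurable path_space"
    by (intro borel_measurable_Pair) measurable
  then show ?case unfolding eq
    by (intro list_measurable_If list_measurable_snoc Suc) measurable
qed

lemma pred_jobs_present: "Measurable.pred path_space (\<lambda>w. jobs_present n w t = {})"
proof -
  have "Measurable.pred (borel \<Otimes>\<^sub>M borel) (\<lambda>j :: real \<times> real. \<not> (fst j \<le> t \<and> t < snd j))" by measurable
  then have "Measurable.pred path_space (\<lambda>w. \<forall>j\<in>set (admitted n w k). \<not> (fst j \<le> t \<and> t < snd j))" for k
    unfolding borel_prod by (rule list_measurable_Ball[OF list_measurable_admitted])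
  then have "Measurable.pred path_space (\<lambda>w. \<forall>k. \<forall>j\<in>set (admitted n w k). \<not> (fst j \<le> t \<and> t < snd j))"
    by measurable
  moreover have "jobs_present n w t = {} \<longleftrightarrow> (\<forall>k. \<forall>j\<in>set (admitted n w k). \<not> (fst j \<le> t \<and> t < snd j))" for w
    unfolding jobs_present_def by blast
  ultimately show ?thesis by simp
qed

section \<open>The probability space of the queue\<close>

locale mg1n = finite_queue +
  assumes S_nonneg: "AE x in S. 0 \<le> x" and S_int: "integrable S (\<lambda>x. x)"
begin

abbreviation Exp :: "real measure" where "Exp \<equiv> density lborel (exponential_density lam)"
abbreviation X :: "(real \<times> real) measure" where "X \<equiv> Exp \<Otimes>\<^sub>M S"
abbreviation P :: "(nat \<Rightarrow> real \<times> real) measure" where "P \<equiv> queue_input lam S"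

definition mu :: real where "mu = (\<integral>x. x \<partial>S)"

sublocale Exp: prob_space Exp by (rule prob_space_exponential_density[OF lam])
sublocale XS: pair_prob_space Exp S ..
sublocale seq: sequence_space X ..
sublocale P: prob_space P unfolding queue_input_def by (rule prob_space_PiM) (rule XS.prob_space_axioms)
sublocale PX: pair_prob_space P X ..
sublocale PP: pair_prob_space P P ..

lemma mu_nonneg: "0 \<le> mu"
  unfolding mu_def by (rule integral_nonneg_AE) (rule S_nonneg)

lemma sets_X: "sets X = sets borel"
proof -
  have "sets X = sets (borel \<Otimes>\<^sub>M (borel :: real measure) :: (real \<times> real) measure)"
    by (intro sets_pair_measure_cong sets_S sets_density[THEN trans] sets_lborel)
  also have "\<dots> = sets borel" by (simp only: borel_prod)
  finally show ?thesis .
qed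

lemma sets_P: "sets P = sets path_space"
  unfolding queue_input_def by (rule sets_PiM_cong[OF refl sets_X])

lemma space_P [simp]: "space P = UNIV"
  using sets_eq_imp_space_eq[OF sets_P] by (simp add: space_PiM)

lemma space_X [simp]: "space X = UNIV"
  using sets_eq_imp_space_eq[OF sets_X] by simp

lemma measurable_P: "measurable P M = measurable path_space M"
  by (rule measurable_cong_sets[OF sets_P refl])

lemma measurable_X: "measurable X M = measurable borel M"
  by (rule measurable_cong_sets[OF sets_X refl])

lemma distr_comb_seq: "distr (P \<Otimes>\<^sub>M P) P (\<lambda>(w, w'). comb_seq k w w') = P"
  using seq.PiM_comb_seq by (simp add: queue_input_def)

lemma comb_seq_measurable: "(\<lambda>(w, w'). comb_seq k w w') \<in> measurable (P \<Otimes>\<^sub>M P) P"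
  unfolding queue_input_def by (rule measurable_comb_seq)

lemma fun_upd_measurable: "(\<lambda>(w, y). w(k := y)) \<in> measurable (P \<Otimes>\<^sub>M X) P"
  unfolding queue_input_def split_beta'
  by (rule measurable_fun_upd[of UNIV UNIV k]) auto

lemma distr_fun_upd: "distr (P \<Otimes>\<^sub>M X) P (\<lambda>(w, y). w(k := y)) = P"
  unfolding queue_input_def by (rule seq.distr_PiM_fun_upd[OF space_X])

lemma measurable_P_intro: "f \<in> measurable path_space M \<Longrightarrow> f \<in> measurable P M"
  by (simp add: measurable_P)

lemma nn_integral_fun_upd:
  assumes [measurable]: "F \<in> borel_measurable P"
  shows "(\<integral>\<^sup>+w. F w \<partial>P) = (\<integral>\<^sup>+w. (\<integral>\<^sup>+y. F (w(k := y)) \<partial>X) \<partial>P)"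
proof -
  note [measurable] = fun_upd_measurable[of k]
  have [measurable]: "(\<lambda>z. F ((fst z)(k := snd z))) \<in> borel_measurable (P \<Otimes>\<^sub>M X)"
    using measurable_compose[OF fun_upd_measurable assms] by (simp add: split_beta')
  have "(\<integral>\<^sup>+w. F w \<partial>P) = (\<integral>\<^sup>+w. F w \<partial>distr (P \<Otimes>\<^sub>M X) P (\<lambda>(w, y). w(k := y)))"
    by (simp only: distr_fun_upd)
  also have "\<dots> = (\<integral>\<^sup>+z. F ((fst z)(k := snd z)) \<partial>(P \<Otimes>\<^sub>M X))"
    by (subst nn_integral_distr[OF fun_upd_measurable]) (simp_all add: split_beta')
  also have "\<dots> = (\<integral>\<^sup>+w. (\<integral>\<^sup>+y. F (w(k := y)) \<partial>X) \<partial>P)"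
    by (subst XS.nn_integral_fst[symmetric]) simp_all
  finally show ?thesis .
qed

lemma integral_fun_upd:
  fixes F :: "(nat \<Rightarrow> real \<times> real) \<Rightarrow> real"
  assumes [measurable]: "F \<in> borel_measurable P" and bound: "\<And>w. \<bar>F w\<bar> \<le> C"
  shows "(\<integral>w. F w \<partial>P) = (\<integral>w. (\<integral>y. F (w(k := y)) \<partial>X) \<partial>P)"
proof -
  have meas: "(\<lambda>z. F ((fst z)(k := snd z))) \<in> borel_measurable (P \<Otimes>\<^sub>M X)"
    using measurable_compose[OF fun_upd_measurable assms(1)] by (simp add: split_beta')
  have "(\<integral>w. F w \<partial>P) = (\<integral>w. F w \<partial>distr (P \<Otimes>\<^sub>M X) P (\<lambda>(w, y). w(k := y)))"
    by (simp only: distr_fun_upd)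
  also have "\<dots> = (\<integral>z. F ((fst z)(k := snd z)) \<partial>(P \<Otimes>\<^sub>M X))"
    by (subst integral_distr[OF fun_upd_measurable]) (simp_all add: split_beta')
  also have "\<dots> = (\<integral>w. (\<integral>y. F (w(k := y)) \<partial>X) \<partial>P)"
    by (subst PX.integral_fst'[symmetric])
      (use bound meas in \<open>auto intro!: PX.P.integrable_const_bound[of _ C]\<close>)
  finally show ?thesis .
qed

lemma nn_integral_X:
  assumes [measurable]: "F \<in> borel_measurable borel"
  shows "(\<integral>\<^sup>+y. F y \<partial>X) = (\<integral>\<^sup>+x. ennreal (exponential_density lam x) * (\<integral>\<^sup>+s. F (x, s) \<partial>S) \<partial>lborel)"
proof -
  have F: "F \<in> borel_measurable X" by (simp add: measurable_X assms)
  have "(\<integral>\<^sup>+y. F y \<partial>X) = (\<integral>\<^sup>+x. (\<integral>\<^sup>+s. F (x, s) \<partial>S) \<partial>Exp)"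
    by (rule S.nn_integral_fst[OF F, symmetric])
  also have "\<dots> = (\<integral>\<^sup>+x. ennreal (exponential_density lam x) * (\<integral>\<^sup>+s. F (x, s) \<partial>S) \<partial>lborel)"
    using S.borel_measurable_nn_integral_fst[OF F] by (subst nn_integral_density) auto
  finally show ?thesis .
qed

lemma integral_X:
  fixes F :: "real \<times> real \<Rightarrow> real"
  assumes [measurable]: "F \<in> borel_measurable borel" and bound: "\<And>y. \<bar>F y\<bar> \<le> C"
  shows "(\<integral>y. F y \<partial>X) = (\<integral>x. exponential_density lam x * (\<integral>s. F (x, s) \<partial>S) \<partial>lborel)"
proof -
  have F: "F \<in> borel_measurable X" by (simp add: measurable_X assms)
  have "(\<integral>y. F y \<partial>X) = (\<integral>x. (\<integral>s. F (x, s) \<partial>S) \<partial>Exp)"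
    by (rule XS.integral_fst'[symmetric]) (auto intro!: XS.P.integrable_const_bound[of _ C] simp: bound F)
  also have "\<dots> = (\<integral>x. exponential_density lam x * (\<integral>s. F (x, s) \<partial>S) \<partial>lborel)"
    using S.borel_measurable_lebesgue_integral[of "\<lambda>x s. F (x, s)" Exp] F lam
    by (subst integral_real_density) (auto simp: exponential_density_def)
  finally show ?thesis .
qed

lemma measurable_fun_upd_right: "(\<lambda>y. w(k := y)) \<in> measurable X P"
  using measurable_Pair2[OF fun_upd_measurable[of k], of w] by simp

lemma AE_X: "AE y in X. 0 < fst y \<and> 0 \<le> snd y"
proof -
  have "AE x in lborel. 0 < exponential_density lam x \<longrightarrow> 0 < x"
    using AE_lborel_singleton[of 0] by eventually_elim (auto simp: exponential_density_def split: if_splits)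
  then have "AE x in Exp. 0 < x"
    by (subst AE_density) (auto simp: ennreal_less_zero_iff)
  then have "AE x in Exp. AE s in S. 0 < x \<and> 0 \<le> s"
    by eventually_elim (use S_nonneg in simp)
  moreover have "Measurable.pred X (\<lambda>y. 0 < fst y \<and> 0 \<le> snd y)"
    unfolding measurable_X by measurable
  ultimately show ?thesis
    by (intro XS.AE_pair_measure) (simp_all add: pred_def)
qed

lemma AE_P_component: "AE w in P. 0 < fst (w i) \<and> 0 \<le> snd (w i)"
  unfolding queue_input_def using AE_X by (intro seq.AE_component) auto

text \<open>The factor \<open>lam / (lam + 1)\<close> is the Laplace transform of an interarrival
  time at 1. The geometric bound makes \<open>exp (- arrival_time w k)\<close> summable in mean,
  which rules out that arrivals accumulate.\<close>

lemma exp_arrival_time: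
  "(\<integral>\<^sup>+w. ennreal (exp (- arrival_time w k)) \<partial>P) \<le> ennreal (lam / (lam + 1)) ^ k"
proof (induction k)
  case 0
  have "(\<integral>\<^sup>+w. ennreal (exp (- arrival_time w 0)) \<partial>P) \<le> (\<integral>\<^sup>+w. 1 \<partial>P)"
    using AE_P_component[of 0]
    by (intro nn_integral_mono_AE) (auto elim!: eventually_mono simp: arrival_time_def)
  then show ?case by (simp add: P.emeasure_space_1[unfolded space_P])
next
  case (Suc k)
  have c: "(\<integral>\<^sup>+y. ennreal (exp (- fst y)) \<partial>X) = ennreal (lam / (lam + 1))"
  proof -
    have "(\<integral>\<^sup>+y. ennreal (exp (- fst y)) \<partial>X) = (\<integral>\<^sup>+x. ennreal (exponential_density lam x) * ennreal (exp (- x)) \<partial>lborel)"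
      by (subst nn_integral_X) (simp_all add: S.emeasure_space_1)
    also have "\<dots> = (\<integral>\<^sup>+x. ennreal (lam / (lam + 1)) * ennreal (exponential_density (lam + 1) x) \<partial>lborel)"
    proof (intro nn_integral_cong)
      fix x
      have "exp (- x * lam) * exp (- x) = exp (- x * (lam + 1))"
        by (simp add: mult_exp_exp algebra_simps)
      then have "exponential_density lam x * exp (- x) = lam / (lam + 1) * exponential_density (lam + 1) x"
        using lam by (simp add: exponential_density_def mult.assoc)
      then show "ennreal (exponential_density lam x) * ennreal (exp (- x)) = ennreal (lam / (lam + 1)) * ennreal (exponential_density (lam + 1) x)"
        using lam by (simp only: ennreal_mult'[symmetric] ennreal_mult''[symmetric] exp_ge_zero exponential_density_nonneg divide_nonneg_pos)
    qed
    also have "\<dots> = ennreal (lam / (lam + 1)) * emeasure (density lborel (exponential_density (lam + 1))) UNIV"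
      by (simp add: nn_integral_cmult emeasure_density)
    also have "emeasure (density lborel (exponential_density (lam + 1))) UNIV = 1"
      using prob_space.emeasure_space_1[OF prob_space_exponential_density[of "lam + 1"]] lam by simp
    finally show ?thesis by simp
  qed
  have "(\<integral>\<^sup>+w. ennreal (exp (- arrival_time w (Suc k))) \<partial>P)
      = (\<integral>\<^sup>+w. (\<integral>\<^sup>+y. ennreal (exp (- arrival_time (w(Suc k := y)) (Suc k))) \<partial>X) \<partial>P)"
    by (rule nn_integral_fun_upd) (simp add: measurable_P)
  also have "\<dots> = (\<integral>\<^sup>+w. (\<integral>\<^sup>+y. ennreal (exp (- arrival_time w k)) * ennreal (exp (- fst y)) \<partial>X) \<partial>P)"
  proof (intro nn_integral_cong)
    fix w :: "nat \<Rightarrow> real \<times> real" and y :: "real \<times> real"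
    have "arrival_time (w(Suc k := y)) k = arrival_time w k" by (rule arrival_time_cong) simp
    then show "ennreal (exp (- arrival_time (w(Suc k := y)) (Suc k))) = ennreal (exp (- arrival_time w k)) * ennreal (exp (- fst y))"
      by (simp add: arrival_time_Suc ennreal_mult[symmetric] mult_exp_exp)
  qed
  also have "\<dots> = (\<integral>\<^sup>+w. ennreal (exp (- arrival_time w k)) * ennreal (lam / (lam + 1)) \<partial>P)"
    by (subst nn_integral_cmult) (simp_all add: measurable_X c)
  also have "\<dots> = (\<integral>\<^sup>+w. ennreal (exp (- arrival_time w k)) \<partial>P) * ennreal (lam / (lam + 1))"
    by (rule nn_integral_multc) (simp add: measurable_P)
  also have "\<dots> \<le> ennreal (lam / (lam + 1)) ^ k * ennreal (lam / (lam + 1))"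
    by (intro mult_right_mono Suc) simp
  finally show ?case by (simp add: mult.commute)
qed

lemma AE_good_path: "AE w in P. good_path w"
proof -
  let ?c = "lam / (lam + 1)"
  have c: "0 \<le> ?c" "?c < 1" using lam by auto
  have [measurable]: "(\<lambda>w. ennreal (exp (- arrival_time w k))) \<in> borel_measurable P" for k
    by (simp add: measurable_P)
  have "(\<integral>\<^sup>+w. (\<Sum>k. ennreal (exp (- arrival_time w k))) \<partial>P) = (\<Sum>k. \<integral>\<^sup>+w. ennreal (exp (- arrival_time w k)) \<partial>P)"
    by (rule nn_integral_suminf) measurable
  also have "\<dots> \<le> (\<Sum>k. ennreal (?c ^ k))"
    by (intro suminf_le summableI) (use exp_arrival_time c in \<open>simp add: ennreal_power\<close>)
  also have "\<dots> = ennreal (\<Sum>k. ?c ^ k)"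
    using c by (intro suminf_ennreal_eq summable_sums summable_geometric)
      (simp_all only: real_norm_def abs_of_nonneg zero_le_power)
  finally have "(\<integral>\<^sup>+w. (\<Sum>k. ennreal (exp (- arrival_time w k))) \<partial>P) \<noteq> \<infinity>"
    by (auto simp: top_unique)
  then have "AE w in P. (\<Sum>k. ennreal (exp (- arrival_time w k))) \<noteq> \<infinity>"
    by (intro nn_integral_PInf_AE) measurable
  moreover have "AE w in P. \<forall>i. 0 < fst (w i) \<and> 0 \<le> snd (w i)"
    by (rule AE_all_countable[THEN iffD2]) (intro allI AE_P_component)
  ultimately show ?thesis
  proof eventually_elim
    fix w :: "nat \<Rightarrow> real \<times> real"
    assume fin: "(\<Sum>k. ennreal (exp (- arrival_time w k))) \<noteq> \<infinity>" and pos: "\<forall>i. 0 < fst (w i) \<and> 0 \<le> snd (w i)"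
    have "\<exists>k. t < arrival_time w k" for t
    proof (rule ccontr)
      assume "\<not> ?thesis"
      then have le: "exp (- t) \<le> exp (- arrival_time w k)" for k by (simp add: not_less)
      define r where "r = enn2real (\<Sum>k. ennreal (exp (- arrival_time w k)))"
      have r: "(\<Sum>k. ennreal (exp (- arrival_time w k))) = ennreal r" "0 \<le> r"
        unfolding r_def using fin by (simp_all add: less_top)
      have "real K * exp (- t) \<le> r" for K
      proof -
        have "ennreal (real K * exp (- t)) = (\<Sum>k<K. ennreal (exp (- t)))"
          by (subst sum_ennreal) simp_all
        also have "\<dots> \<le> (\<Sum>k<K. ennreal (exp (- arrival_time w k)))"
          by (intro sum_mono ennreal_leI le)
        also have "\<dots> \<le> ennreal r" unfolding r(1)[symmetric] by (rule sum_le_suminf) simp_all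
        finally show ?thesis using r(2) by (simp only: ennreal_le_iff)
      qed
      moreover obtain K where "r < real K * exp (- t)" using reals_Archimedean3[of "exp (- t)"] exp_gt_zero by blast
      ultimately show False by (meson not_less)
    qed
    then show "good_path w" using pos by (simp add: good_path_def)
  qed
qed

lemma nn_integral_S: "(\<integral>\<^sup>+s. ennreal s \<partial>S) = ennreal mu"
  unfolding mu_def by (rule nn_integral_eq_integral[OF S_int S_nonneg])

lemma pred_P_intro: "Measurable.pred path_space Q \<Longrightarrow> Measurable.pred P Q"
  by (simp add: measurable_P)

lemma indicator_measurable_path:
  "Measurable.pred path_space Q \<Longrightarrow> (\<lambda>w. indicator {w. Q w} w :: ennreal) \<in> borel_measurable path_space"
  by (intro borel_measurable_indicator) (simp add: pred_def space_PiM)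

lemma emeasure_P_Collect:
  assumes "Measurable.pred path_space Q"
  shows "emeasure P {w. Q w} = (\<integral>\<^sup>+w. indicator {w. Q w} w \<partial>P)"
  using pred_P_intro[OF assms] by (subst nn_integral_indicator) (simp_all add: pred_def)

definition enter :: "nat \<Rightarrow> (nat \<Rightarrow> real \<times> real) \<Rightarrow> bool" where
  "enter i w \<longleftrightarrow> alive n w i \<and> is_admitted n w i"

lemma pred_enter [measurable]: "Measurable.pred path_space (enter i)"
  unfolding enter_def by measurable

text \<open>Whether job \<open>i\<close> enters is determined by earlier jobs and by its
  interarrival time, so its own service can be averaged separately.\<close>

lemma wald_component:
  "(\<integral>\<^sup>+w. indicator {w. enter i w} w * ennreal (snd (w i)) \<partial>P) = ennreal mu * emeasure P {w. enter i w}"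
proof -
  have ind [measurable]: "(\<lambda>w. indicator {w. enter i w} w :: ennreal) \<in> borel_measurable path_space"
    by (rule indicator_measurable_path) measurable
  \<comment> \<open>Setting the service time of job \<open>i\<close> to 0 gives a version of the
    indicator that, for a fixed path, visibly depends on \<open>x\<close> alone.\<close>
  define h where "h w x = (indicator {w. enter i w} (w(i := (x, 0))) :: ennreal)" for w x
  have upd: "indicator {w. enter i w} (w(i := (x, s))) = h w x" for w x s
  proof -
    have "alive n (w(i := (x, s))) i = alive n (w(i := (x, 0))) i" by (rule alive_cong) auto
    moreover have "is_admitted n (w(i := (x, s))) i = is_admitted n (w(i := (x, 0))) i" by (rule is_admitted_cong) auto
    ultimately show ?thesis by (simp add: h_def enter_def indicator_def)
  qed
  have meas: "(\<lambda>y. f (w(i := y))) \<in> borel_measurable borel" if "f \<in> borel_measurable path_space" for f :: "_ \<Rightarrow> ennreal" and w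
    using measurable_compose[OF measurable_fun_upd_right measurable_P_intro[OF that]] by (simp add: measurable_X)
  have inner: "(\<integral>\<^sup>+y. indicator {w. enter i w} (w(i := y)) * ennreal (snd y) \<partial>X)
      = (\<integral>\<^sup>+y. indicator {w. enter i w} (w(i := y)) \<partial>X) * ennreal mu" for w
  proof -
    have [measurable]: "(\<lambda>y. indicator {w. enter i w} (w(i := y)) :: ennreal) \<in> borel_measurable borel"
      by (rule meas) measurable
    have "(\<lambda>x. (x, 0)) \<in> measurable borel (borel :: (real \<times> real) measure)"
      by (intro borel_measurable_continuous_onI continuous_intros)
    then have h: "h w \<in> borel_measurable borel"
      unfolding h_def by (rule measurable_compose) measurable
    have "(\<integral>\<^sup>+y. indicator {w. enter i w} (w(i := y)) * ennreal (snd y) \<partial>X)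
        = (\<integral>\<^sup>+x. ennreal (exponential_density lam x) * (\<integral>\<^sup>+s. h w x * ennreal s \<partial>S) \<partial>lborel)"
      by (subst nn_integral_X) (measurable, simp only: upd snd_conv)
    also have "\<dots> = (\<integral>\<^sup>+x. (ennreal (exponential_density lam x) * h w x) * ennreal mu \<partial>lborel)"
    proof (intro nn_integral_cong)
      fix x
      have "(\<integral>\<^sup>+s. h w x * ennreal s \<partial>S) = h w x * ennreal mu"
        by (subst nn_integral_cmult) (simp_all add: nn_integral_S)
      then show "ennreal (exponential_density lam x) * (\<integral>\<^sup>+s. h w x * ennreal s \<partial>S)
          = (ennreal (exponential_density lam x) * h w x) * ennreal mu" by (simp only: mult.assoc)
    qed
    also have "\<dots> = (\<integral>\<^sup>+x. ennreal (exponential_density lam x) * h w x \<partial>lborel) * ennreal mu"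
      using h by (intro nn_integral_multc) measurable
    also have "(\<integral>\<^sup>+x. ennreal (exponential_density lam x) * h w x \<partial>lborel)
        = (\<integral>\<^sup>+x. ennreal (exponential_density lam x) * (\<integral>\<^sup>+s. h w x \<partial>S) \<partial>lborel)"
      by (simp only: nn_integral_const S.emeasure_space_1 mult_1_right)
    also have "\<dots> = (\<integral>\<^sup>+y. indicator {w. enter i w} (w(i := y)) \<partial>X)"
      by (subst nn_integral_X) (measurable, simp only: upd)
    finally show ?thesis .
  qed
  have "(\<integral>\<^sup>+w. indicator {w. enter i w} w * ennreal (snd (w i)) \<partial>P)
      = (\<integral>\<^sup>+w. (\<integral>\<^sup>+y. indicator {w. enter i w} (w(i := y)) * ennreal (snd ((w(i := y)) i)) \<partial>X) \<partial>P)"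
    by (rule nn_integral_fun_upd) (simp add: measurable_P)
  also have "\<dots> = (\<integral>\<^sup>+w. (\<integral>\<^sup>+y. indicator {w. enter i w} (w(i := y)) \<partial>X) * ennreal mu \<partial>P)"
    by (simp only: fun_upd_same inner)
  also have "\<dots> = (\<integral>\<^sup>+w. (\<integral>\<^sup>+y. indicator {w. enter i w} (w(i := y)) \<partial>X) \<partial>P) * ennreal mu"
  proof (rule nn_integral_multc)
    have "(\<lambda>z. indicator {w. enter i w} ((fst z)(i := snd z)) :: ennreal) \<in> borel_measurable (P \<Otimes>\<^sub>M X)"
      using measurable_compose[OF fun_upd_measurable[of i] measurable_P_intro[OF ind]]
      by (simp only: split_beta')
    then show "(\<lambda>w. \<integral>\<^sup>+y. indicator {w. enter i w} (w(i := y)) \<partial>X) \<in> borel_measurable P"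
      using XS.borel_measurable_nn_integral_fst[of "\<lambda>z. indicator {w. enter i w} ((fst z)(i := snd z))" P] by simp
  qed
  also have "(\<integral>\<^sup>+w. (\<integral>\<^sup>+y. indicator {w. enter i w} (w(i := y)) \<partial>X) \<partial>P) = (\<integral>\<^sup>+w. indicator {w. enter i w} w \<partial>P)"
    by (rule nn_integral_fun_upd[symmetric]) (simp add: measurable_P)
  also have "\<dots> = emeasure P {w. enter i w}"
    by (rule emeasure_P_Collect[symmetric]) measurable
  finally show ?thesis by (simp add: mult.commute)
qed

section \<open>The martingale of predicted admissions\<close>

definition future_joins :: "nat \<Rightarrow> (nat \<Rightarrow> real \<times> real) \<Rightarrow> real" where
  "future_joins i w = (if alive n w i then expected_joins (backlog n w i) 0 else 0)"

lemma future_joins_measurable [measurable]: "future_joins i \<in> borel_measurable path_space"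
proof -
  have [measurable]: "(\<lambda>w. expected_joins (backlog n w i) 0) \<in> borel_measurable path_space"
    by (rule expected_joins_measurable[of _ _ n]) (simp_all add: list_measurable_backlog length_backlog)
  show ?thesis unfolding future_joins_def by measurable
qed

lemma future_joins_bounded: "\<exists>C\<ge>0. \<forall>i w. \<bar>future_joins i w\<bar> \<le> (if alive n w i then C else 0)"
proof -
  obtain C where C: "\<And>gs i. length gs \<le> n \<Longrightarrow> i \<le> n \<Longrightarrow> \<bar>expected_joins gs i\<bar> \<le> C" using expected_joins_bounded_uniform by blast
  have "0 \<le> C" using C[of "[]" 0] by simp
  then show ?thesis using C[OF length_backlog] by (intro exI[of _ C]) (simp add: future_joins_def)
qed

text \<open>The \<open>- 1\<close> is job 0, which is already listed when the prediction
  starts.\<close>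

lemma expectation_future_joins_0: "(\<integral>w. future_joins 0 w \<partial>P) = served arrivals_tail (n - 1) - 1"
proof -
  obtain C where C: "0 \<le> C" "\<And>i w. \<bar>future_joins i w\<bar> \<le> (if alive n w i then C else 0)" using future_joins_bounded by blast
  have C': "\<bar>future_joins 0 w\<bar> \<le> C" for w using C(2)[of 0 w] C(1) by (simp split: if_splits)
  have Y0: "future_joins 0 (w(0 := y)) = expected_joins ([] @ [snd y]) 0" for w y
    using n by (simp add: future_joins_def alive_def admit_def)
  have "(\<integral>w. future_joins 0 w \<partial>P) = (\<integral>w. (\<integral>y. future_joins 0 (w(0 := y)) \<partial>X) \<partial>P)"
    by (rule integral_fun_upd[OF _ C']) (simp add: measurable_P)
  also have "\<dots> = (\<integral>y. expected_joins ([] @ [snd y]) 0 \<partial>X)"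
    unfolding Y0 by (subst lebesgue_integral_const) (simp only: P.prob_space scaleR_one)
  also have "\<dots> = (\<integral>x. exponential_density lam x * (\<integral>s. expected_joins ([] @ [s]) 0 \<partial>S) \<partial>lborel)"
  proof (subst integral_X[where C = C])
    show "(\<lambda>y :: real \<times> real. expected_joins ([] @ [snd y]) 0) \<in> borel_measurable borel"
      using expected_joins_measurable[of borel "\<lambda>y :: real \<times> real. [snd y]" 1 0, OF
        list_measurable_Cons[OF list_measurable_const measurable_snd_borel, of "[]"]] by (simp del: expected_joins.simps)
    show "\<bar>expected_joins ([] @ [snd y]) 0\<bar> \<le> C" for y :: "real \<times> real"
      using C'[of "(\<lambda>_. y)(0 := y)"] unfolding Y0 .
  qed simp
  also have "(\<integral>s. expected_joins ([] @ [s]) 0 \<partial>S) = expected_joins [] 1 - 1"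
    using integral_expected_joins_snoc[of "[]" 0] n by simp
  also have "(\<integral>x. exponential_density lam x * (expected_joins [] 1 - 1) \<partial>lborel) = expected_joins [] 1 - 1"
    by (simp add: integral_exponential_density[OF lam])
  finally show ?thesis by simp
qed

text \<open>One martingale step. Averaging over the service of job \<open>Suc i\<close> turns it
  back into an unlisted job, and averaging over the interarrival time then restores the previous
  prediction. The indicator accounts for the job that has become listed.\<close>

lemma expectation_future_joins_Suc:
  "(\<integral>w. future_joins (Suc i) w \<partial>P) = (\<integral>w. future_joins i w \<partial>P) - measure P {w. enter (Suc i) w}"
proof -
  obtain C where C: "0 \<le> C" "\<And>i w. \<bar>future_joins i w\<bar> \<le> (if alive n w i then C else 0)" using future_joins_bounded by blast
  have C': "\<bar>future_joins i w\<bar> \<le> C" for i w using C(2)[of i w] C(1) by (simp split: if_splits)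
  define F where "F w = future_joins (Suc i) w + indicator {w. enter (Suc i) w} w" for w
  have ind_meas [measurable]: "(\<lambda>w. indicator {w. enter (Suc i) w} w :: real) \<in> borel_measurable path_space"
    by (intro borel_measurable_indicator) (use pred_enter[of "Suc i"] in \<open>simp add: pred_def space_PiM\<close>)
  have F_meas [measurable]: "F \<in> borel_measurable path_space" unfolding F_def by measurable
  have F_bound: "\<bar>F w\<bar> \<le> C + 1" for w
    using C'[of "Suc i" w] by (auto simp: F_def indicator_def)
  have F_upd_meas: "(\<lambda>y. F (w(Suc i := y))) \<in> borel_measurable borel" for w
    using measurable_compose[OF measurable_fun_upd_right measurable_P_intro[OF F_meas]] by (simp add: measurable_X)
  have "(\<integral>w. F w \<partial>P) = (\<integral>w. (\<integral>y. F (w(Suc i := y)) \<partial>X) \<partial>P)"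
    by (rule integral_fun_upd[OF _ F_bound]) (simp add: measurable_P)
  also have "\<dots> = (\<integral>w. future_joins i w \<partial>P)"
  proof (rule integral_cong_AE)
    have "(\<lambda>z. F ((fst z)(Suc i := snd z))) \<in> borel_measurable (P \<Otimes>\<^sub>M X)"
      using measurable_compose[OF fun_upd_measurable measurable_P_intro[OF F_meas]] by (simp add: split_beta')
    then show "(\<lambda>w. \<integral>y. F (w(Suc i := y)) \<partial>X) \<in> borel_measurable P"
      by (intro XS.borel_measurable_lebesgue_integral) (simp add: split_beta')
    show "future_joins i \<in> borel_measurable P" by (simp add: measurable_P)
    show "AE w in P. (\<integral>y. F (w(Suc i := y)) \<partial>X) = future_joins i w"
      using AE_good_path
    proof eventually_elim
      fix w assume w: "good_path w"
      define st where "st = backlog n w i"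
      have st: "\<forall>r\<in>set st. 0 \<le> r" "length st \<le> n"
        using backlog_nonneg[OF w] length_backlog by (auto simp: st_def)
      have b: "backlog n (w(Suc i := y)) i = st" for y
        unfolding st_def by (rule backlog_cong) auto
      have a: "alive n (w(Suc i := y)) i = alive n w i" for y by (rule alive_cong) auto
      have F_upd: "F (w(Suc i := (x, s))) = (if alive n w i \<and> x < sum_list st then
          (if length (consume x st) < n then 1 + expected_joins (consume x st @ [s]) 0 else expected_joins (consume x st) 0) else 0)" for x s
        by (simp add: F_def future_joins_def enter_def alive_Suc is_admitted_def admit_def b a)
      have inner: "exponential_density lam x * (\<integral>s. F (w(Suc i := (x, s))) \<partial>S)
        = (if alive n w i then exponential_density lam x * joins_after (consume x st) else 0)" for x
      proof (cases "0 \<le> x")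
        case True
        define c where "c = consume x st"
        have c_len: "length c \<le> n" using length_consume_le[of x st] st by (simp add: c_def)
        have c_Nil: "c = [] \<longleftrightarrow> \<not> x < sum_list st"
          unfolding c_def consume_eq_Nil_iff[OF True st(1)] by auto
        show ?thesis
        proof (cases "alive n w i \<and> c \<noteq> []")
          case True
          then have "(\<integral>s. F (w(Suc i := (x, s))) \<partial>S) = joins_after c"
          proof (cases "length c < n")
            case len: True
            have "(\<integral>s. F (w(Suc i := (x, s))) \<partial>S) = (\<integral>s. 1 + expected_joins (c @ [s]) 0 \<partial>S)"
              using True c_Nil len unfolding F_upd c_def[symmetric] by simp
            also have "\<dots> = expected_joins c 1"
              using expected_joins_snoc_int[of c 0] integral_expected_joins_snoc[of c 0] len by (simp add: S.prob_space)
            finally have "(\<integral>s. F (w(Suc i := (x, s))) \<partial>S) = expected_joins c 1" .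
            moreover have "min 1 (n - length c) = 1" using len by linarith
            ultimately show ?thesis using True by (simp add: joins_after_def)
          next
            case len: False
            have "(\<integral>s. F (w(Suc i := (x, s))) \<partial>S) = (\<integral>s. expected_joins c 0 \<partial>S)"
              using True c_Nil len unfolding F_upd c_def[symmetric] by simp
            then show ?thesis using True len by (simp add: joins_after_def S.prob_space)
          qed
          then show ?thesis using True by (simp add: c_def)
        next
          case False
          then have "(\<integral>s. F (w(Suc i := (x, s))) \<partial>S) = 0" using c_Nil unfolding F_upd by auto
          then show ?thesis using False by (auto simp: joins_after_def c_def)
        qed
      qed (simp add: exponential_density_def)
      have "(\<integral>y. F (w(Suc i := y)) \<partial>X) = (\<integral>x. exponential_density lam x * (\<integral>s. F (w(Suc i := (x, s))) \<partial>S) \<partial>lborel)"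
        by (rule integral_X[OF F_upd_meas F_bound])
      also have "\<dots> = (if alive n w i then (\<integral>x. exponential_density lam x * joins_after (consume x st) \<partial>lborel) else 0)"
        unfolding inner by simp
      also have "\<dots> = future_joins i w"
        using integral_joins_after_consume[OF st(2,1)] by (simp add: future_joins_def st_def has_bochner_integral_iff)
      finally show "(\<integral>y. F (w(Suc i := y)) \<partial>X) = future_joins i w" .
    qed
  qed
  also have "(\<integral>w. F w \<partial>P) = (\<integral>w. future_joins (Suc i) w \<partial>P) + measure P {w. enter (Suc i) w}"
  proof -
    have "integrable P (future_joins (Suc i))"
      by (rule P.integrable_const_bound[of _ C]) (simp_all add: C' measurable_P)
    moreover have "{w. enter (Suc i) w} \<in> sets P"
      using pred_P_intro[OF pred_enter[of "Suc i"]] by (simp add: pred_def)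
    ultimately show ?thesis unfolding F_def
      by (subst Bochner_Integration.integral_add) (auto simp: P.emeasure_eq_measure)
  qed
  finally show ?thesis by simp
qed

lemma sum_enter: "(\<Sum>i\<le>K. measure P {w. enter i w}) = served arrivals_tail (n - 1) - (\<integral>w. future_joins K w \<partial>P)"
proof (induction K)
  case 0
  have "{w. enter 0 w} = space P" using n by (auto simp: enter_def alive_def is_admitted_def)
  then have "measure P {w. enter 0 w} = 1" by (simp only: P.prob_space)
  then show ?case by (simp add: expectation_future_joins_0)
next
  case (Suc K)
  then show ?case by (simp add: expectation_future_joins_Suc)
qed

lemma emeasure_enter: "emeasure P {w. enter i w} = ennreal (measure P {w. enter i w})"
  by (rule P.emeasure_eq_measure)

definition worked :: "nat \<Rightarrow> (nat \<Rightarrow> real \<times> real) \<Rightarrow> ennreal" where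
  "worked i w = (if alive n w i then ennreal (min (fst (w (Suc i))) (sum_list (backlog n w i))) else 0)"

definition joined :: "nat \<Rightarrow> (nat \<Rightarrow> real \<times> real) \<Rightarrow> ennreal" where
  "joined i w = (if enter i w then ennreal (snd (w i)) else 0)"

lemma worked_measurable [measurable]: "worked i \<in> borel_measurable path_space"
  unfolding worked_def by measurable

lemma joined_measurable [measurable]: "joined i \<in> borel_measurable path_space"
  unfolding joined_def by measurable

lemma nn_integral_joined: "(\<integral>\<^sup>+w. joined i w \<partial>P) = ennreal (mu * measure P {w. enter i w})"
proof -
  have "joined i w = indicator {w. enter i w} w * ennreal (snd (w i))" for w
    by (simp add: joined_def indicator_def)
  then show ?thesis using wald_component[of i]
    by (simp add: emeasure_enter ennreal_mult mu_nonneg)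
qed

lemma worked_partial_sum:
  assumes w: "good_path w"
  shows "(\<Sum>i<K. worked i w) + (if alive n w K then ennreal (sum_list (backlog n w K)) else 0)
    = (\<Sum>i\<le>K. joined i w)"
proof -
  have L: "0 \<le> sum_list (backlog n w i)" for i
    using backlog_nonneg[OF w] by (intro sum_list_nonneg) auto
  have 1: "worked i w = ennreal (if alive n w i then min (fst (w (Suc i))) (sum_list (backlog n w i)) else 0)" for i
    by (simp add: worked_def)
  have 2: "joined i w = ennreal (if alive n w i \<and> is_admitted n w i then snd (w i) else 0)" for i
    by (simp add: joined_def enter_def)
  have nn1: "0 \<le> (if alive n w i then min (fst (w (Suc i))) (sum_list (backlog n w i)) else 0)" for i
    using L good_pathD[OF w] by simp
  have nn2: "0 \<le> (if alive n w i \<and> is_admitted n w i then snd (w i) else 0)" for i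
    using good_pathD[OF w] by simp
  have "(\<Sum>i<K. worked i w) + (if alive n w K then ennreal (sum_list (backlog n w K)) else 0)
    = ennreal (\<Sum>i<K. if alive n w i then min (fst (w (Suc i))) (sum_list (backlog n w i)) else 0)
     + ennreal (if alive n w K then sum_list (backlog n w K) else 0)"
    unfolding 1 by (subst sum_ennreal[OF nn1]) simp
  also have "\<dots> = ennreal ((\<Sum>i<K. if alive n w i then min (fst (w (Suc i))) (sum_list (backlog n w i)) else 0)
     + (if alive n w K then sum_list (backlog n w K) else 0))"
    by (rule ennreal_plus[symmetric]) (use nn1 L in \<open>auto intro!: sum_nonneg\<close>)
  also have "\<dots> = ennreal (\<Sum>i\<le>K. if alive n w i \<and> is_admitted n w i then snd (w i) else 0)"
    by (simp only: busy_work_partial_sum[OF w])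
  also have "\<dots> = (\<Sum>i\<le>K. joined i w)"
    unfolding 2 by (rule sum_ennreal[OF nn2, symmetric])
  finally show ?thesis .
qed

text \<open>A crude bound, obtained while \<open>future_joins\<close> is only known to be bounded;
  it serves to prove that busy periods end.\<close>

lemma nn_integral_worked_finite: "(\<integral>\<^sup>+w. (\<Sum>i. worked i w) \<partial>P) < \<infinity>"
proof -
  obtain C where C: "0 \<le> C" "\<And>i w. \<bar>future_joins i w\<bar> \<le> (if alive n w i then C else 0)" using future_joins_bounded by blast
  have C': "\<bar>future_joins i w\<bar> \<le> C" for i w using C(2)[of i w] C(1) by (simp split: if_splits)
  have le: "(\<Sum>i<K. \<integral>\<^sup>+w. worked i w \<partial>P) \<le> ennreal (mu * (served arrivals_tail (n - 1) + C))" for K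
  proof -
    have "(\<Sum>i<K. \<integral>\<^sup>+w. worked i w \<partial>P) = (\<integral>\<^sup>+w. (\<Sum>i<K. worked i w) \<partial>P)"
      by (rule nn_integral_sum[symmetric]) (simp add: measurable_P)
    also have "\<dots> \<le> (\<integral>\<^sup>+w. (\<Sum>i\<le>K. joined i w) \<partial>P)"
      using AE_good_path
    proof (intro nn_integral_mono_AE, eventually_elim)
      fix w assume w: "good_path w"
      show "(\<Sum>i<K. worked i w) \<le> (\<Sum>i\<le>K. joined i w)"
        unfolding worked_partial_sum[OF w, symmetric] by simp
    qed
    also have "\<dots> = (\<Sum>i\<le>K. \<integral>\<^sup>+w. joined i w \<partial>P)"
      by (rule nn_integral_sum) (simp add: measurable_P)
    also have "\<dots> = ennreal (\<Sum>i\<le>K. mu * measure P {w. enter i w})"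
      unfolding nn_integral_joined by (rule sum_ennreal) (simp add: mu_nonneg)
    also have "(\<Sum>i\<le>K. mu * measure P {w. enter i w}) = mu * (served arrivals_tail (n - 1) - (\<integral>w. future_joins K w \<partial>P))"
      by (simp only: sum_distrib_left[symmetric] sum_enter)
    also have "ennreal \<dots> \<le> ennreal (mu * (served arrivals_tail (n - 1) + C))"
    proof (intro ennreal_leI mult_left_mono mu_nonneg)
      have "\<bar>\<integral>w. future_joins K w \<partial>P\<bar> \<le> (\<integral>w. \<bar>future_joins K w\<bar> \<partial>P)" by (rule integral_abs_bound)
      also have "\<dots> \<le> (\<integral>w. C \<partial>P)"
        by (intro integral_mono P.integrable_const_bound[of _ C] AE_I2) (simp_all add: C C' measurable_P)
      also have "\<dots> = C" by (subst lebesgue_integral_const) (simp only: P.prob_space scaleR_one)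
      finally show "served arrivals_tail (n - 1) - (\<integral>w. future_joins K w \<partial>P) \<le> served arrivals_tail (n - 1) + C" by linarith
    qed
    finally show ?thesis .
  qed
  have "(\<integral>\<^sup>+w. (\<Sum>i. worked i w) \<partial>P) = (\<Sum>i. \<integral>\<^sup>+w. worked i w \<partial>P)"
    by (rule nn_integral_suminf) (simp add: measurable_P)
  also have "\<dots> \<le> ennreal (mu * (served arrivals_tail (n - 1) + C))"
    by (rule suminf_le_const[OF summableI le])
  also have "\<dots> < \<infinity>" by simp
  finally show ?thesis .
qed

text \<open>In a busy period without end the server works through all interarrival times, whose sum
  diverges on a good path.\<close>

lemma AE_eventually_dead: "AE w in P. \<exists>K. \<not> alive n w K"
proof -
  have "AE w in P. (\<Sum>i. worked i w) \<noteq> \<infinity>"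
    using nn_integral_worked_finite by (intro nn_integral_PInf_AE borel_measurable_suminf) (simp_all add: measurable_P)
  then show ?thesis using AE_good_path
  proof eventually_elim
    fix w assume fin: "(\<Sum>i. worked i w) \<noteq> \<infinity>" and w: "good_path w"
    show "\<exists>K. \<not> alive n w K"
    proof (rule ccontr)
      assume "\<not> ?thesis"
      then have al: "alive n w K" for K by blast
      define r where "r = enn2real (\<Sum>i. worked i w)"
      have r: "(\<Sum>i. worked i w) = ennreal r" "0 \<le> r"
        unfolding r_def using fin by (simp_all add: less_top)
      have eq: "worked i w = ennreal (fst (w (Suc i)))" for i
        using al[of "Suc i"] by (simp add: worked_def alive_Suc min_def)
      have "since_first w K \<le> r" for K
      proof -
        have "ennreal (since_first w K) = (\<Sum>i<K. worked i w)"
        proof -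
          have "since_first w K = (\<Sum>i<K. fst (w (Suc i)))"
            by (induction K) (simp_all add: since_first_Suc)
          then show ?thesis unfolding eq using good_pathD[OF w] by (subst sum_ennreal) simp_all
        qed
        also have "\<dots> \<le> ennreal r" unfolding r(1)[symmetric] by (rule sum_le_suminf) simp_all
        finally show ?thesis using r(2) by (simp only: ennreal_le_iff)
      qed
      then have "arrival_time w K \<le> r + fst (w 0)" for K
        by (simp add: since_first_def algebra_simps)
      then show False using w unfolding good_path_def by (meson not_less)
    qed
  qed
qed

lemma alive_tendsto_0: "(\<lambda>K. measure P {w. alive n w K}) \<longlonglongrightarrow> 0"
proof -
  have sets: "{w. alive n w K} \<in> sets P" for K
    using pred_P_intro[OF pred_alive[of n K]] by (simp add: pred_def)
  have "(\<lambda>K. measure P {w. alive n w K}) \<longlonglongrightarrow> measure P (\<Inter>K. {w. alive n w K})"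
    by (rule P.finite_Lim_measure_decseq) (use sets alive_mono in \<open>auto simp: decseq_def\<close>)
  also have "measure P (\<Inter>K. {w. alive n w K}) = 0"
  proof (rule P.prob_eq_0[THEN iffD2])
    show "(\<Inter>K. {w. alive n w K}) \<in> sets P" using sets by (intro sets.countable_INT) auto
    show "AE w in P. w \<notin> (\<Inter>K. {w. alive n w K})"
      using AE_eventually_dead by eventually_elim simp
  qed
  finally show ?thesis .
qed

text \<open>The telescoped sum differs from \<open>served\<close> by the mean prediction at job
  \<open>K\<close>, which is at most a constant times the probability that the busy period lasts
  that long.\<close>

lemma enter_sums: "(\<lambda>i. measure P {w. enter i w}) sums served arrivals_tail (n - 1)"
proof -
  obtain C where C: "0 \<le> C" "\<And>i w. \<bar>future_joins i w\<bar> \<le> (if alive n w i then C else 0)" using future_joins_bounded by blast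
  have sets: "{w. alive n w K} \<in> sets P" for K
    using pred_P_intro[OF pred_alive[of n K]] by (simp add: pred_def)
  have "\<bar>\<integral>w. future_joins K w \<partial>P\<bar> \<le> C * measure P {w. alive n w K}" for K
  proof -
    have "\<bar>\<integral>w. future_joins K w \<partial>P\<bar> \<le> (\<integral>w. \<bar>future_joins K w\<bar> \<partial>P)" by (rule integral_abs_bound)
    also have "\<dots> \<le> (\<integral>w. C * indicator {w. alive n w K} w \<partial>P)"
    proof (intro integral_mono)
      have "\<bar>future_joins K w\<bar> \<le> C" for w using C(2)[of K w] C(1) by (simp split: if_splits)
      then show "integrable P (\<lambda>w. \<bar>future_joins K w\<bar>)"
        by (intro P.integrable_const_bound[of _ C]) (simp_all add: measurable_P)
      show "integrable P (\<lambda>w. C * indicator {w. alive n w K} w)"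
        using sets by (intro integrable_mult_right integrable_real_indicator) (auto simp: P.emeasure_eq_measure)
      show "\<bar>future_joins K w\<bar> \<le> C * indicator {w. alive n w K} w" for w
        using C(2)[of K w] by (cases "alive n w K") simp_all
    qed
    also have "\<dots> = C * measure P {w. alive n w K}" by simp
    finally show ?thesis .
  qed
  then have "(\<lambda>K. \<integral>w. future_joins K w \<partial>P) \<longlonglongrightarrow> 0"
    by (intro Lim_null_comparison[OF _ tendsto_mult_right_zero[OF alive_tendsto_0, of C]]) (auto intro: always_eventually)
  then have "(\<lambda>K. \<Sum>i\<le>K. measure P {w. enter i w}) \<longlonglongrightarrow> served arrivals_tail (n - 1) - 0"
    unfolding sum_enter by (intro tendsto_intros)
  then show ?thesis by (simp add: sums_def_le)
qed

text \<open>Wald's identity: the length of a busy period is the sum of the services of the jobs that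
  it admits.\<close>

theorem nn_integral_busy_period:
  "(\<integral>\<^sup>+w. emeasure lborel {y. 0 \<le> y \<and> busy_until n w y} \<partial>P) = ennreal (mu * served arrivals_tail (n - 1))"
proof -
  have "(\<integral>\<^sup>+w. emeasure lborel {y. 0 \<le> y \<and> busy_until n w y} \<partial>P) = (\<integral>\<^sup>+w. (\<Sum>i. joined i w) \<partial>P)"
    using AE_good_path AE_eventually_dead
  proof (intro nn_integral_cong_AE, eventually_elim)
    fix w assume w: "good_path w" and "\<exists>K. \<not> alive n w K"
    then obtain K where K: "\<not> alive n w K" by blast
    have dead: "\<not> alive n w i" if "K \<le> i" for i using K alive_mono[OF that] by blast
    have "emeasure lborel {y. 0 \<le> y \<and> busy_until n w y} = (\<Sum>i. worked i w)"
      unfolding emeasure_busy_period[OF w] by (intro suminf_cong) (simp add: worked_def indicator_def)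
    also have "\<dots> = (\<Sum>i<K. worked i w)"
      by (rule suminf_finite) (simp_all add: worked_def dead)
    also have "\<dots> = (\<Sum>i\<le>K. joined i w)"
      using worked_partial_sum[OF w, of K] K by simp
    also have "\<dots> = (\<Sum>i. joined i w)"
      by (rule suminf_finite[symmetric]) (simp_all add: joined_def enter_def dead)
    finally show "emeasure lborel {y. 0 \<le> y \<and> busy_until n w y} = (\<Sum>i. joined i w)" .
  qed
  also have "\<dots> = (\<Sum>i. \<integral>\<^sup>+w. joined i w \<partial>P)"
    by (rule nn_integral_suminf) (simp add: measurable_P)
  also have "\<dots> = (\<Sum>i. ennreal (mu * measure P {w. enter i w}))"
    unfolding nn_integral_joined ..
  also have "\<dots> = ennreal (mu * served arrivals_tail (n - 1))"
    by (rule suminf_ennreal_eq[OF _ sums_mult[OF enter_sums]]) (simp add: mu_nonneg)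
  finally show ?thesis .
qed

end

section \<open>Restarting the path at an arrival\<close>

lemma measurable_comb_seq_shift:
  "(\<lambda>w i. w (k + i)) \<in> measurable path_space path_space"
  by (rule measurable_PiM_single') auto

lemma prev_arrival_cong:
  "(\<And>i. i < k \<Longrightarrow> fst (w i) = fst (w' i)) \<Longrightarrow> prev_arrival w k = prev_arrival w' k"
  by (cases k) (auto simp: prev_arrival_def intro: arrival_time_cong)

lemma prev_work_cong:
  "(\<And>i. i < k \<Longrightarrow> w i = w' i) \<Longrightarrow> prev_work n w k = prev_work n w' k"
  by (cases k) (auto simp: prev_work_def intro!: arg_cong[of _ _ sum_list] backlog_cong)

text \<open>A busy period is counted from the arrival of its first job, hence is independent of the
  idle time before it.\<close>

lemma busy_until_upd_fst: "busy_until n (w(0 := (x, snd (w 0)))) y = busy_until n w y"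
proof -
  have "backlog n (w(0 := (x, snd (w 0)))) i = backlog n w i" for i
    by (rule backlog_cong) auto
  moreover have "since_first (w(0 := (x, snd (w 0)))) i = since_first w i" for i
    by (induction i) (simp_all add: since_first_Suc)
  ultimately show ?thesis by (simp add: busy_until_def)
qed

context mg1n
begin

sublocale PE: pair_prob_space P Exp ..
sublocale EP: pair_prob_space Exp P ..
sublocale PL: pair_sigma_finite P lborel ..

lemma fst_upd_measurable: "(\<lambda>(w, x). w(0 := (x, snd (w 0)))) \<in> measurable (P \<Otimes>\<^sub>M Exp) P"
proof -
  have [measurable]: "(\<lambda>z. snd (fst z 0)) \<in> measurable (P \<Otimes>\<^sub>M Exp) S"
    unfolding queue_input_def by measurable
  have "(\<lambda>z. (fst z)(0 := (snd z, snd (fst z 0)))) \<in> measurable (P \<Otimes>\<^sub>M Exp) P"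
    unfolding queue_input_def
    by (rule measurable_fun_upd[of UNIV UNIV "0 :: nat"]) (auto simp: queue_input_def[symmetric])
  then show ?thesis by (simp add: split_beta')
qed

text \<open>Resamples the interarrival time of job 0 but keeps its service. Both sides agree once
  the whole coordinate is resampled, by Fubini in its two components.\<close>

lemma nn_integral_fst_upd:
  assumes F [measurable]: "F \<in> borel_measurable P"
  shows "(\<integral>\<^sup>+w. F w \<partial>P) = (\<integral>\<^sup>+w. (\<integral>\<^sup>+x. F (w(0 := (x, snd (w 0)))) \<partial>Exp) \<partial>P)"
proof -
  define G where "G w = (\<integral>\<^sup>+x. F (w(0 := (x, snd (w 0)))) \<partial>Exp)" for w
  have "(\<lambda>z. F ((fst z)(0 := (snd z, snd (fst z 0))))) \<in> borel_measurable (P \<Otimes>\<^sub>M Exp)"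
    using measurable_compose[OF fst_upd_measurable F] by (simp add: split_beta')
  then have G: "G \<in> borel_measurable P"
    unfolding G_def using Exp.borel_measurable_nn_integral_fst[of "\<lambda>z. F ((fst z)(0 := (snd z, snd (fst z 0))))" P] by simp
  have Fw: "(\<lambda>y. F (w(0 := y))) \<in> borel_measurable X" for w
    using measurable_compose[OF measurable_fun_upd_right F] .
  have Gw: "(\<lambda>y. G (w(0 := y))) \<in> borel_measurable X" for w
    using measurable_compose[OF measurable_fun_upd_right G] .
  have "(\<integral>\<^sup>+w. G w \<partial>P) = (\<integral>\<^sup>+w. (\<integral>\<^sup>+y. G (w(0 := y)) \<partial>X) \<partial>P)"
    by (rule nn_integral_fun_upd[OF G])
  also have "\<dots> = (\<integral>\<^sup>+w. (\<integral>\<^sup>+y. F (w(0 := y)) \<partial>X) \<partial>P)"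
  proof (rule nn_integral_cong)
    fix w
    have "(\<integral>\<^sup>+y. G (w(0 := y)) \<partial>X) = (\<integral>\<^sup>+x'. (\<integral>\<^sup>+s. (\<integral>\<^sup>+x. F (w(0 := (x, s))) \<partial>Exp) \<partial>S) \<partial>Exp)"
      by (subst S.nn_integral_fst[OF Gw, symmetric]) (simp add: G_def)
    also have "\<dots> = (\<integral>\<^sup>+s. (\<integral>\<^sup>+x. F (w(0 := (x, s))) \<partial>Exp) \<partial>S)"
      by (simp only: nn_integral_const Exp.emeasure_space_1 mult_1_right)
    also have "\<dots> = (\<integral>\<^sup>+x. (\<integral>\<^sup>+s. F (w(0 := (x, s))) \<partial>S) \<partial>Exp)"
      by (rule XS.Fubini') (use Fw[of w] in \<open>simp add: split_beta'\<close>)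
    also have "\<dots> = (\<integral>\<^sup>+y. F (w(0 := y)) \<partial>X)"
      by (rule S.nn_integral_fst[OF Fw])
    finally show "(\<integral>\<^sup>+y. G (w(0 := y)) \<partial>X) = (\<integral>\<^sup>+y. F (w(0 := y)) \<partial>X)" .
  qed
  also have "\<dots> = (\<integral>\<^sup>+w. F w \<partial>P)" by (rule nn_integral_fun_upd[OF F, symmetric])
  finally show ?thesis by (simp add: G_def)
qed

lemma nn_integral_comb_seq:
  assumes F [measurable]: "F \<in> borel_measurable P"
  shows "(\<integral>\<^sup>+w. F w \<partial>P) = (\<integral>\<^sup>+w. (\<integral>\<^sup>+w'. F (comb_seq k w w') \<partial>P) \<partial>P)"
proof -
  have [measurable]: "(\<lambda>z. F (comb_seq k (fst z) (snd z))) \<in> borel_measurable (P \<Otimes>\<^sub>M P)"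
    using measurable_compose[OF comb_seq_measurable F] by (simp add: split_beta')
  have "(\<integral>\<^sup>+w. F w \<partial>P) = (\<integral>\<^sup>+w. F w \<partial>distr (P \<Otimes>\<^sub>M P) P (\<lambda>(w, w'). comb_seq k w w'))"
    by (simp only: distr_comb_seq)
  also have "\<dots> = (\<integral>\<^sup>+z. F (comb_seq k (fst z) (snd z)) \<partial>(P \<Otimes>\<^sub>M P))"
    by (subst nn_integral_distr[OF comb_seq_measurable]) (simp_all add: split_beta')
  also have "\<dots> = (\<integral>\<^sup>+w. (\<integral>\<^sup>+w'. F (comb_seq k w w') \<partial>P) \<partial>P)"
    by (subst P.nn_integral_fst[symmetric]) simp_all
  finally show ?thesis .
qed

text \<open>\<open>busy_prob\<close> and \<open>empty_prob\<close> are the functions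
  \<open>g\<close> and \<open>u\<close> to which \<open>renewal_equation\<close> will be applied;
  this is why they are set to 0 at negative times.\<close>

definition busy_prob :: "real \<Rightarrow> real" where
  "busy_prob y = (if y < 0 then 0 else measure P {w. busy_until n w y})"

definition empty_prob :: "real \<Rightarrow> real" where
  "empty_prob t = (if t < 0 then 0 else measure P {w. jobs_present n w t = {}})"

lemma sets_P_lborel: "sets (P \<Otimes>\<^sub>M lborel) = sets (path_space \<Otimes>\<^sub>M borel)"
  by (intro sets_pair_measure_cong sets_P) simp

lemma busy_y_measurable: "Measurable.pred path_space (\<lambda>w. busy_until n w y)"
proof -
  have "(\<lambda>w. (w, y)) \<in> measurable path_space (path_space \<Otimes>\<^sub>M borel)" by measurable
  from measurable_compose[OF this pred_busy_until[of n]] show ?thesis by simp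
qed

lemma ennreal_busy_prob:
  assumes "0 \<le> y"
  shows "ennreal (busy_prob y) = (\<integral>\<^sup>+w. (if busy_until n w y then 1 else 0) \<partial>P)"
proof -
  have "ennreal (busy_prob y) = emeasure P {w. busy_until n w y}"
    using assms by (simp add: busy_prob_def P.emeasure_eq_measure)
  also have "\<dots> = (\<integral>\<^sup>+w. indicator {w. busy_until n w y} w \<partial>P)"
    by (rule emeasure_P_Collect[OF busy_y_measurable])
  also have "\<dots> = (\<integral>\<^sup>+w. (if busy_until n w y then 1 else 0) \<partial>P)"
    by (intro nn_integral_cong) (simp add: indicator_def)
  finally show ?thesis .
qed

lemma busy_prob_bounds: "0 \<le> busy_prob y" "busy_prob y \<le> 1"
  by (simp_all add: busy_prob_def)

lemma busy_prob_antimono: "0 \<le> s \<Longrightarrow> s \<le> t \<Longrightarrow> busy_prob t \<le> busy_prob s"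
  unfolding busy_prob_def using pred_P_intro[OF busy_y_measurable, of s]
  by (auto intro!: P.finite_measure_mono busy_until_mono[of s t] simp: pred_def)

lemma busy_prob_nn: "ennreal (busy_prob y) = (\<integral>\<^sup>+w. (if 0 \<le> y \<and> busy_until n w y then 1 else 0) \<partial>P)"
  by (cases "0 \<le> y") (simp_all add: ennreal_busy_prob, simp add: busy_prob_def)

lemma busy_prob_meas [measurable]: "busy_prob \<in> borel_measurable borel"
proof -
  have "(\<lambda>z. if 0 \<le> fst z \<and> busy_until n (snd z) (fst z) then 1 else 0 :: ennreal) \<in> borel_measurable (lborel \<Otimes>\<^sub>M P)"
  proof -
    have "Measurable.pred (borel \<Otimes>\<^sub>M path_space) (\<lambda>z. busy_until n (snd z) (fst z))"
      using measurable_compose[OF measurable_pair_swap' pred_busy_until] by (simp add: split_beta')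
    then have "(\<lambda>z. if 0 \<le> fst z \<and> busy_until n (snd z) (fst z) then 1 else 0 :: ennreal) \<in> borel_measurable (borel \<Otimes>\<^sub>M path_space)"
      by measurable
    moreover have sets: "sets (lborel \<Otimes>\<^sub>M P) = sets (borel \<Otimes>\<^sub>M path_space)"
      by (intro sets_pair_measure_cong sets_P) simp
    ultimately show ?thesis unfolding measurable_cong_sets[OF sets refl] by blast
  qed
  then have "(\<lambda>y. ennreal (busy_prob y)) \<in> borel_measurable lborel"
    unfolding busy_prob_nn
    using P.borel_measurable_nn_integral_fst[of "\<lambda>z. if 0 \<le> fst z \<and> busy_until n (snd z) (fst z) then 1 else 0" lborel]
    by (simp only: fst_conv snd_conv)
  then have "(\<lambda>y. enn2real (ennreal (busy_prob y))) \<in> borel_measurable lborel" by measurable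
  then show ?thesis by (simp add: busy_prob_bounds)
qed

text \<open>The mean of a nonnegative variable is the integral of its tail.\<close>

lemma busy_prob_has_integral: "has_bochner_integral lborel busy_prob (mu * served arrivals_tail (n - 1))"
proof (rule has_bochner_integral_nn_integral)
  have "(\<integral>\<^sup>+y. ennreal (busy_prob y) \<partial>lborel) = (\<integral>\<^sup>+y. (\<integral>\<^sup>+w. (if 0 \<le> y \<and> busy_until n w y then 1 else 0) \<partial>P) \<partial>lborel)"
    by (simp only: busy_prob_nn)
  also have "\<dots> = (\<integral>\<^sup>+w. (\<integral>\<^sup>+y. (if 0 \<le> y \<and> busy_until n w y then 1 else 0) \<partial>lborel) \<partial>P)"
  proof (rule PL.Fubini')
    have "(\<lambda>z. if 0 \<le> snd z \<and> busy_until n (fst z) (snd z) then 1 else 0 :: ennreal) \<in> borel_measurable (path_space \<Otimes>\<^sub>M borel)"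
      by measurable
    then show "(\<lambda>(w, y). if 0 \<le> y \<and> busy_until n w y then 1 else 0 :: ennreal) \<in> borel_measurable (P \<Otimes>\<^sub>M lborel)"
      unfolding measurable_cong_sets[OF sets_P_lborel refl] by (simp add: split_beta')
  qed
  also have "\<dots> = (\<integral>\<^sup>+w. emeasure lborel {y. 0 \<le> y \<and> busy_until n w y} \<partial>P)"
  proof (rule nn_integral_cong)
    fix w
    have "Measurable.pred borel (\<lambda>y. busy_until n w y)"
    proof -
      have "(\<lambda>y. (w, y)) \<in> measurable borel (path_space \<Otimes>\<^sub>M borel)"
        by (rule measurable_Pair1') (simp add: space_PiM)
      from measurable_compose[OF this pred_busy_until[of n]] show ?thesis by simp
    qed
    then have "Measurable.pred borel (\<lambda>y. 0 \<le> y \<and> busy_until n w y)" by measurable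
    then have "{y. 0 \<le> y \<and> busy_until n w y} \<in> sets lborel" by (simp add: pred_def)
    then have "emeasure lborel {y. 0 \<le> y \<and> busy_until n w y} = (\<integral>\<^sup>+y. indicator {y. 0 \<le> y \<and> busy_until n w y} y \<partial>lborel)"
      by simp
    then show "(\<integral>\<^sup>+y. (if 0 \<le> y \<and> busy_until n w y then 1 else 0) \<partial>lborel) = emeasure lborel {y. 0 \<le> y \<and> busy_until n w y}"
      by (simp only: indicator_def of_bool_def mem_Collect_eq)
  qed
  also have "\<dots> = ennreal (mu * served arrivals_tail (n - 1))" by (rule nn_integral_busy_period)
  finally show "(\<integral>\<^sup>+y. ennreal (busy_prob y) \<partial>lborel) = ennreal (mu * served arrivals_tail (n - 1))" .
  show "0 \<le> mu * served arrivals_tail (n - 1)"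
    using mu_nonneg served_ge_1[of arrivals_tail "n - 1", OF arrivals_tail_0_less_1 arrivals_tail_nonneg] by simp
qed (auto simp: busy_prob_bounds)

end

section \<open>The stationary probability of an empty queue\<close>

lemma pred_real_le [measurable (raw)]:
  fixes f busy_prob :: "'a \<Rightarrow> real"
  assumes "f \<in> borel_measurable M" "busy_prob \<in> borel_measurable M"
  shows "Measurable.pred M (\<lambda>w. f w \<le> busy_prob w)"
  unfolding pred_def using assms by (rule borel_measurable_le)

lemma suminf_of_unique:
  fixes f :: "nat \<Rightarrow> ennreal"
  assumes "\<And>k. f k = (if Q k then 1 else 0)" and "\<And>k k'. Q k \<Longrightarrow> Q k' \<Longrightarrow> k = k'"
  shows "(\<Sum>k. f k) = (if \<exists>k. Q k then 1 else 0)"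
proof (cases "\<exists>k. Q k")
  case True
  then obtain k0 where "Q k0" by blast
  then have "f k = (if k = k0 then 1 else 0)" for k using assms by auto
  then have "(\<Sum>k. f k) = (\<Sum>k\<in>{k0}. f k)" by (intro suminf_finite) auto
  then show ?thesis using True \<open>Q k0\<close> by (simp add: assms(1))
qed (simp add: assms(1))

lemma nn_integral_exponential_greaterThan:
  assumes l: "0 < l" and z: "0 \<le> z"
  shows "(\<integral>\<^sup>+x. ennreal (exponential_density l x) * (if z < x then 1 else 0) \<partial>lborel) = ennreal (exp (- (l * z)))"
proof -
  interpret D: prob_space "density lborel (exponential_density l)" by (rule prob_space_exponential_density[OF l])
  have "(\<integral>\<^sup>+x. ennreal (exponential_density l x) * (if z < x then 1 else 0) \<partial>lborel)
      = (\<integral>\<^sup>+x. ennreal (exponential_density l x) * indicator {z<..} x \<partial>lborel)"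
    by (intro nn_integral_cong) (simp add: indicator_def)
  also have "\<dots> = emeasure (density lborel (exponential_density l)) {z<..}"
    by (subst emeasure_density) auto
  also have "\<dots> = ennreal (D.prob (space (density lborel (exponential_density l)) - {..z}))"
    by (simp add: D.emeasure_eq_measure) (rule arg_cong[of _ _ D.prob], auto)
  also have "\<dots> = ennreal (1 - D.prob {..z})" by (subst D.prob_compl) auto
  also have "D.prob {..z} = erlang_CDF 0 l z"
    using emeasure_erlang_density[OF l, of 0 z] l by (simp add: D.emeasure_eq_measure)
  also have "1 - erlang_CDF 0 l z = exp (- (l * z))" using z by (simp add: erlang_CDF_def)
  finally show ?thesis .
qed

section \<open>Arrivals to an empty system and the renewal equation of the queue\<close>

context mg1n
begin

text \<open>Given the jobs before \<open>k\<close>, this is the density at time \<open>y\<close> of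
  job \<open>k\<close> arriving to an empty system.\<close>

definition idle_weight :: "nat \<Rightarrow> (nat \<Rightarrow> real \<times> real) \<Rightarrow> real \<Rightarrow> ennreal" where
  "idle_weight k w y = (if prev_work n w k \<le> y - prev_arrival w k
     then ennreal (exponential_density lam (y - prev_arrival w k)) else 0)"

lemma idle_weight_measurable:
  "(\<lambda>(w, y). idle_weight k w y) \<in> borel_measurable (P \<Otimes>\<^sub>M lborel)"
proof -
  have [measurable]: "(\<lambda>z. f (fst z)) \<in> borel_measurable (path_space \<Otimes>\<^sub>M borel)"
    if "f \<in> borel_measurable path_space" for f :: "_ \<Rightarrow> real"
    using measurable_compose[OF measurable_fst that] .
  show ?thesis
    unfolding measurable_cong_sets[OF sets_P_lborel refl] idle_weight_def split_beta' by measurable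
qed

lemma AE_prev_nonneg: "AE w in P. \<forall>k. 0 \<le> prev_arrival w k \<and> 0 \<le> prev_work n w k"
  using AE_good_path
proof eventually_elim
  fix w assume w: "good_path w"
  show "\<forall>k. 0 \<le> prev_arrival w k \<and> 0 \<le> prev_work n w k"
  proof
    fix k
    have "prev_arrival w 0 \<le> prev_arrival w k" using monoD[OF mono_prev_arrival[OF w], of 0 k] by simp
    moreover have "0 \<le> prev_work n w k"
      using backlog_nonneg[OF w] by (cases k) (auto simp: prev_work_def intro!: sum_list_nonneg)
    ultimately show "0 \<le> prev_arrival w k \<and> 0 \<le> prev_work n w k" by (simp add: prev_arrival_def)
  qed
qed

definition idle_at :: "nat \<Rightarrow> real \<Rightarrow> (nat \<Rightarrow> real \<times> real) \<Rightarrow> bool" where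
  "idle_at k y w \<longleftrightarrow> prev_arrival w k \<le> y \<and> y < prev_arrival w k + fst (w k) \<and> prev_work n w k \<le> y - prev_arrival w k"

lemma idle_at_measurable [measurable]: "Measurable.pred path_space (idle_at k y)"
  unfolding idle_at_def by measurable

text \<open>An exponential density is \<open>lam\<close> times its own tail: the rate at which job
  \<open>k\<close> arrives to an empty system at \<open>y\<close> is \<open>lam\<close> times the
  probability that exactly \<open>k\<close> jobs have arrived by \<open>y\<close> and their work is
  done.\<close>

lemma nn_integral_idle_weight:
  assumes y: "0 \<le> y"
  shows "(\<integral>\<^sup>+w. idle_weight k w y \<partial>P) = ennreal lam * (\<integral>\<^sup>+w. (if idle_at k y w then 1 else 0) \<partial>P)"
proof -
  have [measurable]: "(\<lambda>w. if idle_at k y w then 1 else 0 :: ennreal) \<in> borel_measurable path_space"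
    by measurable
  have "(\<integral>\<^sup>+w. (if idle_at k y w then 1 else 0) \<partial>P) = (\<integral>\<^sup>+w. (\<integral>\<^sup>+v. (if idle_at k y (w(k := v)) then 1 else 0) \<partial>X) \<partial>P)"
    by (rule nn_integral_fun_upd) (simp add: measurable_P)
  also have "\<dots> = (\<integral>\<^sup>+w. (if prev_arrival w k \<le> y \<and> prev_work n w k \<le> y - prev_arrival w k
      then ennreal (exp (- (lam * (y - prev_arrival w k)))) else 0) \<partial>P)"
  proof (rule nn_integral_cong)
    fix w
    have pa: "prev_arrival (w(k := v)) k = prev_arrival w k" for v by (rule prev_arrival_cong) simp
    have pw: "prev_work n (w(k := v)) k = prev_work n w k" for v by (rule prev_work_cong) simp
    show "(\<integral>\<^sup>+v. (if idle_at k y (w(k := v)) then 1 else 0) \<partial>X) = (if prev_arrival w k \<le> y \<and> prev_work n w k \<le> y - prev_arrival w k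
      then ennreal (exp (- (lam * (y - prev_arrival w k)))) else 0)"
    proof (cases "prev_arrival w k \<le> y \<and> prev_work n w k \<le> y - prev_arrival w k")
      case True
      then have "(\<integral>\<^sup>+v. (if idle_at k y (w(k := v)) then 1 else 0) \<partial>X)
          = (\<integral>\<^sup>+v. (if y - prev_arrival w k < fst v then 1 else 0) \<partial>X)"
        by (intro nn_integral_cong) (auto simp: idle_at_def pa pw)
      also have "\<dots> = (\<integral>\<^sup>+x. ennreal (exponential_density lam x) * (if y - prev_arrival w k < x then 1 else 0) \<partial>lborel)"
        by (subst nn_integral_X) (simp_all only: fst_conv nn_integral_const S.emeasure_space_1 mult_1_right, measurable)
      also have "\<dots> = ennreal (exp (- (lam * (y - prev_arrival w k))))"
        by (rule nn_integral_exponential_greaterThan) (use lam True in auto)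
      finally show ?thesis using True by simp
    next
      case False
      then have "(\<integral>\<^sup>+v. (if idle_at k y (w(k := v)) then 1 else 0) \<partial>X) = (\<integral>\<^sup>+v. 0 \<partial>X)"
        by (intro nn_integral_cong) (auto simp: idle_at_def pa pw)
      then show ?thesis using False by simp
    qed
  qed
  finally have eq: "(\<integral>\<^sup>+w. (if idle_at k y w then 1 else 0) \<partial>P) = (\<integral>\<^sup>+w. (if prev_arrival w k \<le> y \<and> prev_work n w k \<le> y - prev_arrival w k
      then ennreal (exp (- (lam * (y - prev_arrival w k)))) else 0) \<partial>P)" .
  have "(\<integral>\<^sup>+w. idle_weight k w y \<partial>P) = (\<integral>\<^sup>+w. ennreal lam * (if prev_arrival w k \<le> y \<and> prev_work n w k \<le> y - prev_arrival w k
      then ennreal (exp (- (lam * (y - prev_arrival w k)))) else 0) \<partial>P)"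
    using AE_prev_nonneg
  proof (intro nn_integral_cong_AE, eventually_elim)
    fix w assume "\<forall>k. 0 \<le> prev_arrival w k \<and> 0 \<le> prev_work n w k"
    then have "0 \<le> prev_work n w k" by blast
    then show "idle_weight k w y = ennreal lam * (if prev_arrival w k \<le> y \<and> prev_work n w k \<le> y - prev_arrival w k
      then ennreal (exp (- (lam * (y - prev_arrival w k)))) else 0)"
      using lam by (auto simp: idle_weight_def exponential_density_def ennreal_mult[symmetric] mult.commute[of _ lam])
        (simp_all add: algebra_simps)
  qed
  also have "\<dots> = ennreal lam * (\<integral>\<^sup>+w. (if prev_arrival w k \<le> y \<and> prev_work n w k \<le> y - prev_arrival w k
      then ennreal (exp (- (lam * (y - prev_arrival w k)))) else 0) \<partial>P)"
    by (rule nn_integral_cmult) (simp add: measurable_P)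
  finally show ?thesis unfolding eq .
qed

lemma empty_prob_nn:
  assumes y: "0 \<le> y"
  shows "ennreal (empty_prob y) = (\<Sum>k. \<integral>\<^sup>+w. (if idle_at k y w then 1 else 0) \<partial>P)"
proof -
  have [measurable]: "(\<lambda>w. if idle_at k y w then 1 else 0 :: ennreal) \<in> borel_measurable P" for k
    by (simp add: measurable_P)
  have "ennreal (empty_prob y) = emeasure P {w. jobs_present n w y = {}}"
    using y by (simp add: empty_prob_def P.emeasure_eq_measure)
  also have "\<dots> = (\<integral>\<^sup>+w. indicator {w. jobs_present n w y = {}} w \<partial>P)"
    by (rule emeasure_P_Collect[OF pred_jobs_present])
  also have "\<dots> = (\<integral>\<^sup>+w. (\<Sum>k. (if idle_at k y w then 1 else 0)) \<partial>P)"
    using AE_good_path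
  proof (intro nn_integral_cong_AE, eventually_elim)
    fix w assume w: "good_path w"
    have "k = k'" if "idle_at k y w" "idle_at k' y w" for k k'
      using that prev_arrival_unique[OF w, of k y k'] by (simp add: idle_at_def arrival_time_eq_prev)
    then have "(\<Sum>k. (if idle_at k y w then 1 else 0)) = (if \<exists>k. idle_at k y w then 1 else (0 :: ennreal))"
      by (intro suminf_of_unique[of _ "\<lambda>k. idle_at k y w"]) auto
    moreover have "jobs_present n w y = {} \<longleftrightarrow> (\<exists>k. idle_at k y w)"
      unfolding jobs_present_empty_iff_ex[OF w y] by (simp add: idle_at_def arrival_time_eq_prev)
    ultimately show "indicator {w. jobs_present n w y = {}} w = (\<Sum>k. (if idle_at k y w then 1 else (0 :: ennreal)))"
      by (simp add: indicator_def)
  qed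
  also have "\<dots> = (\<Sum>k. \<integral>\<^sup>+w. (if idle_at k y w then 1 else 0) \<partial>P)"
    by (rule nn_integral_suminf) measurable
  finally show ?thesis .
qed

lemma suminf_idle_weight: "(\<Sum>k. \<integral>\<^sup>+w. idle_weight k w y \<partial>P) = ennreal (lam * empty_prob y)"
proof (cases "0 \<le> y")
  case True
  have "(\<Sum>k. \<integral>\<^sup>+w. idle_weight k w y \<partial>P) = ennreal lam * (\<Sum>k. \<integral>\<^sup>+w. (if idle_at k y w then 1 else 0) \<partial>P)"
    unfolding nn_integral_idle_weight[OF True] by (rule ennreal_suminf_cmult)
  also have "\<dots> = ennreal (lam * empty_prob y)"
    unfolding empty_prob_nn[OF True, symmetric] using lam by (simp add: ennreal_mult empty_prob_def)
  finally show ?thesis .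
next
  case False
  have "(\<integral>\<^sup>+w. idle_weight k w y \<partial>P) = (\<integral>\<^sup>+w. 0 \<partial>P)" for k
    using AE_prev_nonneg
  proof (intro nn_integral_cong_AE, eventually_elim)
    fix w assume "\<forall>k. 0 \<le> prev_arrival w k \<and> 0 \<le> prev_work n w k"
    then have "0 \<le> prev_arrival w k" by blast
    then show "idle_weight k w y = 0"
      using False by (simp add: idle_weight_def exponential_density_def)
  qed
  then show ?thesis using False by (simp add: empty_prob_def)
qed

definition in_busy_period :: "nat \<Rightarrow> real \<Rightarrow> (nat \<Rightarrow> real \<times> real) \<Rightarrow> bool" where
  "in_busy_period k t w \<longleftrightarrow> prev_work n w k \<le> fst (w k) \<and> arrival_time w k \<le> t \<and>
     busy_until n (\<lambda>i. w (k + i)) (t - arrival_time w k)"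

lemma in_busy_period_measurable [measurable]: "Measurable.pred path_space (in_busy_period k t)"
proof -
  have "(\<lambda>w. ((\<lambda>i. w (k + i)), t - arrival_time w k)) \<in> measurable path_space (path_space \<Otimes>\<^sub>M borel)"
    by (intro measurable_Pair measurable_comb_seq_shift) measurable
  from measurable_compose[OF this pred_busy_until[of n]]
  have [measurable]: "Measurable.pred path_space (\<lambda>w. busy_until n (\<lambda>i. w (k + i)) (t - arrival_time w k))" by simp
  show ?thesis unfolding in_busy_period_def by measurable
qed

lemma nonempty_nn:
  assumes t: "0 \<le> t"
  shows "ennreal (1 - empty_prob t) = (\<Sum>k. \<integral>\<^sup>+w. (if in_busy_period k t w then 1 else 0) \<partial>P)"
proof -
  have [measurable]: "(\<lambda>w. if in_busy_period k t w then 1 else 0 :: ennreal) \<in> borel_measurable P" for k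
    by (simp add: measurable_P)
  have "{w. jobs_present n w t = {}} \<in> sets P"
    using pred_P_intro[OF pred_jobs_present[of n t]] by (simp add: pred_def)
  then have "measure P (space P - {w. jobs_present n w t = {}}) = 1 - empty_prob t"
    using t by (subst P.prob_compl) (simp_all add: empty_prob_def)
  then have "ennreal (1 - empty_prob t) = emeasure P (space P - {w. jobs_present n w t = {}})"
    by (simp only: P.emeasure_eq_measure)
  also have "space P - {w. jobs_present n w t = {}} = {w. \<not> jobs_present n w t = {}}" by auto
  also have "emeasure P \<dots> = (\<integral>\<^sup>+w. indicator {w. \<not> jobs_present n w t = {}} w \<partial>P)"
    by (rule emeasure_P_Collect) (intro pred_intros_logic pred_jobs_present)
  also have "\<dots> = (\<integral>\<^sup>+w. (\<Sum>k. (if in_busy_period k t w then 1 else 0)) \<partial>P)"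
    using AE_good_path
  proof (intro nn_integral_cong_AE, eventually_elim)
    fix w assume w: "good_path w"
    have "k = k'" if "in_busy_period k t w" "in_busy_period k' t w" for k k'
    proof (rule ccontr)
      assume "k \<noteq> k'"
      then consider "k < k'" | "k' < k" by linarith
      then show False using that idle_arrival_unique[OF w]
        by cases (auto simp: in_busy_period_def)
    qed
    then have "(\<Sum>k. (if in_busy_period k t w then 1 else 0)) = (if \<exists>k. in_busy_period k t w then 1 else (0 :: ennreal))"
      by (intro suminf_of_unique[of _ "\<lambda>k. in_busy_period k t w"]) auto
    moreover have "\<not> jobs_present n w t = {} \<longleftrightarrow> (\<exists>k. in_busy_period k t w)"
      unfolding jobs_present_nonempty_iff[OF w t] by (simp add: in_busy_period_def)
    ultimately show "indicator {w. \<not> jobs_present n w t = {}} w = (\<Sum>k. (if in_busy_period k t w then 1 else (0 :: ennreal)))"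
      by (simp add: indicator_def)
  qed
  also have "\<dots> = (\<Sum>k. \<integral>\<^sup>+w. (if in_busy_period k t w then 1 else 0) \<partial>P)"
    by (rule nn_integral_suminf) measurable
  finally show ?thesis .
qed

text \<open>At the arrival epoch of job \<open>k\<close> the future is independent of the past.\<close>

lemma nn_integral_in_busy_period:
  "(\<integral>\<^sup>+w. (if in_busy_period k t w then 1 else 0) \<partial>P)
    = (\<integral>\<^sup>+y. ennreal (busy_prob (t - y)) * (\<integral>\<^sup>+w. idle_weight k w y \<partial>P) \<partial>lborel)"
proof -
  have meas: "(\<lambda>w. if in_busy_period k t w then 1 else 0 :: ennreal) \<in> borel_measurable P"
    by (simp add: measurable_P)
  have "(\<integral>\<^sup>+w. (if in_busy_period k t w then 1 else 0) \<partial>P)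
      = (\<integral>\<^sup>+w. (\<integral>\<^sup>+w'. (if in_busy_period k t (comb_seq k w w') then 1 else 0) \<partial>P) \<partial>P)"
    by (rule nn_integral_comb_seq[OF meas])
  also have "\<dots> = (\<integral>\<^sup>+w. (\<integral>\<^sup>+y. ennreal (busy_prob (t - y)) * idle_weight k w y \<partial>lborel) \<partial>P)"
  proof (rule nn_integral_cong)
    fix w
    define a where "a = prev_arrival w k"
    define b where "b = prev_work n w k"
    have 1: "in_busy_period k t (comb_seq k w w') \<longleftrightarrow> b \<le> fst (w' 0) \<and> a + fst (w' 0) \<le> t \<and> busy_until n w' (t - a - fst (w' 0))" for w'
    proof -
      have "prev_arrival (comb_seq k w w') k = a" unfolding a_def by (rule prev_arrival_cong) (simp add: comb_seq_def)
      moreover have "prev_work n (comb_seq k w w') k = b" unfolding b_def by (rule prev_work_cong) (simp add: comb_seq_def)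
      ultimately show ?thesis
        by (simp add: in_busy_period_def arrival_time_eq_prev[of _ k] comb_seq_def diff_diff_eq)
    qed
    define Q where "Q w' x \<longleftrightarrow> b \<le> x \<and> a + x \<le> t \<and> busy_until n w' (t - a - x)" for w' x
    have Q_upd: "Q (w'(0 := (x, snd (w' 0)))) x = Q w' x" for w' x
      by (simp add: Q_def busy_until_upd_fst)
    have Q_pair: "Measurable.pred (path_space \<Otimes>\<^sub>M borel) (\<lambda>z. Q (fst z) (snd z))"
    proof -
      have "(\<lambda>z. (fst z, t - a - snd z)) \<in> measurable (path_space \<Otimes>\<^sub>M borel) (path_space \<Otimes>\<^sub>M borel)" by measurable
      from measurable_compose[OF this pred_busy_until[of n]]
      have [measurable]: "Measurable.pred (path_space \<Otimes>\<^sub>M borel) (\<lambda>z. busy_until n (fst z) (t - a - snd z))" by simp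
      show ?thesis unfolding Q_def by measurable
    qed
    have "(\<lambda>w'. (w', fst (w' 0))) \<in> measurable path_space (path_space \<Otimes>\<^sub>M borel)" by measurable
    from measurable_compose[OF this Q_pair]
    have [measurable]: "Measurable.pred path_space (\<lambda>w'. Q w' (fst (w' 0)))" by simp
    have "(\<integral>\<^sup>+w'. (if in_busy_period k t (comb_seq k w w') then 1 else 0) \<partial>P)
        = (\<integral>\<^sup>+w'. (if Q w' (fst (w' 0)) then 1 else 0) \<partial>P)"
      unfolding 1 Q_def ..
    \<comment> \<open>Separates the interarrival time of job \<open>k\<close> from the busy period
      that the job starts, which is independent of it.\<close>
    also have "\<dots> = (\<integral>\<^sup>+w'. (\<integral>\<^sup>+x. (if Q (w'(0 := (x, snd (w' 0)))) (fst ((w'(0 := (x, snd (w' 0)))) 0)) then 1 else 0) \<partial>Exp) \<partial>P)"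
      by (rule nn_integral_fst_upd) (simp add: measurable_P)
    also have "\<dots> = (\<integral>\<^sup>+w'. (\<integral>\<^sup>+x. (if Q w' x then 1 else 0) \<partial>Exp) \<partial>P)"
      by (simp only: fun_upd_same fst_conv Q_upd)
    also have "\<dots> = (\<integral>\<^sup>+x. (\<integral>\<^sup>+w'. (if Q w' x then 1 else 0) \<partial>P) \<partial>Exp)"
    proof (rule PE.Fubini'[symmetric])
      have "(\<lambda>(w', x). if Q w' x then 1 else 0 :: ennreal) \<in> borel_measurable (path_space \<Otimes>\<^sub>M borel)"
        unfolding split_beta' using Q_pair by measurable
      moreover have sets: "sets (P \<Otimes>\<^sub>M Exp) = sets (path_space \<Otimes>\<^sub>M borel)"
        by (intro sets_pair_measure_cong sets_P) simp
      ultimately show "(\<lambda>(w', x). if Q w' x then 1 else 0 :: ennreal) \<in> borel_measurable (P \<Otimes>\<^sub>M Exp)"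
        unfolding measurable_cong_sets[OF sets refl] by blast
    qed
    also have "\<dots> = (\<integral>\<^sup>+x. (if b \<le> x then ennreal (busy_prob (t - a - x)) else 0) \<partial>Exp)"
    proof (rule nn_integral_cong)
      fix x
      show "(\<integral>\<^sup>+w'. (if Q w' x then 1 else 0) \<partial>P) = (if b \<le> x then ennreal (busy_prob (t - a - x)) else 0)"
        by (cases "b \<le> x"; cases "a + x \<le> t") (simp_all add: Q_def ennreal_busy_prob, simp add: busy_prob_def)
    qed
    also have "\<dots> = (\<integral>\<^sup>+x. ennreal (exponential_density lam x) * (if b \<le> x then ennreal (busy_prob (t - a - x)) else 0) \<partial>lborel)"
      by (subst nn_integral_density) measurable
    also have "\<dots> = (\<integral>\<^sup>+y. ennreal (exponential_density lam (y - a)) * (if b \<le> y - a then ennreal (busy_prob (t - a - (y - a))) else 0) \<partial>lborel)"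
      by (subst nn_integral_real_affine[of "\<lambda>x. ennreal (exponential_density lam x) * (if b \<le> x then ennreal (busy_prob (t - a - x)) else 0)" 1 "- a"])
        (simp_all cong: if_cong)
    also have "\<dots> = (\<integral>\<^sup>+y. ennreal (busy_prob (t - y)) * idle_weight k w y \<partial>lborel)"
      by (intro nn_integral_cong) (simp add: idle_weight_def a_def[symmetric] b_def[symmetric] mult.commute)
    finally show "(\<integral>\<^sup>+w'. (if in_busy_period k t (comb_seq k w w') then 1 else 0) \<partial>P) = (\<integral>\<^sup>+y. ennreal (busy_prob (t - y)) * idle_weight k w y \<partial>lborel)" .
  qed
  also have "\<dots> = (\<integral>\<^sup>+y. (\<integral>\<^sup>+w. ennreal (busy_prob (t - y)) * idle_weight k w y \<partial>P) \<partial>lborel)"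
  proof (rule PL.Fubini'[symmetric])
    note [measurable] = idle_weight_measurable[of k]
    show "(\<lambda>(w, y). ennreal (busy_prob (t - y)) * idle_weight k w y) \<in> borel_measurable (P \<Otimes>\<^sub>M lborel)" by measurable
  qed
  also have "\<dots> = (\<integral>\<^sup>+y. ennreal (busy_prob (t - y)) * (\<integral>\<^sup>+w. idle_weight k w y \<partial>P) \<partial>lborel)"
  proof (intro nn_integral_cong nn_integral_cmult)
    fix y
    show "(\<lambda>w. idle_weight k w y) \<in> borel_measurable P"
      unfolding idle_weight_def measurable_P by measurable
  qed
  finally show ?thesis .
qed

text \<open>The definition gives one event for each time and says nothing about the dependence on
  \<open>t\<close>; measurability is read off the series for the arrival rate
  \<open>lam * empty_prob\<close>.\<close>

lemma empty_prob_measurable [measurable]: "empty_prob \<in> borel_measurable borel"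
proof -
  have "(\<lambda>y. \<integral>\<^sup>+w. idle_weight k w y \<partial>P) \<in> borel_measurable lborel" for k
  proof -
    have "(\<lambda>z. idle_weight k (snd z) (fst z)) \<in> borel_measurable (lborel \<Otimes>\<^sub>M P)"
      using measurable_compose[OF measurable_pair_swap' idle_weight_measurable[of k]] by (simp add: split_beta')
    from P.borel_measurable_nn_integral_fst[OF this] show ?thesis by simp
  qed
  then have "(\<lambda>y. \<Sum>k. \<integral>\<^sup>+w. idle_weight k w y \<partial>P) \<in> borel_measurable lborel" by measurable
  then have "(\<lambda>y. enn2real (ennreal (lam * empty_prob y)) / lam) \<in> borel_measurable borel"
    unfolding suminf_idle_weight by measurable
  moreover have "enn2real (ennreal (lam * empty_prob y)) / lam = empty_prob y" for y
    using lam by (simp add: empty_prob_def)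
  ultimately show ?thesis by simp
qed

lemma empty_prob_bounds: "0 \<le> empty_prob t" "empty_prob t \<le> 1"
  by (simp_all add: empty_prob_def)

text \<open>Sums \<open>nn_integral_in_busy_period\<close> over the job that started the running
  busy period; the arrival rates to an empty system add up to
  \<open>lam * empty_prob\<close>.\<close>

lemma renewal_equation_empty_prob:
  assumes t: "0 \<le> t"
  shows "empty_prob t + lam * (\<integral>s. empty_prob (t - s) * busy_prob s \<partial>lborel) = 1"
proof -
  note [measurable] = empty_prob_measurable
  have iw: "(\<lambda>y. \<integral>\<^sup>+w. idle_weight k w y \<partial>P) \<in> borel_measurable lborel" for k
  proof -
    have "(\<lambda>z. idle_weight k (snd z) (fst z)) \<in> borel_measurable (lborel \<Otimes>\<^sub>M P)"
      using measurable_compose[OF measurable_pair_swap' idle_weight_measurable[of k]] by (simp add: split_beta')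
    from P.borel_measurable_nn_integral_fst[OF this] show ?thesis by simp
  qed
  have "ennreal (1 - empty_prob t) = (\<Sum>k. \<integral>\<^sup>+y. ennreal (busy_prob (t - y)) * (\<integral>\<^sup>+w. idle_weight k w y \<partial>P) \<partial>lborel)"
    unfolding nonempty_nn[OF t] nn_integral_in_busy_period ..
  also have "\<dots> = (\<integral>\<^sup>+y. (\<Sum>k. ennreal (busy_prob (t - y)) * (\<integral>\<^sup>+w. idle_weight k w y \<partial>P)) \<partial>lborel)"
  proof (rule nn_integral_suminf[symmetric])
    show "(\<lambda>y. ennreal (busy_prob (t - y)) * (\<integral>\<^sup>+w. idle_weight k w y \<partial>P)) \<in> borel_measurable lborel" for k
      using iw[of k] by measurable
  qed
  also have "\<dots> = (\<integral>\<^sup>+y. ennreal (lam * (busy_prob (t - y) * empty_prob y)) \<partial>lborel)"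
    unfolding ennreal_suminf_cmult suminf_idle_weight
    using lam by (intro nn_integral_cong) (simp add: ennreal_mult[symmetric] busy_prob_bounds empty_prob_bounds mult.left_commute)
  also have "\<dots> = (\<integral>\<^sup>+s. ennreal (lam * (empty_prob (t - s) * busy_prob s)) \<partial>lborel)"
    by (subst nn_integral_real_affine[of _ "-1" t]) (simp_all add: mult.commute)
  also have "\<dots> = ennreal (\<integral>s. lam * (empty_prob (t - s) * busy_prob s) \<partial>lborel)"
  proof (rule nn_integral_eq_integral)
    have "integrable lborel (\<lambda>s. empty_prob (t - s) * busy_prob s)"
    proof (rule Bochner_Integration.integrable_bound)
      show "integrable lborel busy_prob" using busy_prob_has_integral by (simp add: has_bochner_integral_iff)
      show "AE s in lborel. norm (empty_prob (t - s) * busy_prob s) \<le> norm (busy_prob s)"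
        using empty_prob_bounds by (auto simp: abs_mult intro!: mult_left_le_one_le)
    qed measurable
    then show "integrable lborel (\<lambda>s. lam * (empty_prob (t - s) * busy_prob s))" by simp
    show "AE s in lborel. 0 \<le> lam * (empty_prob (t - s) * busy_prob s)" using lam busy_prob_bounds empty_prob_bounds by simp
  qed
  finally have "1 - empty_prob t = (\<integral>s. lam * (empty_prob (t - s) * busy_prob s) \<partial>lborel)"
  proof (rule ennreal_inj[THEN iffD1, rotated 2])
    show "0 \<le> 1 - empty_prob t" using empty_prob_bounds[of t] by simp
    show "0 \<le> (\<integral>s. lam * (empty_prob (t - s) * busy_prob s) \<partial>lborel)"
      using lam busy_prob_bounds empty_prob_bounds by (intro Bochner_Integration.integral_nonneg) simp
  qed
  then show ?thesis by simp
qed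

theorem MG1n_empty_prob_eq:
  "MG1n_empty_prob lam S n = 1 / (1 + lam * mu * served arrivals_tail (n - 1))"
proof -
  interpret R: renewal_equation lam empty_prob busy_prob
  proof
    show "integrable lborel busy_prob" using busy_prob_has_integral by (simp add: has_bochner_integral_iff)
    show "busy_prob t = 0" if "t < 0" for t using that by (simp add: busy_prob_def)
    show "empty_prob t = 0" if "t < 0" for t using that by (simp add: empty_prob_def)
  qed (use lam busy_prob_bounds empty_prob_bounds busy_prob_antimono renewal_equation_empty_prob in auto)
  have "(\<integral>x. busy_prob x \<partial>lborel) = mu * served arrivals_tail (n - 1)"
    using busy_prob_has_integral by (simp add: has_bochner_integral_iff)
  then have "(empty_prob \<longlongrightarrow> 1 / (1 + lam * mu * served arrivals_tail (n - 1))) at_top"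
    using R.tendsto_u by (simp add: mult.assoc)
  then have "((\<lambda>t. measure P {w \<in> space P. jobs_present n w t = {}}) \<longlongrightarrow> 1 / (1 + lam * mu * served arrivals_tail (n - 1))) at_top"
    by (rule Lim_transform_eventually)
      (rule eventually_mono[OF eventually_ge_at_top[of "0 :: real"]], simp add: empty_prob_def)
  then show ?thesis
    unfolding MG1n_empty_prob_def by (intro tendsto_Lim) (simp_all add: trivial_limit_at_top_linorder)
qed

end

section \<open>Absorbing Markov chains\<close>

primrec mpow :: "nat \<Rightarrow> (nat \<Rightarrow> nat \<Rightarrow> real) \<Rightarrow> nat \<Rightarrow> nat \<Rightarrow> nat \<Rightarrow> real" where
  "mpow k A 0 i j = (if i = j then 1 else 0)"
| "mpow k A (Suc m) i j = (\<Sum>l\<le>k. mpow k A m i l * A l j)"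

lemma mpow_Suc_left:
  "i \<le> k \<Longrightarrow> j \<le> k \<Longrightarrow> mpow k A (Suc m) i j = (\<Sum>l\<le>k. A i l * mpow k A m l j)"
proof (induction m arbitrary: j)
  case 0
  have "mpow k A (Suc 0) i j = (\<Sum>l\<le>k. if l = i then A l j else 0)"
    unfolding mpow.simps by (intro sum.cong refl) simp
  also have "\<dots> = A i j" using 0 by (simp add: sum.delta)
  also have "\<dots> = (\<Sum>l\<le>k. if l = j then A i l else 0)" using 0 by (simp add: sum.delta)
  also have "\<dots> = (\<Sum>l\<le>k. A i l * mpow k A 0 l j)" by (intro sum.cong) auto
  finally show ?case .
next
  case (Suc m)
  have "mpow k A (Suc (Suc m)) i j = (\<Sum>l\<le>k. mpow k A (Suc m) i l * A l j)" by (rule mpow.simps)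
  also have "\<dots> = (\<Sum>l\<le>k. (\<Sum>l'\<le>k. A i l' * mpow k A m l' l) * A l j)"
    using Suc by (intro sum.cong refl) (simp del: mpow.simps)
  also have "\<dots> = (\<Sum>l'\<le>k. \<Sum>l\<le>k. A i l' * mpow k A m l' l * A l j)"
    unfolding sum_distrib_right by (rule sum.swap)
  also have "\<dots> = (\<Sum>l'\<le>k. A i l' * mpow k A (Suc m) l' j)"
    by (simp add: sum_distrib_left mult.assoc)
  finally show ?case .
qed

lemma mpow_bound:
  assumes A: "\<And>i j. i \<le> k \<Longrightarrow> j \<le> k \<Longrightarrow> \<bar>A i j\<bar> \<le> M" and "0 \<le> M"
  shows "i \<le> k \<Longrightarrow> j \<le> k \<Longrightarrow> \<bar>mpow k A m i j\<bar> \<le> (real (k + 1) * M) ^ m"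
proof (induction m arbitrary: j)
  case 0
  then show ?case by simp
next
  case (Suc m)
  have "\<bar>mpow k A (Suc m) i j\<bar> \<le> (\<Sum>l\<le>k. \<bar>mpow k A m i l * A l j\<bar>)"
    unfolding mpow.simps by (rule sum_abs)
  also have "\<dots> \<le> (\<Sum>l\<le>k. (real (k + 1) * M) ^ m * M)"
    unfolding abs_mult using Suc A assms(2) by (intro sum_mono mult_mono) auto
  also have "\<dots> = (real (k + 1) * M) ^ Suc m" by simp
  finally show ?case .
qed

definition mexp :: "nat \<Rightarrow> (nat \<Rightarrow> nat \<Rightarrow> real) \<Rightarrow> real \<Rightarrow> nat \<Rightarrow> nat \<Rightarrow> real" where
  "mexp k A t i j = (\<Sum>m. t ^ m / fact m * mpow k A m i j)"

lemma mexp_summable: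
  assumes "i \<le> k" "j \<le> k"
  shows "summable (\<lambda>m. \<bar>t ^ m / fact m * mpow k A m i j\<bar>)"
proof -
  define M where "M = (\<Sum>i\<le>k. \<Sum>j\<le>k. \<bar>A i j\<bar>)"
  have "0 \<le> M" unfolding M_def by (intro sum_nonneg) auto
  have "\<bar>A i j\<bar> \<le> M" if "i \<le> k" "j \<le> k" for i j
  proof -
    have "\<bar>A i j\<bar> \<le> (\<Sum>j\<le>k. \<bar>A i j\<bar>)" using that by (intro member_le_sum) auto
    also have "\<dots> \<le> M" unfolding M_def using that by (intro member_le_sum sum_nonneg) auto
    finally show ?thesis .
  qed
  define B where "B = real (k + 1) * M"
  note bound = mpow_bound[OF \<open>\<And>i j. i \<le> k \<Longrightarrow> j \<le> k \<Longrightarrow> \<bar>A i j\<bar> \<le> M\<close> \<open>0 \<le> M\<close> assms, folded B_def]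
  show ?thesis
  proof (rule summable_comparison_test')
    show "summable (\<lambda>m. (\<bar>t\<bar> * B) ^ m /\<^sub>R fact m)" by (rule summable_exp_generic)
    fix m
    have "\<bar>t ^ m / fact m * mpow k A m i j\<bar> \<le> \<bar>t\<bar> ^ m / fact m * B ^ m"
      unfolding abs_mult using bound by (intro mult_mono) (auto simp: power_abs)
    then show "norm \<bar>t ^ m / fact m * mpow k A m i j\<bar> \<le> (\<bar>t\<bar> * B) ^ m /\<^sub>R fact m"
      by (simp add: power_mult_distrib divide_inverse mult_ac)
  qed
qed

text \<open>Kolmogorov's backward equation: the power of the generator is split on the left, so that
  the derivative acts on the initial state.\<close>

lemma DERIV_mexp:
  assumes "i \<le> k" "j \<le> k"
  shows "((\<lambda>t. mexp k A t i j) has_real_derivative (\<Sum>l\<le>k. A i l * mexp k A t l j)) (at t)"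
proof -
  define c where "c m = mpow k A m i j / fact m" for m
  have c: "(\<Sum>m. c m * t ^ m) = mexp k A t i j" for t
    by (simp add: mexp_def c_def mult.commute)
  have "summable (\<lambda>m. c m * y ^ m)" for y
    using mexp_summable[OF assms, of y A, THEN summable_rabs_cancel] by (simp add: c_def mult.commute)
  then have "((\<lambda>t. \<Sum>m. c m * t ^ m) has_real_derivative (\<Sum>m. diffs c m * t ^ m)) (at t)"
    by (rule termdiffs_strong_converges_everywhere)
  moreover have "(\<Sum>m. diffs c m * t ^ m) = (\<Sum>l\<le>k. A i l * mexp k A t l j)"
  proof -
    have "diffs c m * t ^ m = (\<Sum>l\<le>k. A i l * (t ^ m / fact m * mpow k A m l j))" for m
    proof -
      have "diffs c m = mpow k A (Suc m) i j / fact m"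
        by (simp add: diffs_def c_def field_simps del: of_nat_Suc mpow.simps)
      then have "diffs c m * t ^ m = (\<Sum>l\<le>k. A i l * mpow k A m l j / fact m * t ^ m)"
        unfolding mpow_Suc_left[OF assms] by (simp only: sum_divide_distrib sum_distrib_right)
      also have "\<dots> = (\<Sum>l\<le>k. A i l * (t ^ m / fact m * mpow k A m l j))"
        by (intro sum.cong refl) simp
      finally show ?thesis .
    qed
    moreover have "(\<Sum>m. \<Sum>l\<le>k. A i l * (t ^ m / fact m * mpow k A m l j)) = (\<Sum>l\<le>k. \<Sum>m. A i l * (t ^ m / fact m * mpow k A m l j))"
      using assms by (intro suminf_sum summable_mult mexp_summable[THEN summable_rabs_cancel]) auto
    moreover have "(\<Sum>m. A i l * (t ^ m / fact m * mpow k A m l j)) = A i l * mexp k A t l j" if "l \<le> k" for l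
      unfolding mexp_def using assms that by (intro suminf_mult mexp_summable[THEN summable_rabs_cancel]) auto
    ultimately show ?thesis by simp
  qed
  ultimately show ?thesis unfolding c by simp
qed

lemma mexp_0: "i \<le> k \<Longrightarrow> j \<le> k \<Longrightarrow> mexp k A 0 i j = (if i = j then 1 else 0)"
proof -
  have "mexp k A 0 i j = (\<Sum>m\<in>{0}. 0 ^ m / fact m * mpow k A m i j)"
    unfolding mexp_def by (rule suminf_finite) (auto simp: power_0_left)
  then show ?thesis by simp
qed

text \<open>The uniformized chain, which jumps with the matrix \<open>I + A / c\<close> at the
  events of a Poisson process of rate \<open>c\<close>.\<close>

definition unif :: "real \<Rightarrow> (nat \<Rightarrow> nat \<Rightarrow> real) \<Rightarrow> nat \<Rightarrow> nat \<Rightarrow> real" where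
  "unif c A i j = (if i = j then 1 else 0) + A i j / c"

text \<open>Binomial expansion of \<open>(c * I + A) ^ m\<close>.\<close>

lemma mpow_unif:
  assumes c: "0 < c" and i: "i \<le> k"
  shows "j \<le> k \<Longrightarrow> c ^ m * mpow k (unif c A) m i j = (\<Sum>n\<le>m. real (m choose n) * c ^ (m - n) * mpow k A n i j)"
proof (induction m arbitrary: j)
  case 0
  then show ?case by simp
next
  case (Suc m)
  define x where "x n = mpow k A n i j" for n
  have "c ^ Suc m * mpow k (unif c A) (Suc m) i j
      = (\<Sum>l\<le>k. (c ^ m * mpow k (unif c A) m i l) * (c * unif c A l j))"
    by (simp add: sum_distrib_left mult_ac)
  also have "\<dots> = (\<Sum>l\<le>k. (c ^ m * mpow k (unif c A) m i l) * A l j) + (\<Sum>l\<le>k. if l = j then (c ^ m * mpow k (unif c A) m i l) * c else 0)"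
    unfolding sum.distrib[symmetric] using c by (intro sum.cong refl) (simp add: unif_def field_simps)
  also have "(\<Sum>l\<le>k. if l = j then (c ^ m * mpow k (unif c A) m i l) * c else 0) = c * (\<Sum>n\<le>m. real (m choose n) * c ^ (m - n) * x n)"
    using Suc by (simp add: sum.delta x_def)
  also have "(\<Sum>l\<le>k. (c ^ m * mpow k (unif c A) m i l) * A l j) = (\<Sum>n\<le>m. real (m choose n) * c ^ (m - n) * x (Suc n))"
  proof -
    have "(\<Sum>l\<le>k. (c ^ m * mpow k (unif c A) m i l) * A l j) = (\<Sum>l\<le>k. \<Sum>n\<le>m. real (m choose n) * c ^ (m - n) * mpow k A n i l * A l j)"
      using Suc.IH by (intro sum.cong refl) (simp add: sum_distrib_right)
    also have "\<dots> = (\<Sum>n\<le>m. \<Sum>l\<le>k. real (m choose n) * c ^ (m - n) * mpow k A n i l * A l j)" by (rule sum.swap)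
    finally show ?thesis by (simp add: x_def sum_distrib_left mult.assoc)
  qed
  also have "c * (\<Sum>n\<le>m. real (m choose n) * c ^ (m - n) * x n) = c ^ Suc m * x 0 + (\<Sum>n\<le>m. real (m choose Suc n) * c ^ (m - n) * x (Suc n))"
  proof -
    have "c * (\<Sum>n\<le>m. real (m choose n) * c ^ (m - n) * x n) = (\<Sum>n\<le>m. real (m choose n) * c ^ (Suc m - n) * x n)"
      unfolding sum_distrib_left by (intro sum.cong refl) (simp add: Suc_diff_le)
    also have "\<dots> = (\<Sum>n\<le>Suc m. real (m choose n) * c ^ (Suc m - n) * x n)" by simp
    also have "\<dots> = c ^ Suc m * x 0 + (\<Sum>n\<le>m. real (m choose Suc n) * c ^ (m - n) * x (Suc n))"
      by (subst sum.atMost_Suc_shift) simp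
    finally show ?thesis .
  qed
  also have "(\<Sum>n\<le>m. real (m choose n) * c ^ (m - n) * x (Suc n)) + (c ^ Suc m * x 0 + (\<Sum>n\<le>m. real (m choose Suc n) * c ^ (m - n) * x (Suc n)))
      = c ^ Suc m * x 0 + (\<Sum>n\<le>m. real (Suc m choose Suc n) * c ^ (m - n) * x (Suc n))"
    by (simp add: sum.distrib distrib_right)
  also have "\<dots> = (\<Sum>n\<le>Suc m. real (Suc m choose n) * c ^ (Suc m - n) * x n)"
    by (subst sum.atMost_Suc_shift) simp
  finally show ?case unfolding x_def .
qed

text \<open>The series of \<open>exp (t * (c * I + A))\<close> is the Cauchy product of the series
  of \<open>exp (t * A)\<close> and \<open>exp (c * t)\<close>.\<close>

lemma mexp_unif:
  assumes c: "0 < c" and ij: "i \<le> k" "j \<le> k"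
  shows "(\<lambda>n. exp (- (c * t)) * ((c * t) ^ n / fact n * mpow k (unif c A) n i j)) sums mexp k A t i j"
proof -
  have "(\<lambda>m. \<Sum>n\<le>m. (t ^ n / fact n * mpow k A n i j) * ((c * t) ^ (m - n) /\<^sub>R fact (m - n))) sums
      ((\<Sum>n. t ^ n / fact n * mpow k A n i j) * (\<Sum>n. (c * t) ^ n /\<^sub>R fact n))"
    by (rule Cauchy_product_sums) (use mexp_summable[OF ij, of t A] summable_norm_exp[of "c * t"] in simp_all)
  also have "(\<Sum>n. t ^ n / fact n * mpow k A n i j) * (\<Sum>n. (c * t) ^ n /\<^sub>R fact n) = mexp k A t i j * exp (c * t)"
    by (simp only: mexp_def exp_def)
  also have "(\<lambda>m. \<Sum>n\<le>m. (t ^ n / fact n * mpow k A n i j) * ((c * t) ^ (m - n) /\<^sub>R fact (m - n)))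
      = (\<lambda>m. (c * t) ^ m / fact m * mpow k (unif c A) m i j)"
  proof
    fix m
    have "(c * t) ^ m / fact m * mpow k (unif c A) m i j = t ^ m / fact m * (c ^ m * mpow k (unif c A) m i j)"
      by (simp add: power_mult_distrib)
    also have "\<dots> = (\<Sum>n\<le>m. t ^ m / fact m * (real (m choose n) * c ^ (m - n) * mpow k A n i j))"
      unfolding mpow_unif[OF c ij] sum_distrib_left ..
    also have "\<dots> = (\<Sum>n\<le>m. (t ^ n / fact n * mpow k A n i j) * ((c * t) ^ (m - n) /\<^sub>R fact (m - n)))"
    proof (intro sum.cong refl)
      fix n assume "n \<in> {..m}"
      then have n: "n \<le> m" by simp
      have "t ^ m = t ^ n * t ^ (m - n)" using n by (simp add: power_add[symmetric])
      then show "t ^ m / fact m * (real (m choose n) * c ^ (m - n) * mpow k A n i j) = (t ^ n / fact n * mpow k A n i j) * ((c * t) ^ (m - n) /\<^sub>R fact (m - n))"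
        using n by (simp add: binomial_fact power_mult_distrib field_simps)
    qed
    finally show "(\<Sum>n\<le>m. (t ^ n / fact n * mpow k A n i j) * ((c * t) ^ (m - n) /\<^sub>R fact (m - n)))
      = (c * t) ^ m / fact m * mpow k (unif c A) m i j" by simp
  qed
  finally have "(\<lambda>m. exp (- (c * t)) * ((c * t) ^ m / fact m * mpow k (unif c A) m i j)) sums (exp (- (c * t)) * (mexp k A t i j * exp (c * t)))"
    by (rule sums_mult)
  also have "exp (- (c * t)) * (mexp k A t i j * exp (c * t)) = mexp k A t i j"
    by (simp add: exp_minus field_simps)
  finally show ?thesis .
qed

lemma index_pow_mat:
  fixes Q :: "real mat"
  assumes Q: "Q \<in> carrier_mat (k + 1) (k + 1)"
  shows "i \<le> k \<Longrightarrow> j \<le> k \<Longrightarrow> (Q ^\<^sub>m m) $$ (i, j) = mpow k (\<lambda>i j. Q $$ (i, j)) m i j"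
proof (induction m arbitrary: i j)
  case 0
  then show ?case using Q by simp
next
  case (Suc m)
  have dim: "Q ^\<^sub>m m \<in> carrier_mat (k + 1) (k + 1)" using Q by (rule pow_carrier_mat)
  have "(Q ^\<^sub>m Suc m) $$ (i, j) = (\<Sum>l = 0..<k + 1. (Q ^\<^sub>m m) $$ (i, l) * Q $$ (l, j))"
    using Suc.prems Q dim by (simp add: scalar_prod_def)
  also have "\<dots> = (\<Sum>l\<le>k. (Q ^\<^sub>m m) $$ (i, l) * Q $$ (l, j))"
    by (intro sum.cong) auto
  also have "\<dots> = mpow k (\<lambda>i j. Q $$ (i, j)) (Suc m) i j"
    using Suc by simp
  finally show ?case .
qed

lemma nn_integral_erlang_density_eq_1:
  "0 < c \<Longrightarrow> (\<integral>\<^sup>+t. ennreal (erlang_density n c t) \<partial>lborel) = 1"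
  using prob_space.emeasure_space_1[OF prob_space_erlang_density[of c n]]
  by (simp add: emeasure_density)

lemma capped_rate_tendsto_0:
  assumes "0 < r"
  shows "(capped_rate r m \<longlongrightarrow> 0) at_top"
proof -
  have top: "filterlim (\<lambda>x. r * x) at_top at_top"
    by (rule filterlim_tendsto_pos_mult_at_top[OF tendsto_const assms filterlim_ident])
  have "((\<lambda>x. r * (\<Sum>a<m. ((r * x) ^ a / exp (r * x)) * (1 / fact a))) \<longlongrightarrow> r * (\<Sum>a<m. 0 * (1 / fact a))) at_top"
    by (intro tendsto_intros filterlim_compose[OF tendsto_power_div_exp_0 top])
  moreover have "capped_rate r m = (\<lambda>x. r * (\<Sum>a<m. ((r * x) ^ a / exp (r * x)) * (1 / fact a)))"
    by (rule ext) (simp add: capped_rate_def sum_distrib_left exp_minus divide_inverse mult_ac)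
  ultimately show ?thesis by (simp only:) simp
qed

lemma integral_FTC_atLeast_0:
  fixes F f :: "real \<Rightarrow> real"
  assumes F: "\<And>x. (F has_real_derivative f x) (at x)" and f: "\<And>x. isCont f x"
    and int: "integrable lborel (\<lambda>x. indicator {0..} x * f x)" and lim: "(F \<longlongrightarrow> 0) at_top"
  shows "(\<integral>x. indicator {0..} x * f x \<partial>lborel) = - F 0"
proof -
  have "((\<lambda>T. \<integral>x. indicator {..T} x *\<^sub>R (indicator {0..} x * f x) \<partial>lborel) \<longlongrightarrow> (\<integral>x. indicator {0..} x * f x \<partial>lborel)) at_top"
    by (rule tendsto_integral_at_top[OF _ int]) simp
  moreover have "((\<lambda>T. F T - F 0) \<longlongrightarrow> 0 - F 0) at_top"
    by (intro tendsto_intros lim)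
  moreover have "\<forall>\<^sub>F T in at_top. F T - F 0 = (\<integral>x. indicator {..T} x *\<^sub>R (indicator {0..} x * f x) \<partial>lborel)"
    using eventually_ge_at_top[of 0]
  proof eventually_elim
    fix T :: real assume "0 \<le> T"
    then have "has_bochner_integral lborel (\<lambda>x. f x * indicator {0..T} x) (F T - F 0)"
      using F f by (intro has_bochner_integral_FTC_Icc_real) auto
    moreover have "(\<lambda>x. f x * indicator {0..T} x) = (\<lambda>x. indicator {..T} x *\<^sub>R (indicator {0..} x * f x))"
      by (auto simp: indicator_def)
    ultimately show "F T - F 0 = (\<integral>x. indicator {..T} x *\<^sub>R (indicator {0..} x * f x) \<partial>lborel)"
      by (simp add: has_bochner_integral_iff)
  qed
  ultimately have "((\<lambda>T. \<integral>x. indicator {..T} x *\<^sub>R (indicator {0..} x * f x) \<partial>lborel) \<longlongrightarrow> 0 - F 0) at_top"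
    by (blast intro: Lim_transform_eventually)
  with \<open>((\<lambda>T. \<integral>x. indicator {..T} x *\<^sub>R (indicator {0..} x * f x) \<partial>lborel) \<longlongrightarrow> (\<integral>x. indicator {0..} x * f x \<partial>lborel)) at_top\<close>
  show ?thesis using tendsto_unique[OF trivial_limit_at_top_linorder] by fastforce
qed

locale absorbing_chain =
  fixes k :: nat and A :: "nat \<Rightarrow> nat \<Rightarrow> real"
  assumes offdiag: "i \<le> k \<Longrightarrow> j \<le> k \<Longrightarrow> i \<noteq> j \<Longrightarrow> 0 \<le> A i j"
    and row_sum: "i \<le> k \<Longrightarrow> (\<Sum>j\<le>k. A i j) = 0"
    and absorbing: "j \<le> k \<Longrightarrow> A k j = 0"
    and transient: "i < k \<Longrightarrow> set_integrable lborel {0..} (\<lambda>t. mexp k A t i i)"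
begin

text \<open>A rate above all exit rates, so that \<open>R\<close> has nonnegative entries; the
  summand 1 keeps it positive.\<close>

definition c :: real where "c = 1 + (\<Sum>i\<le>k. \<bar>A i i\<bar>)"
definition R :: "nat \<Rightarrow> nat \<Rightarrow> real" where "R = unif c A"

lemma c_pos: "0 < c"
  unfolding c_def by (intro add_pos_nonneg sum_nonneg) auto

lemma R_nonneg: "i \<le> k \<Longrightarrow> j \<le> k \<Longrightarrow> 0 \<le> R i j"
proof (cases "i = j")
  case True
  assume "i \<le> k" "j \<le> k"
  then have "\<bar>A i i\<bar> \<le> (\<Sum>i\<le>k. \<bar>A i i\<bar>)" by (intro member_le_sum) auto
  then have "- A i i \<le> c" by (simp add: c_def)
  then show ?thesis using True c_pos by (simp add: R_def unif_def field_simps)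
next
  case False
  assume "i \<le> k" "j \<le> k"
  then show ?thesis using False offdiag[of i j] c_pos by (simp add: R_def unif_def)
qed

lemma R_row_sum: "i \<le> k \<Longrightarrow> (\<Sum>j\<le>k. R i j) = 1"
  by (simp add: R_def unif_def sum.distrib row_sum sum_divide_distrib[symmetric])

lemma mpow_R_nonneg: "i \<le> k \<Longrightarrow> j \<le> k \<Longrightarrow> 0 \<le> mpow k R n i j"
  by (induction n arbitrary: j) (auto intro!: sum_nonneg mult_nonneg_nonneg R_nonneg)

lemma mpow_R_row_sum: "i \<le> k \<Longrightarrow> (\<Sum>j\<le>k. mpow k R n i j) = 1"
proof (induction n)
  case (Suc n)
  have "(\<Sum>j\<le>k. mpow k R (Suc n) i j) = (\<Sum>l\<le>k. mpow k R n i l * (\<Sum>j\<le>k. R l j))"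
    unfolding mpow.simps sum_distrib_left by (rule sum.swap)
  also have "\<dots> = (\<Sum>l\<le>k. mpow k R n i l)" by (intro sum.cong refl) (simp add: R_row_sum)
  finally show ?case using Suc by simp
qed simp

text \<open>\<open>erlang_density n c t / c\<close> is the probability of \<open>n\<close> Poisson
  events up to time \<open>t\<close>. As densities integrate to 1, integrals over time become sums
  over visits.\<close>

lemma mexp_sums:
  assumes "0 \<le> t" "i \<le> k" "j \<le> k"
  shows "(\<lambda>n. mpow k R n i j / c * erlang_density n c t) sums mexp k A t i j"
proof -
  have "exp (- (c * t)) * ((c * t) ^ n / fact n * mpow k R n i j) = mpow k R n i j / c * erlang_density n c t" for n
    using assms c_pos by (simp add: erlang_density_def power_mult_distrib)
  then show ?thesis using mexp_unif[OF c_pos assms(2,3), of t A] by (simp add: R_def)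
qed

lemma mexp_nonneg: "0 \<le> t \<Longrightarrow> i \<le> k \<Longrightarrow> j \<le> k \<Longrightarrow> 0 \<le> mexp k A t i j"
  by (rule sums_le[OF _ sums_zero mexp_sums]) (use c_pos mpow_R_nonneg in auto)

lemma mexp_row_sum:
  assumes "0 \<le> t" "i \<le> k"
  shows "(\<Sum>j\<le>k. mexp k A t i j) = 1"
proof -
  have "(\<lambda>n. \<Sum>j\<le>k. mpow k R n i j / c * erlang_density n c t) sums (\<Sum>j\<le>k. mexp k A t i j)"
    by (rule sums_sum, rule mexp_sums) (use assms in auto)
  also have "(\<lambda>n. \<Sum>j\<le>k. mpow k R n i j / c * erlang_density n c t) = (\<lambda>n. exp (- (c * t)) * ((c * t) ^ n /\<^sub>R fact n))"
  proof
    fix n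
    have "(\<Sum>j\<le>k. mpow k R n i j / c * erlang_density n c t) = 1 / c * erlang_density n c t"
      unfolding sum_distrib_right[symmetric] sum_divide_distrib[symmetric] mpow_R_row_sum[OF assms(2)] ..
    then show "(\<Sum>j\<le>k. mpow k R n i j / c * erlang_density n c t) = exp (- (c * t)) * ((c * t) ^ n /\<^sub>R fact n)"
      using assms c_pos by (simp add: erlang_density_def power_mult_distrib divide_inverse)
  qed
  finally have "(\<lambda>n. exp (- (c * t)) * ((c * t) ^ n /\<^sub>R fact n)) sums (\<Sum>j\<le>k. mexp k A t i j)" .
  moreover have "(\<lambda>n. exp (- (c * t)) * ((c * t) ^ n /\<^sub>R fact n)) sums (exp (- (c * t)) * exp (c * t))"
    by (intro sums_mult exp_converges)
  ultimately have "(\<Sum>j\<le>k. mexp k A t i j) = exp (- (c * t)) * exp (c * t)" by (rule sums_unique2)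
  then show ?thesis by (simp add: mult_exp_exp)
qed

lemma continuous_mexp: "i \<le> k \<Longrightarrow> j \<le> k \<Longrightarrow> isCont (\<lambda>t. mexp k A t i j) t"
  using DERIV_mexp DERIV_isCont by blast

lemma mexp_measurable: "i \<le> k \<Longrightarrow> j \<le> k \<Longrightarrow> (\<lambda>t. mexp k A t i j) \<in> borel_measurable borel"
  by (intro borel_measurable_continuous_onI continuous_at_imp_continuous_on ballI continuous_mexp)

text \<open>The mean time spent in \<open>j\<close> is the mean number of visits divided by the jump
  rate.\<close>

lemma nn_integral_mexp:
  assumes "i \<le> k" "j \<le> k"
  shows "(\<integral>\<^sup>+t. ennreal (indicator {0..} t * mexp k A t i j) \<partial>lborel) = (\<Sum>n. ennreal (mpow k R n i j / c))"
proof -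
  have nn: "0 \<le> mpow k R n i j / c * erlang_density n c t" for n t
    using c_pos mpow_R_nonneg[OF assms] by simp
  have "ennreal (indicator {0..} t * mexp k A t i j) = (\<Sum>n. ennreal (mpow k R n i j / c * erlang_density n c t))" for t
  proof (cases "0 \<le> t")
    case True
    then show ?thesis using suminf_ennreal_eq[OF nn mexp_sums[OF True assms]] by simp
  qed (simp add: erlang_density_def)
  then have "(\<integral>\<^sup>+t. ennreal (indicator {0..} t * mexp k A t i j) \<partial>lborel) = (\<integral>\<^sup>+t. (\<Sum>n. ennreal (mpow k R n i j / c * erlang_density n c t)) \<partial>lborel)"
    by simp
  also have "\<dots> = (\<Sum>n. \<integral>\<^sup>+t. ennreal (mpow k R n i j / c * erlang_density n c t) \<partial>lborel)"
    by (rule nn_integral_suminf) simp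
  also have "\<dots> = (\<Sum>n. ennreal (mpow k R n i j / c))"
  proof (rule suminf_cong)
    fix n
    have "(\<integral>\<^sup>+t. ennreal (mpow k R n i j / c * erlang_density n c t) \<partial>lborel) = (\<integral>\<^sup>+t. ennreal (mpow k R n i j / c) * ennreal (erlang_density n c t) \<partial>lborel)"
      using c_pos mpow_R_nonneg[OF assms] by (intro nn_integral_cong ennreal_mult) auto
    also have "\<dots> = ennreal (mpow k R n i j / c)"
      by (subst nn_integral_cmult) (simp_all add: nn_integral_erlang_density_eq_1[OF c_pos])
    finally show "(\<integral>\<^sup>+t. ennreal (mpow k R n i j / c * erlang_density n c t) \<partial>lborel) = ennreal (mpow k R n i j / c)" .
  qed
  finally show ?thesis .
qed

lemma summable_diag:
  assumes "j < k"
  shows "summable (\<lambda>n. mpow k R n j j)"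
proof -
  have "integrable lborel (\<lambda>t. indicator {0..} t * mexp k A t j j)"
    using transient[OF assms] by (simp add: set_integrable_def)
  then have "(\<integral>\<^sup>+t. ennreal (norm (indicator {0..} t * mexp k A t j j)) \<partial>lborel) < \<infinity>"
    unfolding integrable_iff_bounded by blast
  moreover have "norm (indicator {0..} t * mexp k A t j j) = indicator {0..} t * mexp k A t j j" for t
    using mexp_nonneg[of t j j] assms by (simp add: indicator_def)
  ultimately have "(\<Sum>n. ennreal (mpow k R n j j / c)) < \<infinity>"
    using nn_integral_mexp[of j j] assms by simp
  then have "summable (\<lambda>n. mpow k R n j j / c)"
    using c_pos mpow_R_nonneg assms by (intro summable_suminf_not_top) auto
  then have "summable (\<lambda>n. mpow k R n j j / c * c)" by (rule summable_mult2)
  then show ?thesis using c_pos by simp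
qed

text \<open>The expected number of visits to \<open>j\<close> is largest when starting from \<open>j\<close>.\<close>

lemma visits_le:
  assumes j: "j \<le> k"
  shows "i \<le> k \<Longrightarrow> (\<Sum>n<N. mpow k R n i j) \<le> (\<Sum>n<N. mpow k R n j j)"
proof (induction N arbitrary: i)
  case (Suc N)
  show ?case
  proof (cases "i = j")
    case False
    have "(\<Sum>n<Suc N. mpow k R n i j) = (\<Sum>n<N. \<Sum>l\<le>k. R i l * mpow k R n l j)"
      unfolding sum.lessThan_Suc_shift mpow_Suc_left[OF Suc.prems j] using False by simp
    also have "\<dots> = (\<Sum>l\<le>k. R i l * (\<Sum>n<N. mpow k R n l j))"
      unfolding sum_distrib_left by (rule sum.swap)
    also have "\<dots> \<le> (\<Sum>l\<le>k. R i l * (\<Sum>n<N. mpow k R n j j))"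
      using Suc by (intro sum_mono mult_left_mono[OF Suc.IH R_nonneg]) auto
    also have "\<dots> = (\<Sum>n<N. mpow k R n j j)"
      unfolding sum_distrib_right[symmetric] using R_row_sum[OF Suc.prems] by simp
    also have "\<dots> \<le> (\<Sum>n<Suc N. mpow k R n j j)" using mpow_R_nonneg[OF j j] by (simp del: mpow.simps)
    finally show ?thesis .
  qed simp
qed simp

lemma summable_visits:
  assumes "i \<le> k" "j < k"
  shows "summable (\<lambda>n. mpow k R n i j)"
proof (rule bounded_imp_summable)
  fix N
  have "(\<Sum>n\<le>N. mpow k R n i j) \<le> (\<Sum>n\<le>N. mpow k R n j j)"
    using visits_le[of j i "Suc N"] assms by (simp only: lessThan_Suc_atMost less_imp_le)
  also have "\<dots> \<le> (\<Sum>n. mpow k R n j j)"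
    using assms by (intro sum_le_suminf summable_diag) (auto intro: mpow_R_nonneg)
  finally show "(\<Sum>n\<le>N. mpow k R n i j) \<le> (\<Sum>n. mpow k R n j j)" .
qed (use assms in \<open>auto intro: mpow_R_nonneg\<close>)

section \<open>Absorption times\<close>

definition surv :: "nat \<Rightarrow> real \<Rightarrow> real" where "surv i t = 1 - mexp k A t i k"

definition mean_time :: "nat \<Rightarrow> real" where
  "mean_time i = (\<Sum>j<k. (\<Sum>n. mpow k R n i j)) / c"

lemma surv_eq: "0 \<le> t \<Longrightarrow> i \<le> k \<Longrightarrow> surv i t = (\<Sum>j<k. mexp k A t i j)"
  using mexp_row_sum[of t i] by (simp add: surv_def lessThan_Suc_atMost[symmetric])

lemma surv_bounds: "0 \<le> t \<Longrightarrow> i \<le> k \<Longrightarrow> 0 \<le> surv i t \<and> surv i t \<le> 1"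
  using mexp_nonneg[of t i k] surv_eq[of t i] by (auto simp: surv_def intro!: sum_nonneg mexp_nonneg)

lemma surv_measurable: "i \<le> k \<Longrightarrow> surv i \<in> borel_measurable borel"
  unfolding surv_def[abs_def] by (intro borel_measurable_diff mexp_measurable) auto

lemma surv_integral:
  assumes "i \<le> k"
  shows "has_bochner_integral lborel (\<lambda>t. indicator {0..} t * surv i t) (mean_time i)"
proof -
  have "has_bochner_integral lborel (\<lambda>t. \<Sum>j<k. indicator {0..} t * mexp k A t i j) (\<Sum>j<k. (\<Sum>n. mpow k R n i j / c))"
  proof (rule has_bochner_integral_sum)
    fix j assume "j \<in> {..<k}"
    then have j: "j < k" "j \<le> k" by auto
    have s: "summable (\<lambda>n. mpow k R n i j / c)" using summable_visits[OF assms j(1)] by (rule summable_divide)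
    have nn: "0 \<le> mpow k R n i j / c" for n using mpow_R_nonneg[OF assms j(2)] c_pos by simp
    have "(\<integral>\<^sup>+t. ennreal (indicator {0..} t * mexp k A t i j) \<partial>lborel) = ennreal (\<Sum>n. mpow k R n i j / c)"
      unfolding nn_integral_mexp[OF assms j(2)] by (rule suminf_ennreal2[OF nn s])
    then show "has_bochner_integral lborel (\<lambda>t. indicator {0..} t * mexp k A t i j) (\<Sum>n. mpow k R n i j / c)"
      using mexp_measurable[OF assms j(2)] mexp_nonneg[OF _ assms j(2)] suminf_nonneg[OF s nn]
      by (intro has_bochner_integral_nn_integral) (auto simp: indicator_def)
  qed
  also have "(\<Sum>j<k. (\<Sum>n. mpow k R n i j / c)) = mean_time i"
    unfolding mean_time_def sum_divide_distrib using summable_visits[OF assms]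
    by (intro sum.cong refl suminf_divide) auto
  also have "(\<lambda>t. \<Sum>j<k. indicator {0..} t * mexp k A t i j) = (\<lambda>t. indicator {0..} t * surv i t)"
    using surv_eq[OF _ assms] by (auto simp: indicator_def)
  finally show ?thesis .
qed

lemma mean_time_nonneg: "i \<le> k \<Longrightarrow> 0 \<le> mean_time i"
  unfolding mean_time_def using c_pos
  by (intro divide_nonneg_pos sum_nonneg suminf_nonneg summable_visits mpow_R_nonneg) auto

lemma mpow_R_absorbing: "j < k \<Longrightarrow> mpow k R n k j = 0"
proof (induction n)
  case (Suc n)
  have "mpow k R (Suc n) k j = (\<Sum>l\<le>k. R k l * mpow k R n l j)"
    using Suc.prems by (intro mpow_Suc_left) auto
  also have "\<dots> = (\<Sum>l\<le>k. if l = k then mpow k R n k j else 0)"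
    by (intro sum.cong refl) (auto simp: R_def unif_def absorbing)
  finally show ?case using Suc by simp
qed simp

lemma mean_time_absorbed: "mean_time k = 0"
  by (simp add: mean_time_def mpow_R_absorbing)

lemma surv_absorbed: "0 \<le> t \<Longrightarrow> surv k t = 0"
proof -
  assume t: "0 \<le> t"
  have "mexp k A t k j = 0" if "j < k" for j
  proof -
    have "(\<lambda>n. 0 :: real) sums mexp k A t k j"
      using mexp_sums[OF t, of k j] that by (simp add: mpow_R_absorbing del: mpow.simps)
    then show ?thesis using sums_unique2 sums_zero by blast
  qed
  then show "surv k t = 0" using surv_eq[OF t, of k] by simp
qed

text \<open>First-step analysis: apart from the initial one, visits are counted after one jump of
  \<open>R\<close>. Summing over the states below \<open>k\<close> gives the equation for the
  generator.\<close>

lemma mean_time_eq: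
  assumes i: "i < k"
  shows "(\<Sum>l\<le>k. A i l * mean_time l) = - 1"
proof -
  have "(\<Sum>n. mpow k R n i j) = (if i = j then 1 else 0) + (\<Sum>l\<le>k. R i l * (\<Sum>n. mpow k R n l j))" if j: "j < k" for j
  proof -
    have "(\<Sum>n. mpow k R n i j) = (\<Sum>n. mpow k R (Suc n) i j) + mpow k R 0 i j"
      using suminf_split_head[OF summable_visits[of i j]] i j by (simp del: mpow.simps)
    also have "(\<Sum>n. mpow k R (Suc n) i j) = (\<Sum>n. \<Sum>l\<le>k. R i l * mpow k R n l j)"
      using i j by (intro suminf_cong mpow_Suc_left) auto
    also have "\<dots> = (\<Sum>l\<le>k. \<Sum>n. R i l * mpow k R n l j)"
      using j by (intro suminf_sum summable_mult summable_visits) auto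
    also have "\<dots> = (\<Sum>l\<le>k. R i l * (\<Sum>n. mpow k R n l j))"
      using j by (intro sum.cong refl suminf_mult summable_visits) auto
    finally show ?thesis by simp
  qed
  then have "c * mean_time i = (\<Sum>j<k. (if i = j then 1 else 0) + (\<Sum>l\<le>k. R i l * (\<Sum>n. mpow k R n l j)))"
    using c_pos by (simp add: mean_time_def)
  also have "\<dots> = 1 + (\<Sum>j<k. \<Sum>l\<le>k. R i l * (\<Sum>n. mpow k R n l j))"
    using i by (simp add: sum.distrib)
  also have "(\<Sum>j<k. \<Sum>l\<le>k. R i l * (\<Sum>n. mpow k R n l j)) = (\<Sum>l\<le>k. \<Sum>j<k. R i l * (\<Sum>n. mpow k R n l j))"
    by (rule sum.swap)
  also have "\<dots> = (\<Sum>l\<le>k. R i l * (c * mean_time l))"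
  proof (intro sum.cong refl)
    fix l
    have "c * mean_time l = (\<Sum>j<k. \<Sum>n. mpow k R n l j)" using c_pos by (simp add: mean_time_def)
    then show "(\<Sum>j<k. R i l * (\<Sum>n. mpow k R n l j)) = R i l * (c * mean_time l)"
      by (simp only: sum_distrib_left)
  qed
  also have "\<dots> = (\<Sum>l\<le>k. (if i = l then c * mean_time l else 0) + A i l * mean_time l)"
    using c_pos by (intro sum.cong refl) (simp add: R_def unif_def field_simps)
  also have "\<dots> = c * mean_time i + (\<Sum>l\<le>k. A i l * mean_time l)"
    using i by (simp add: sum.distrib)
  finally show ?thesis by simp
qed

lemma DERIV_surv:
  assumes "i \<le> k"
  shows "(surv i has_real_derivative (\<Sum>l\<le>k. A i l * surv l t)) (at t)"
proof -
  have "(surv i has_real_derivative 0 - (\<Sum>l\<le>k. A i l * mexp k A t l k)) (at t)"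
    unfolding surv_def[abs_def] by (intro DERIV_diff DERIV_const DERIV_mexp assms) simp
  also have "0 - (\<Sum>l\<le>k. A i l * mexp k A t l k) = (\<Sum>l\<le>k. A i l * surv l t)"
    using row_sum[OF assms] by (simp add: surv_def right_diff_distrib sum_subtractf)
  finally show ?thesis .
qed

text \<open>Integration by parts turns the mean of \<open>capped_mean r m\<close> at the absorption
  time into an integral of its derivative against the survival function.\<close>

definition capped :: "real \<Rightarrow> nat \<Rightarrow> nat \<Rightarrow> real" where
  "capped r i m = (\<integral>t. indicator {0..} t * (capped_rate r m t * surv i t) \<partial>lborel)"

lemma capped_integrable:
  assumes "0 < r" "i \<le> k"
  shows "integrable lborel (\<lambda>t. indicator {0..} t * (capped_rate r m t * surv i t))"
proof (rule Bochner_Integration.integrable_bound)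
  show "integrable lborel (\<lambda>t. r * (indicator {0..} t * surv i t))"
    using surv_integral[OF assms(2)] by (simp add: has_bochner_integral_iff)
  show "(\<lambda>t. indicator {0..} t * (capped_rate r m t * surv i t)) \<in> borel_measurable lborel"
    using surv_measurable[OF assms(2)] by measurable
  have "\<bar>capped_rate r m t * surv i t\<bar> \<le> \<bar>r * surv i t\<bar>" if "0 \<le> t" for t
    using that assms capped_rate_nonneg[of r t m] capped_rate_le[of r t m] surv_bounds[of t i]
    by (simp add: abs_mult mult_right_mono)
  then show "AE t in lborel. norm (indicator {0..} t * (capped_rate r m t * surv i t)) \<le> norm (r * (indicator {0..} t * surv i t))"
    by (auto simp: indicator_def)
qed

lemma capped_0 [simp]: "capped r i 0 = 0"
  by (simp add: capped_def)

lemma capped_absorbed [simp]: "capped r k m = 0"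
proof -
  have "(\<lambda>t :: real. indicator {0..} t * (capped_rate r m t * surv k t)) = (\<lambda>t. 0)"
    by (rule ext) (simp add: indicator_def surv_absorbed)
  then show ?thesis by (simp only: capped_def) simp
qed

text \<open>Backward equation for the arrivals before absorption: an arrival, at rate
  \<open>r\<close>, counts 1 and lowers the cap, while the chain moves according to
  \<open>A\<close>. It results from integrating the derivative of the product of
  \<open>capped_rate\<close> and \<open>surv\<close>, whose value at 0 is \<open>r\<close>.\<close>

lemma capped_eq:
  assumes r: "0 < r" and i: "i < k"
  shows "r * (1 + capped r i m - capped r i (Suc m)) + (\<Sum>l\<le>k. A i l * capped r l (Suc m)) = 0"
proof -
  have i': "i \<le> k" using i by simp
  define F where "F t = capped_rate r (Suc m) t * surv i t" for t
  define f where "f t = r * (capped_rate r m t - capped_rate r (Suc m) t) * surv i t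
    + capped_rate r (Suc m) t * (\<Sum>l\<le>k. A i l * surv l t)" for t
  have DF: "(F has_real_derivative f t) (at t)" for t
  proof -
    have "(F has_real_derivative r * (capped_rate r m t - capped_rate r (Suc m) t) * surv i t
      + (\<Sum>l\<le>k. A i l * surv l t) * capped_rate r (Suc m) t) (at t)"
      unfolding F_def by (intro DERIV_mult DERIV_capped_rate DERIV_surv i')
    then show ?thesis by (simp add: f_def mult.commute)
  qed
  have cont_rate: "isCont (capped_rate r n) t" for n t
    by (cases n) (auto intro: DERIV_isCont[OF DERIV_capped_rate] simp: capped_rate_def[abs_def])
  have cont: "isCont f t" for t
    unfolding f_def by (intro continuous_intros cont_rate DERIV_isCont[OF DERIV_surv] i') auto
  have split: "indicator {0..} t * f t = r * (indicator {0..} t * (capped_rate r m t * surv i t))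
      - r * (indicator {0..} t * (capped_rate r (Suc m) t * surv i t))
      + (\<Sum>l\<le>k. A i l * (indicator {0..} t * (capped_rate r (Suc m) t * surv l t)))" for t :: real
    by (cases "0 \<le> t") (simp_all add: f_def sum_distrib_left algebra_simps)
  have int: "has_bochner_integral lborel (\<lambda>t. indicator {0..} t * f t)
      (r * capped r i m - r * capped r i (Suc m) + (\<Sum>l\<le>k. A i l * capped r l (Suc m)))"
    unfolding split capped_def
    by (intro has_bochner_integral_add has_bochner_integral_diff has_bochner_integral_sum has_bochner_integral_mult_right
        has_bochner_integral_integrable capped_integrable r i') auto
  have lim: "(F \<longlongrightarrow> 0) at_top"
  proof (rule tendsto_sandwich[OF _ _ tendsto_const capped_rate_tendsto_0[OF r, of "Suc m"]])
    show "\<forall>\<^sub>F t in at_top. 0 \<le> F t"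
      using eventually_ge_at_top[of 0] by eventually_elim (use r surv_bounds[OF _ i'] capped_rate_nonneg in \<open>simp add: F_def\<close>)
    show "\<forall>\<^sub>F t in at_top. F t \<le> capped_rate r (Suc m) t"
      using eventually_ge_at_top[of 0]
      by eventually_elim (use r surv_bounds[OF _ i'] capped_rate_nonneg in \<open>simp add: F_def mult_left_le\<close>)
  qed
  have "(\<integral>t. indicator {0..} t * f t \<partial>lborel) = - F 0"
    using int by (intro integral_FTC_atLeast_0[OF DF cont _ lim]) (simp add: has_bochner_integral_iff)
  moreover have "F 0 = r"
    using i by (simp add: F_def surv_def mexp_0 capped_rate_at_0)
  ultimately show ?thesis using int by (simp add: has_bochner_integral_iff algebra_simps)
qed

text \<open>At a negative minimum of \<open>v\<close>, attained at some \<open>i0 < k\<close>, the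
  zero row sum and the nonnegative off-diagonal rates make \<open>A v\<close> nonnegative, while
  \<open>a * v\<close> is negative.\<close>

lemma min_principle:
  assumes a: "0 < a" and v: "0 \<le> v k" and sup: "\<And>i. i < k \<Longrightarrow> 0 \<le> a * v i - (\<Sum>l\<le>k. A i l * v l)"
    and "i \<le> k"
  shows "0 \<le> (v i :: real)"
proof (rule ccontr)
  assume neg: "\<not> 0 \<le> v i"
  obtain i0 where i0: "i0 \<le> k" "\<And>l. l \<le> k \<Longrightarrow> v i0 \<le> v l"
    using arg_min_if_finite[of "{..k}" v] by (metis atMost_iff empty_iff finite_atMost le0 not_less)
  have "v i0 < 0" using i0(2)[OF \<open>i \<le> k\<close>] neg by simp
  then have "i0 < k" using i0(1) v by (cases "i0 = k") auto
  have "(\<Sum>l\<le>k. A i0 l * v l) = (\<Sum>l\<le>k. A i0 l * (v l - v i0)) + (\<Sum>l\<le>k. A i0 l) * v i0"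
    by (simp add: right_diff_distrib sum_subtractf sum_distrib_right)
  also have "\<dots> = (\<Sum>l\<le>k. A i0 l * (v l - v i0))" using row_sum[OF i0(1)] by simp
  also have "0 \<le> \<dots>"
  proof (rule sum_nonneg)
    fix l assume "l \<in> {..k}"
    then show "0 \<le> A i0 l * (v l - v i0)"
      using i0 offdiag[of i0 l] by (cases "l = i0") auto
  qed
  finally have "0 \<le> (\<Sum>l\<le>k. A i0 l * v l)" .
  moreover have "a * v i0 < 0" using a \<open>v i0 < 0\<close> by (rule mult_pos_neg)
  ultimately show False using sup[OF \<open>i0 < k\<close>] by linarith
qed

text \<open>Induction on the cap: the previous cap enters with the positive factor \<open>r\<close>,
  and the minimum principle is applied to the difference.\<close>

lemma capped_le_supersolution:
  assumes r: "0 < r" and U0: "\<And>i. i \<le> k \<Longrightarrow> 0 \<le> U 0 i" and Uk: "\<And>m. 0 \<le> U m k"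
    and sup: "\<And>m i. i < k \<Longrightarrow> r * (1 + U m i - U (Suc m) i) + (\<Sum>l\<le>k. A i l * U (Suc m) l) \<le> 0"
  shows "i \<le> k \<Longrightarrow> capped r i m \<le> U m i"
proof (induction m arbitrary: i)
  case 0
  then show ?case using U0 by simp
next
  case (Suc m)
  have "0 \<le> U (Suc m) i - capped r i (Suc m)"
  proof (rule min_principle[OF r, of "\<lambda>i. U (Suc m) i - capped r i (Suc m)"])
    show "0 \<le> U (Suc m) k - capped r k (Suc m)" using Uk by simp
    fix i assume i: "i < k"
    have "r * capped r i m \<le> r * U m i" using Suc.IH[of i] i r by simp
    then show "0 \<le> r * (U (Suc m) i - capped r i (Suc m)) - (\<Sum>l\<le>k. A i l * (U (Suc m) l - capped r l (Suc m)))"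
      using sup[OF i, of m] capped_eq[OF r i, of m]
      by (simp add: right_diff_distrib sum_subtractf algebra_simps)
  qed (rule Suc.prems)
  then show ?case by simp
qed

end

section \<open>Sums of exponential phases\<close>

text \<open>Integration by parts against the exponential law: the function \<open>F\<close> below
  vanishes both at 0 and at infinity, so its derivative has integral 0.\<close>

lemma capped_mean_exponential:
  assumes \<rho>: "0 < \<rho>" and \<kappa>: "0 < \<kappa>" and y: "0 \<le> y" and d: "0 \<le> d"
  shows "(\<integral>x. capped_mean \<rho> m (y + d * x) \<partial>density lborel (exponential_density \<kappa>))
    = capped_mean \<rho> m y + d / \<kappa> * (\<integral>x. capped_rate \<rho> m (y + d * x) \<partial>density lborel (exponential_density \<kappa>))"
proof -
  interpret D: prob_space "density lborel (exponential_density \<kappa>)" by (rule prob_space_exponential_density[OF \<kappa>])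
  define e where "e x = exp (- (\<kappa> * x))" for x
  define F where "F x = e x * (capped_mean \<rho> m (y + d * x) - capped_mean \<rho> m y)" for x
  define f where "f x = e x * (d * capped_rate \<rho> m (y + d * x)) - \<kappa> * e x * (capped_mean \<rho> m (y + d * x) - capped_mean \<rho> m y)" for x
  have pos: "0 \<le> y + d * x" if "0 \<le> x" for x using that y d by simp
  have to_D: "(\<integral>x. h x \<partial>density lborel (exponential_density \<kappa>)) = (\<integral>x. indicator {0..} x * (\<kappa> * e x * h x) \<partial>lborel)"
    and int_D: "integrable lborel (\<lambda>x. indicator {0..} x * (\<kappa> * e x * h x))"
    if h: "h \<in> borel_measurable borel" and b: "\<And>x. 0 \<le> x \<Longrightarrow> \<bar>h x\<bar> \<le> C" for h :: "real \<Rightarrow> real" and C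
  proof -
    have eq: "exponential_density \<kappa> x * h x = indicator {0..} x * (\<kappa> * e x * h x)" for x
      by (simp add: exponential_density_def e_def mult.commute)
    show "(\<integral>x. h x \<partial>density lborel (exponential_density \<kappa>)) = (\<integral>x. indicator {0..} x * (\<kappa> * e x * h x) \<partial>lborel)"
      using h \<kappa> by (subst integral_real_density) (auto simp: eq exponential_density_nonneg)
    have "AE x in density lborel (exponential_density \<kappa>). \<bar>h x\<bar> \<le> C"
      using b by (subst AE_density) (auto simp: exponential_density_def)
    then have "integrable (density lborel (exponential_density \<kappa>)) h"
      using h by (intro D.integrable_const_bound[of _ C]) auto
    then show "integrable lborel (\<lambda>x. indicator {0..} x * (\<kappa> * e x * h x))"
      using h \<kappa> by (subst (asm) integrable_real_density) (auto simp: eq exponential_density_nonneg)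
  qed
  have b1: "\<bar>capped_mean \<rho> m (y + d * x)\<bar> \<le> real m" if "0 \<le> x" for x
    using capped_mean_bounds[OF \<rho> pos[OF that], of m] by auto
  have b2: "\<bar>capped_mean \<rho> m (y + d * x) - capped_mean \<rho> m y\<bar> \<le> 2 * real m" if "0 \<le> x" for x
    using capped_mean_bounds[OF \<rho> pos[OF that], of m] capped_mean_bounds[OF \<rho> y, of m] by auto
  have b3: "\<bar>capped_rate \<rho> m (y + d * x)\<bar> \<le> \<rho>" if "0 \<le> x" for x
    using capped_rate_nonneg[OF less_imp_le[OF \<rho>] pos[OF that], of m] capped_rate_le[OF less_imp_le[OF \<rho>] pos[OF that], of m] by auto
  have m1: "(\<lambda>x. capped_mean \<rho> m (y + d * x)) \<in> borel_measurable borel"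
    "(\<lambda>x. capped_mean \<rho> m (y + d * x) - capped_mean \<rho> m y) \<in> borel_measurable borel"
    "(\<lambda>x. capped_rate \<rho> m (y + d * x)) \<in> borel_measurable borel" by measurable
  have DF: "(F has_real_derivative f x) (at x)" for x
  proof -
    have "((\<lambda>x. capped_mean \<rho> m (y + d * x)) has_real_derivative capped_rate \<rho> m (y + d * x) * d) (at x)"
      by (rule DERIV_chain2[OF DERIV_capped_mean]) (auto intro!: derivative_eq_intros)
    moreover have "(e has_real_derivative - \<kappa> * e x) (at x)"
      unfolding e_def by (auto intro!: derivative_eq_intros)
    ultimately have "(F has_real_derivative (- \<kappa> * e x) * (capped_mean \<rho> m (y + d * x) - capped_mean \<rho> m y)
        + (capped_rate \<rho> m (y + d * x) * d - 0) * e x) (at x)"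
      unfolding F_def by (intro DERIV_mult DERIV_diff DERIV_const)
    then show ?thesis by (simp add: f_def algebra_simps)
  qed
  have cont_rate: "isCont (capped_rate \<rho> m) t" for t
    by (cases m) (auto intro: DERIV_isCont[OF DERIV_capped_rate] simp: capped_rate_def[abs_def])
  have cont: "isCont f x" for x
    unfolding f_def e_def
    by (intro continuous_intros isCont_o2[OF _ cont_rate] isCont_o2[OF _ DERIV_isCont[OF DERIV_capped_mean]])
  have split: "indicator {0..} x * f x = d / \<kappa> * (indicator {0..} x * (\<kappa> * e x * capped_rate \<rho> m (y + d * x)))
      - indicator {0..} x * (\<kappa> * e x * (capped_mean \<rho> m (y + d * x) - capped_mean \<rho> m y))" for x :: real
    using \<kappa> by (simp add: f_def field_simps)
  have int_f: "integrable lborel (\<lambda>x. indicator {0..} x * f x)"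
    unfolding split by (intro Bochner_Integration.integrable_diff integrable_mult_right int_D[OF m1(2) b2] int_D[OF m1(3) b3])
  have lim: "(F \<longlongrightarrow> 0) at_top"
  proof (rule Lim_null_comparison)
    have "filterlim (\<lambda>x. \<kappa> * x) at_top at_top"
      by (rule filterlim_tendsto_pos_mult_at_top[OF tendsto_const \<kappa> filterlim_ident])
    then have "(e \<longlongrightarrow> 0) at_top"
      unfolding e_def by (intro filterlim_compose[OF exp_at_bot] filterlim_uminus_at_top[THEN iffD1])
    then show "((\<lambda>x. e x * (2 * real m)) \<longlongrightarrow> 0) at_top" by (rule tendsto_mult_left_zero)
    show "\<forall>\<^sub>F x in at_top. norm (F x) \<le> e x * (2 * real m)"
      using eventually_ge_at_top[of 0]
    proof eventually_elim
      fix x :: real assume "0 \<le> x"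
      then show "norm (F x) \<le> e x * (2 * real m)"
        using b2[of x] by (simp add: F_def abs_mult e_def)
    qed
  qed
  have "(\<integral>x. indicator {0..} x * f x \<partial>lborel) = - F 0"
    by (rule integral_FTC_atLeast_0[OF DF cont int_f lim])
  also have "F 0 = 0" by (simp add: F_def)
  finally have "(\<integral>x. indicator {0..} x * f x \<partial>lborel) = 0" by simp
  then have "d / \<kappa> * (\<integral>x. indicator {0..} x * (\<kappa> * e x * capped_rate \<rho> m (y + d * x)) \<partial>lborel)
      = (\<integral>x. indicator {0..} x * (\<kappa> * e x * (capped_mean \<rho> m (y + d * x) - capped_mean \<rho> m y)) \<partial>lborel)"
    unfolding split
    using Bochner_Integration.integral_diff[OF integrable_mult_right[OF int_D[OF m1(3) b3], of "d / \<kappa>"] int_D[OF m1(2) b2]]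
    by (simp only: integral_mult_right_zero)
  then have "d / \<kappa> * (\<integral>x. capped_rate \<rho> m (y + d * x) \<partial>density lborel (exponential_density \<kappa>))
      = (\<integral>x. capped_mean \<rho> m (y + d * x) - capped_mean \<rho> m y \<partial>density lborel (exponential_density \<kappa>))"
    using to_D[OF m1(3) b3] to_D[OF m1(2) b2] by simp
  also have "\<dots> = (\<integral>x. capped_mean \<rho> m (y + d * x) \<partial>density lborel (exponential_density \<kappa>)) - capped_mean \<rho> m y"
  proof -
    have "AE x in density lborel (exponential_density \<kappa>). \<bar>capped_mean \<rho> m (y + d * x)\<bar> \<le> real m"
      using b1 by (subst AE_density) (auto simp: exponential_density_def)
    then have "integrable (density lborel (exponential_density \<kappa>)) (\<lambda>x. capped_mean \<rho> m (y + d * x))"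
      by (intro D.integrable_const_bound[of _ "real m"]) auto
    then show ?thesis using D.prob_space by simp
  qed
  finally show ?thesis by simp
qed

text \<open>Phase \<open>l\<close> lasts \<open>d l * y l\<close>, with mean
  \<open>d l / \<kappa>\<close>. Putting weights on one family of independent variables admits
  phases of length 0 and compares different phase means on the same space.\<close>

locale exponential_phases =
  fixes \<kappa> \<rho> :: real and d :: "nat \<Rightarrow> real"
  assumes \<kappa>: "0 < \<kappa>" and \<rho>: "0 < \<rho>" and d: "\<And>l. 0 \<le> d l"
begin

abbreviation E :: "real measure" where "E \<equiv> density lborel (exponential_density \<kappa>)"
abbreviation W :: "(nat \<Rightarrow> real) measure" where "W \<equiv> \<Pi>\<^sub>M i\<in>UNIV. E"

sublocale E: prob_space E by (rule prob_space_exponential_density[OF \<kappa>])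
sublocale W: prob_space W by (rule prob_space_PiM) (rule E.prob_space_axioms)
sublocale seq: sequence_space E ..

definition tot :: "nat \<Rightarrow> (nat \<Rightarrow> real) \<Rightarrow> real" where
  "tot r y = (\<Sum>l<r. d l * y l)"

text \<open>Values and slopes of the comparison chain with \<open>r\<close> phases to run: by
  \<open>U_Suc\<close>, \<open>V\<close> is the slope of \<open>U\<close> per unit of added mean
  time.\<close>

definition U :: "nat \<Rightarrow> nat \<Rightarrow> real" where "U m r = (\<integral>y. capped_mean \<rho> m (tot r y) \<partial>W)"
definition V :: "nat \<Rightarrow> nat \<Rightarrow> real" where "V m r = (\<integral>y. capped_rate \<rho> m (tot r y) \<partial>W)"

lemma coordinate_measurable [measurable]: "(\<lambda>y. y l) \<in> borel_measurable W"
  using measurable_component_singleton[of l UNIV "\<lambda>_. E"] by simp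

lemma tot_measurable [measurable]: "tot r \<in> borel_measurable W"
  unfolding tot_def[abs_def] by measurable

lemma AE_nonneg: "AE y in W. \<forall>l. 0 \<le> y l"
proof -
  have "AE x in E. 0 \<le> x" by (subst AE_density) (auto simp: exponential_density_def)
  then have "AE y in W. 0 \<le> y l" for l by (intro seq.AE_component) auto
  then show ?thesis by (subst AE_all_countable) auto
qed

lemma tot_nonneg: "\<forall>l. 0 \<le> y l \<Longrightarrow> 0 \<le> tot r y"
  unfolding tot_def using d by (intro sum_nonneg mult_nonneg_nonneg) auto

lemma capped_mean_tot_bound: "AE y in W. \<bar>capped_mean \<rho> m (tot r y)\<bar> \<le> real m"
  using AE_nonneg by eventually_elim (use capped_mean_bounds[OF \<rho> tot_nonneg] in \<open>auto simp: abs_le_iff intro: order_trans[of _ 0]\<close>)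

lemma capped_rate_tot_bound: "AE y in W. \<bar>capped_rate \<rho> m (tot r y)\<bar> \<le> \<rho>"
  using AE_nonneg
proof eventually_elim
  fix y :: "nat \<Rightarrow> real" assume "\<forall>l. 0 \<le> y l"
  then have "0 \<le> tot r y" by (rule tot_nonneg)
  then show "\<bar>capped_rate \<rho> m (tot r y)\<bar> \<le> \<rho>"
    using capped_rate_nonneg[of \<rho> "tot r y" m] capped_rate_le[of \<rho> "tot r y" m] \<rho> by simp
qed

lemma capped_mean_tot_int: "integrable W (\<lambda>y. capped_mean \<rho> m (tot r y))"
  using capped_mean_tot_bound by (intro W.integrable_const_bound[of _ "real m"]) simp_all

lemma capped_rate_tot_int: "integrable W (\<lambda>y. capped_rate \<rho> m (tot r y))"
  using capped_rate_tot_bound by (intro W.integrable_const_bound[of _ \<rho>]) simp_all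

lemma U_nonneg: "0 \<le> U m r"
  unfolding U_def using AE_nonneg
  by (intro integral_nonneg_AE) (auto elim!: eventually_mono intro!: capped_mean_bounds[OF \<rho>] tot_nonneg)

lemma U_0 [simp]: "U 0 r = 0"
  by (simp add: U_def)

lemma V_eq: "V (Suc m) r = \<rho> * (1 + U m r - U (Suc m) r)"
  unfolding V_def U_def capped_rate_eq
  using capped_mean_tot_int[of m r] capped_mean_tot_int[of "Suc m" r] by (simp add: W.prob_space)

lemma V_antimono: "V m (Suc r) \<le> V m r"
  unfolding V_def
proof (rule integral_mono_AE[OF capped_rate_tot_int capped_rate_tot_int])
  show "AE y in W. capped_rate \<rho> m (tot (Suc r) y) \<le> capped_rate \<rho> m (tot r y)"
    using AE_nonneg
  proof eventually_elim
    fix y :: "nat \<Rightarrow> real" assume y: "\<forall>l. 0 \<le> y l"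
    have "tot r y \<le> tot (Suc r) y" using y d[of r] by (simp add: tot_def)
    then show "capped_rate \<rho> m (tot (Suc r) y) \<le> capped_rate \<rho> m (tot r y)"
      using \<rho> tot_nonneg[OF y] by (intro capped_rate_antimono) auto
  qed
qed

lemma V_antimono_le: "r \<le> s \<Longrightarrow> V m s \<le> V m r"
  using lift_Suc_antimono_le[of "V m"] V_antimono by blast

text \<open>With the earlier phases fixed, phase \<open>r\<close> alone is integrated out by
  \<open>capped_mean_exponential\<close>.\<close>

lemma U_Suc: "U m (Suc r) - U m r = d r / \<kappa> * V m (Suc r)"
proof -
  have tot_upd: "tot (Suc r) (y(r := x)) = tot r y + d r * x" for x y
    by (simp add: tot_def)
  have "U m (Suc r) = (\<integral>y. (\<integral>x. capped_mean \<rho> m (tot r y + d r * x) \<partial>E) \<partial>W)"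
    unfolding U_def tot_upd[symmetric]
    by (rule seq.integral_PiM_fun_upd(1)[OF _ _ capped_mean_tot_bound]) auto
  also have "\<dots> = (\<integral>y. capped_mean \<rho> m (tot r y) + d r / \<kappa> * (\<integral>x. capped_rate \<rho> m (tot r y + d r * x) \<partial>E) \<partial>W)"
  proof (rule integral_cong_AE)
    show "AE y in W. (\<integral>x. capped_mean \<rho> m (tot r y + d r * x) \<partial>E)
        = capped_mean \<rho> m (tot r y) + d r / \<kappa> * (\<integral>x. capped_rate \<rho> m (tot r y + d r * x) \<partial>E)"
      using AE_nonneg by eventually_elim (intro capped_mean_exponential \<rho> \<kappa> tot_nonneg d)
  qed measurable
  also have "\<dots> = U m r + d r / \<kappa> * (\<integral>y. (\<integral>x. capped_rate \<rho> m (tot r y + d r * x) \<partial>E) \<partial>W)"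
  proof -
    have "AE y in W. \<bar>\<integral>x. capped_rate \<rho> m (tot r y + d r * x) \<partial>E\<bar> \<le> \<rho>"
      using AE_nonneg
    proof eventually_elim
      fix y :: "nat \<Rightarrow> real" assume y: "\<forall>l. 0 \<le> y l"
      have ae: "AE x in E. \<bar>capped_rate \<rho> m (tot r y + d r * x)\<bar> \<le> \<rho>"
      proof -
        have "AE x in E. 0 \<le> x" by (subst AE_density) (auto simp: exponential_density_def)
        then show ?thesis
        proof eventually_elim
          fix x :: real assume "0 \<le> x"
          then have "0 \<le> tot r y + d r * x" using tot_nonneg[OF y, of r] d[of r] by simp
          then show "\<bar>capped_rate \<rho> m (tot r y + d r * x)\<bar> \<le> \<rho>"
            using capped_rate_nonneg[of \<rho> _ m] capped_rate_le[of \<rho> _ m] \<rho> by simp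
        qed
      qed
      have int: "integrable E (\<lambda>x. capped_rate \<rho> m (tot r y + d r * x))"
        using ae by (intro E.integrable_const_bound[of _ \<rho>]) simp_all
      have "\<bar>\<integral>x. capped_rate \<rho> m (tot r y + d r * x) \<partial>E\<bar> \<le> (\<integral>x. \<bar>capped_rate \<rho> m (tot r y + d r * x)\<bar> \<partial>E)"
        by (rule integral_abs_bound)
      also have "\<dots> \<le> (\<integral>x. \<rho> \<partial>E)" using int ae by (intro integral_mono_AE) auto
      also have "\<dots> = \<rho>" using E.prob_space by simp
      finally show "\<bar>\<integral>x. capped_rate \<rho> m (tot r y + d r * x) \<partial>E\<bar> \<le> \<rho>" .
    qed
    then have "integrable W (\<lambda>y. \<integral>x. capped_rate \<rho> m (tot r y + d r * x) \<partial>E)"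
      by (intro W.integrable_const_bound[of _ \<rho>]) (simp, measurable)
    then show ?thesis unfolding U_def using capped_mean_tot_int[of m r] by simp
  qed
  also have "(\<integral>y. (\<integral>x. capped_rate \<rho> m (tot r y + d r * x) \<partial>E) \<partial>W) = V m (Suc r)"
    unfolding V_def tot_upd[symmetric]
    by (rule seq.integral_PiM_fun_upd(1)[symmetric, OF _ _ capped_rate_tot_bound]) auto
  finally show ?thesis by simp
qed

text \<open>As a function of the accumulated mean time, \<open>U m\<close> has decreasing slopes.
  \<open>V m r\<close> is at least every slope to the right of \<open>r\<close> and at most every
  slope to the left, so it gives a tangent in both directions.\<close>

lemma U_le_tangent: "U m s - U m r \<le> ((\<Sum>l<s. d l / \<kappa>) - (\<Sum>l<r. d l / \<kappa>)) * V m r"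
proof -
  have nn: "0 \<le> d l / \<kappa>" for l using d \<kappa> by simp
  show ?thesis
  proof (cases "r \<le> s")
    case True
    then show ?thesis
    proof (induction rule: dec_induct)
      case (step s)
      have "d s / \<kappa> * V m (Suc s) \<le> d s / \<kappa> * V m r"
        using step by (intro mult_left_mono nn V_antimono_le) simp
      then show ?case using step.IH U_Suc[of m s] by (simp add: algebra_simps)
    qed simp
  next
    case False
    then have "s \<le> r" by simp
    then show ?thesis
    proof (induction rule: inc_induct)
      case (step s)
      have "d s / \<kappa> * V m r \<le> d s / \<kappa> * V m (Suc s)"
        using step by (intro mult_left_mono nn V_antimono_le) simp
      then show ?case using step.IH U_Suc[of m s] by (simp add: algebra_simps)
    qed simp
  qed
qed

text \<open>The law of \<open>W\<close> is invariant under cyclic shifts of the first \<open>k\<close> coordinates; averaging over the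
  shifts replaces all weights by their mean.\<close>

lemma U_le_equal_weights:
  assumes "0 < k"
  shows "U m k \<le> (\<integral>y. capped_mean \<rho> m ((\<Sum>l<k. d l) / real k * (\<Sum>l<k. y l)) \<partial>W)"
proof -
  \<comment> \<open>\<open>\<sigma> s\<close> shifts cyclically below \<open>k\<close> and fixes all
    other indices, so it is injective on all naturals. Below \<open>k\<close> the formula is
    symmetric in \<open>s\<close> and \<open>l\<close>; hence for fixed \<open>l\<close> it also
    permutes the shifts \<open>s\<close>, which makes the average over \<open>s\<close> equalise the
    weights.\<close>
  define \<sigma> where "\<sigma> s l = (if l < k \<and> s < k then if l + s < k then l + s else l + s - k else l)" for s l :: nat
  define T where "T s y = (\<Sum>l<k. d l * y (\<sigma> s l))" for s and y :: "nat \<Rightarrow> real"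
  have T_meas [measurable]: "T s \<in> borel_measurable W" for s unfolding T_def by measurable
  have inj: "inj (\<sigma> s)" for s
    by (rule injI) (auto simp: \<sigma>_def split: if_splits)
  have distr: "distr W W (\<lambda>y l. y (\<sigma> s l)) = W" for s
    using distr_PiM_reindex[of UNIV "\<lambda>_. E" "\<sigma> s" UNIV] inj[of s] E.prob_space_axioms by (simp add: restrict_def)
  have perm: "(\<integral>y. capped_mean \<rho> m (T s y) \<partial>W) = U m k" for s
  proof -
    have meas: "(\<lambda>y l. y (\<sigma> s l)) \<in> measurable W W"
      by (rule measurable_PiM_single') (auto simp: space_PiM)
    have "U m k = (\<integral>y. capped_mean \<rho> m (tot k y) \<partial>distr W W (\<lambda>y l. y (\<sigma> s l)))"
      by (simp only: distr U_def)
    also have "\<dots> = (\<integral>y. capped_mean \<rho> m (tot k (\<lambda>l. y (\<sigma> s l))) \<partial>W)"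
      by (rule integral_distr[OF meas]) measurable
    finally show ?thesis by (simp add: T_def tot_def)
  qed
  have bound: "AE y in W. \<bar>capped_mean \<rho> m (T s y)\<bar> \<le> real m" for s
    using AE_nonneg
  proof eventually_elim
    fix y :: "nat \<Rightarrow> real" assume "\<forall>l. 0 \<le> y l"
    then have "0 \<le> T s y" unfolding T_def using d by (intro sum_nonneg mult_nonneg_nonneg) auto
    then show "\<bar>capped_mean \<rho> m (T s y)\<bar> \<le> real m" using capped_mean_bounds[OF \<rho>, of "T s y" m] by simp
  qed
  have int: "integrable W (\<lambda>y. capped_mean \<rho> m (T s y))" for s
    using bound[of s] by (intro W.integrable_const_bound[of _ "real m"]) simp_all
  have avg: "(\<Sum>s<k. (1 / real k) * T s y) = (\<Sum>l<k. d l) / real k * (\<Sum>l<k. y l)" for y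
  proof -
    have shift: "(\<Sum>s<k. y (\<sigma> s l)) = (\<Sum>l<k. y l)" if "l < k" for l
    proof (rule sum.reindex_bij_betw)
      show "bij_betw (\<lambda>s. \<sigma> s l) {..<k} {..<k}"
      proof (rule bij_betw_imageI)
        show inj2: "inj_on (\<lambda>s. \<sigma> s l) {..<k}"
          using that by (intro inj_onI) (auto simp: \<sigma>_def split: if_splits)
        show "(\<lambda>s. \<sigma> s l) ` {..<k} = {..<k}"
          by (rule endo_inj_surj[OF _ _ inj2]) (use assms that in \<open>auto simp: \<sigma>_def\<close>)
      qed
    qed
    have "(\<Sum>s<k. (1 / real k) * T s y) = (\<Sum>s<k. \<Sum>l<k. d l * y (\<sigma> s l)) / real k"
      by (simp add: T_def sum_divide_distrib)
    also have "(\<Sum>s<k. \<Sum>l<k. d l * y (\<sigma> s l)) = (\<Sum>l<k. d l * (\<Sum>s<k. y (\<sigma> s l)))"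
      unfolding sum_distrib_left by (rule sum.swap)
    also have "\<dots> = (\<Sum>l<k. d l) * (\<Sum>l<k. y l)"
      unfolding sum_distrib_right by (intro sum.cong refl) (simp add: shift)
    finally show ?thesis by simp
  qed
  have "U m k = (\<integral>y. (\<Sum>s<k. (1 / real k) * capped_mean \<rho> m (T s y)) \<partial>W)"
    using assms int by (simp add: perm)
  also have "\<dots> \<le> (\<integral>y. capped_mean \<rho> m ((\<Sum>l<k. d l) / real k * (\<Sum>l<k. y l)) \<partial>W)"
  proof (rule integral_mono_AE)
    show "integrable W (\<lambda>y. \<Sum>s<k. (1 / real k) * capped_mean \<rho> m (T s y))"
      by (intro Bochner_Integration.integrable_sum integrable_mult_right int)
    have nn: "AE y in W. 0 \<le> (\<Sum>l<k. d l) / real k * (\<Sum>l<k. y l)"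
      using AE_nonneg by eventually_elim (use d in \<open>auto intro!: mult_nonneg_nonneg divide_nonneg_nonneg sum_nonneg\<close>)
    then have "AE y in W. \<bar>capped_mean \<rho> m ((\<Sum>l<k. d l) / real k * (\<Sum>l<k. y l))\<bar> \<le> real m"
      by eventually_elim (simp add: capped_mean_bounds[OF \<rho>])
    then show "integrable W (\<lambda>y. capped_mean \<rho> m ((\<Sum>l<k. d l) / real k * (\<Sum>l<k. y l)))"
      by (intro W.integrable_const_bound[of _ "real m"]) simp_all
    show "AE y in W. (\<Sum>s<k. (1 / real k) * capped_mean \<rho> m (T s y)) \<le> capped_mean \<rho> m ((\<Sum>l<k. d l) / real k * (\<Sum>l<k. y l))"
      using AE_nonneg
    proof eventually_elim
      fix y :: "nat \<Rightarrow> real" assume y: "\<forall>l. 0 \<le> y l"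
      have "T s y \<in> {0..}" for s unfolding T_def using d y by (auto intro!: sum_nonneg mult_nonneg_nonneg)
      then have "- capped_mean \<rho> m (\<Sum>s<k. (1 / real k) *\<^sub>R T s y) \<le> (\<Sum>s<k. (1 / real k) * - capped_mean \<rho> m (T s y))"
        using assms by (intro convex_on_sum[OF _ _ concave_capped_mean]) (use \<rho> in auto)
      then show "(\<Sum>s<k. (1 / real k) * capped_mean \<rho> m (T s y)) \<le> capped_mean \<rho> m ((\<Sum>l<k. d l) / real k * (\<Sum>l<k. y l))"
        unfolding avg[symmetric] by (simp add: sum_negf)
    qed
  qed
  finally show ?thesis .
qed

lemma sum_erlang:
  assumes "0 < k"
  shows "distr W borel (\<lambda>y. \<Sum>l<k. y l) = density lborel (erlang_density (k - 1) \<kappa>)"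
proof -
  have comp: "distr W E (\<lambda>y. y l) = E" for l :: nat
    using distr_PiM_component[of UNIV "\<lambda>_. E" l] E.prob_space_axioms by simp
  have comp': "distr W borel (\<lambda>y. y l) = E" for l :: nat
  proof -
    have "distr W borel (\<lambda>y. y l) = distr W E (\<lambda>y. y l)" by (rule distr_cong) simp_all
    then show ?thesis by (simp only: comp)
  qed
  have "W.indep_vars (\<lambda>_. borel) (\<lambda>l y. y l) {..<k}"
  proof (subst W.indep_vars_iff_distr_eq_PiM')
    have "distr W (\<Pi>\<^sub>M i\<in>{..<k}. borel) (\<lambda>y. \<lambda>i\<in>{..<k}. y i) = distr W (\<Pi>\<^sub>M i\<in>{..<k}. E) (\<lambda>y. restrict y {..<k})"
      by (rule distr_cong) (simp_all cong: sets_PiM_cong)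
    also have "\<dots> = (\<Pi>\<^sub>M i\<in>{..<k}. E)"
      using distr_PiM_reindex[of UNIV "\<lambda>_. E" "\<lambda>i. i" "{..<k}"] E.prob_space_axioms by (simp add: restrict_def)
    finally show "distr W (\<Pi>\<^sub>M i\<in>{..<k}. borel) (\<lambda>y. \<lambda>i\<in>{..<k}. y i) = (\<Pi>\<^sub>M i\<in>{..<k}. distr W borel (\<lambda>y. y i))"
      by (simp only: comp')
  qed (use assms in auto)
  then have "distributed W lborel (\<lambda>y. \<Sum>l\<in>{..<k}. y l) (erlang_density (card {..<k} - 1) \<kappa>)"
    using assms \<kappa>
    by (intro W.exponential_distributed_sum) (auto simp: distributed_def comp' cong: distr_cong)
  then show ?thesis by (simp add: distributed_def cong: distr_cong)
qed

end

section \<open>Phase-type job sizes\<close>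

lemma transition_prob_eq_mexp:
  assumes "rate_matrix k Q" "i \<le> k" "j \<le> k"
  shows "transition_prob Q t i j = mexp k (\<lambda>i j. Q $$ (i, j)) t i j"
  using assms index_pow_mat[of Q k i j]
  by (simp add: transition_prob_def mexp_def rate_matrix_def)

text \<open>Layer-cake formula for a function \<open>F\<close> with derivative
  \<open>\<phi>\<close>. The half-open interval makes the condition on \<open>z\<close> strict, as
  \<open>1 - cdf Z t\<close> is the probability of exceeding \<open>t\<close>.\<close>

lemma nn_integral_tail:
  fixes \<phi> F :: "real \<Rightarrow> real"
  assumes Z: "real_distribution Z" and nonneg: "AE z in Z. 0 \<le> z"
    and \<phi> [measurable]: "\<phi> \<in> borel_measurable borel" and \<phi>_nonneg: "\<And>t. 0 \<le> t \<Longrightarrow> 0 \<le> \<phi> t"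
    and F: "\<And>z. 0 \<le> z \<Longrightarrow> (\<integral>\<^sup>+t. ennreal (\<phi> t) * indicator {0..<z} t \<partial>lborel) = ennreal (F z)"
  shows "(\<integral>\<^sup>+z. ennreal (F z) \<partial>Z) = (\<integral>\<^sup>+t. ennreal (indicator {0..} t * (\<phi> t * (1 - cdf Z t))) \<partial>lborel)"
proof -
  interpret Z: real_distribution Z by fact
  interpret LZ: pair_sigma_finite lborel Z ..
  have "(\<integral>\<^sup>+z. ennreal (F z) \<partial>Z) = (\<integral>\<^sup>+z. (\<integral>\<^sup>+t. ennreal (\<phi> t) * indicator {0..<z} t \<partial>lborel) \<partial>Z)"
    using nonneg by (intro nn_integral_cong_AE) (auto elim!: eventually_mono simp: F)
  also have "\<dots> = (\<integral>\<^sup>+t. (\<integral>\<^sup>+z. ennreal (\<phi> t) * indicator {0..<z} t \<partial>Z) \<partial>lborel)"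
  proof (rule LZ.Fubini')
    have "(\<lambda>(t, z). ennreal (\<phi> t) * (if 0 \<le> t \<and> t < z then 1 else 0)) \<in> borel_measurable (lborel \<Otimes>\<^sub>M Z)"
      by measurable
    then show "(\<lambda>(t, z). ennreal (\<phi> t) * indicator {0..<z} t) \<in> borel_measurable (lborel \<Otimes>\<^sub>M Z)"
      by (rule measurable_cong[THEN iffD1, rotated]) (auto simp: indicator_def)
  qed
  also have "\<dots> = (\<integral>\<^sup>+t. ennreal (indicator {0..} t * (\<phi> t * (1 - cdf Z t))) \<partial>lborel)"
  proof (rule nn_integral_cong)
    fix t
    have "emeasure Z {t<..} = ennreal (measure Z (space Z - {..t}))"
      by (simp add: Z.emeasure_eq_measure) (rule arg_cong[of _ _ "measure Z"], auto)
    also have "\<dots> = ennreal (1 - cdf Z t)" by (subst Z.prob_compl) (auto simp: cdf_def)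
    finally have tail: "emeasure Z {t<..} = ennreal (1 - cdf Z t)" .
    show "(\<integral>\<^sup>+z. ennreal (\<phi> t) * indicator {0..<z} t \<partial>Z) = ennreal (indicator {0..} t * (\<phi> t * (1 - cdf Z t)))"
    proof (cases "0 \<le> t")
      case True
      then have "(\<integral>\<^sup>+z. ennreal (\<phi> t) * indicator {0..<z} t \<partial>Z) = (\<integral>\<^sup>+z. ennreal (\<phi> t) * indicator {t<..} z \<partial>Z)"
        by (intro nn_integral_cong) (simp add: indicator_def)
      also have "\<dots> = ennreal (\<phi> t) * ennreal (1 - cdf Z t)"
        by (subst nn_integral_cmult) (simp_all add: tail)
      also have "\<dots> = ennreal (\<phi> t * (1 - cdf Z t))"
        using True \<phi>_nonneg by (simp add: ennreal_mult Z.cdf_bounded_prob)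
      finally show ?thesis using True by simp
    qed simp
  qed
  finally show ?thesis .
qed

lemma nn_integral_indicator_atLeastLessThan:
  assumes "0 \<le> z" shows "(\<integral>\<^sup>+t. ennreal 1 * indicator {0..<z} t \<partial>lborel) = ennreal z"
  using assms by simp

lemma nn_integral_capped_rate:
  assumes r: "0 < r" and z: "0 \<le> z"
  shows "(\<integral>\<^sup>+t. ennreal (capped_rate r m t) * indicator {0..<z} t \<partial>lborel) = ennreal (capped_mean r m z)"
proof -
  have "(\<integral>\<^sup>+t. ennreal (capped_rate r m t) * indicator {0..<z} t \<partial>lborel)
      = (\<integral>\<^sup>+t. ennreal (capped_rate r m t) * indicator {0..z} t \<partial>lborel)"
  proof (rule nn_integral_cong_AE)
    show "AE t in lborel. ennreal (capped_rate r m t) * indicator {0..<z} t = ennreal (capped_rate r m t) * indicator {0..z} t"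
      using AE_lborel_singleton[of z] by eventually_elim (auto simp: indicator_def)
  qed
  also have "\<dots> = ennreal (capped_mean r m z - capped_mean r m 0)"
    using r z by (intro nn_integral_FTC_Icc DERIV_capped_mean) (auto intro: capped_rate_nonneg DERIV_subset[OF DERIV_capped_mean])
  finally show ?thesis by simp
qed

lemma integrable_capped_mean:
  assumes Z: "real_distribution Z" "AE z in Z. 0 \<le> z" and r: "0 < r"
  shows "integrable Z (capped_mean r m)"
proof -
  interpret Z: real_distribution Z by fact
  have "AE z in Z. \<bar>capped_mean r m z\<bar> \<le> real m"
    using Z(2) by eventually_elim (use capped_mean_bounds[OF r] in auto)
  then show ?thesis by (intro Z.integrable_const_bound[of _ "real m"]) auto
qed

text \<open>Both claims are the tail formula, with derivative 1 and \<open>capped_rate r m\<close>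
  respectively; the tail of \<open>Z\<close> is the mixture of the survival functions.\<close>

lemma (in absorbing_chain) mixture_expectations:
  assumes Z: "real_distribution Z" "AE z in Z. 0 \<le> z" and r: "0 < r"
    and a: "\<And>i. i \<le> k \<Longrightarrow> 0 \<le> a i" "(\<Sum>i\<le>k. a i) = 1"
    and cdf: "\<And>t. 0 \<le> t \<Longrightarrow> cdf Z t = (\<Sum>i\<le>k. a i * mexp k A t i k)"
  shows "(\<integral>\<^sup>+z. ennreal z \<partial>Z) = ennreal (\<Sum>i\<le>k. a i * mean_time i)"
    and "(\<integral>z. capped_mean r m z \<partial>Z) = (\<Sum>i\<le>k. a i * capped r i m)"
proof -
  have tail: "1 - cdf Z t = (\<Sum>i\<le>k. a i * surv i t)" if "0 \<le> t" for t
    using cdf[OF that] a(2) by (simp add: surv_def right_diff_distrib sum_subtractf)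
  have "(\<integral>\<^sup>+z. ennreal z \<partial>Z) = (\<integral>\<^sup>+t. ennreal (indicator {0..} t * (1 * (1 - cdf Z t))) \<partial>lborel)"
    by (rule nn_integral_tail[OF Z]) (use nn_integral_indicator_atLeastLessThan in auto)
  also have "\<dots> = (\<integral>\<^sup>+t. ennreal (\<Sum>i\<le>k. a i * (indicator {0..} t * surv i t)) \<partial>lborel)"
  proof (intro nn_integral_cong arg_cong[where f = ennreal])
    fix t :: real
    show "indicator {0..} t * (1 * (1 - cdf Z t)) = (\<Sum>i\<le>k. a i * (indicator {0..} t * surv i t))"
      by (cases "0 \<le> t") (simp_all add: tail)
  qed
  also have "\<dots> = ennreal (\<Sum>i\<le>k. a i * mean_time i)"
  proof -
    have hb: "has_bochner_integral lborel (\<lambda>t. \<Sum>i\<le>k. a i * (indicator {0..} t * surv i t)) (\<Sum>i\<le>k. a i * mean_time i)"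
      by (intro has_bochner_integral_sum has_bochner_integral_mult_right surv_integral) auto
    have "0 \<le> indicator {0..} t * surv i t" if "i \<le> k" for i and t :: real
      using surv_bounds[OF _ that, of t] by (cases "0 \<le> t") simp_all
    then have "0 \<le> (\<Sum>i\<le>k. a i * (indicator {0..} t * surv i t))" for t :: real
      by (auto intro!: sum_nonneg mult_nonneg_nonneg[OF a(1)])
    then show ?thesis
      using hb by (subst nn_integral_eq_integral) (auto simp: has_bochner_integral_iff)
  qed
  finally show "(\<integral>\<^sup>+z. ennreal z \<partial>Z) = ennreal (\<Sum>i\<le>k. a i * mean_time i)" .
  have "(\<integral>\<^sup>+z. ennreal (capped_mean r m z) \<partial>Z) = (\<integral>\<^sup>+t. ennreal (indicator {0..} t * (capped_rate r m t * (1 - cdf Z t))) \<partial>lborel)"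
    by (rule nn_integral_tail[OF Z]) (use nn_integral_capped_rate[OF r] capped_rate_nonneg r in auto)
  also have "\<dots> = (\<integral>\<^sup>+t. ennreal (\<Sum>i\<le>k. a i * (indicator {0..} t * (capped_rate r m t * surv i t))) \<partial>lborel)"
  proof (intro nn_integral_cong arg_cong[where f = ennreal])
    fix t :: real
    show "indicator {0..} t * (capped_rate r m t * (1 - cdf Z t)) = (\<Sum>i\<le>k. a i * (indicator {0..} t * (capped_rate r m t * surv i t)))"
      by (cases "0 \<le> t") (simp_all add: tail sum_distrib_left mult_ac)
  qed
  also have "\<dots> = ennreal (\<Sum>i\<le>k. a i * capped r i m)"
  proof -
    have hb: "has_bochner_integral lborel (\<lambda>t. \<Sum>i\<le>k. a i * (indicator {0..} t * (capped_rate r m t * surv i t))) (\<Sum>i\<le>k. a i * capped r i m)"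
      unfolding capped_def
      by (intro has_bochner_integral_sum has_bochner_integral_mult_right has_bochner_integral_integrable capped_integrable r) auto
    have "0 \<le> indicator {0..} t * (capped_rate r m t * surv i t)" if "i \<le> k" for i and t :: real
      using surv_bounds[OF _ that, of t] capped_rate_nonneg[OF less_imp_le[OF r], of t m] by (cases "0 \<le> t") simp_all
    then have "0 \<le> (\<Sum>i\<le>k. a i * (indicator {0..} t * (capped_rate r m t * surv i t)))" for t :: real
      by (auto intro!: sum_nonneg mult_nonneg_nonneg[OF a(1)])
    then show ?thesis
      using hb by (subst nn_integral_eq_integral) (auto simp: has_bochner_integral_iff)
  qed
  finally have nn: "(\<integral>\<^sup>+z. ennreal (capped_mean r m z) \<partial>Z) = ennreal (\<Sum>i\<le>k. a i * capped r i m)" .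
  have "0 \<le> capped r i m" if "i \<le> k" for i
    unfolding capped_def using surv_bounds that capped_rate_nonneg[OF less_imp_le[OF r]]
    by (intro Bochner_Integration.integral_nonneg) (simp add: indicator_def)
  then have "0 \<le> (\<Sum>i\<le>k. a i * capped r i m)" using a by (intro sum_nonneg mult_nonneg_nonneg) auto
  moreover have "AE z in Z. 0 \<le> capped_mean r m z"
    using Z(2) by eventually_elim (rule capped_mean_bounds[OF r])
  ultimately have "has_bochner_integral Z (capped_mean r m) (\<Sum>i\<le>k. a i * capped r i m)"
    using nn integrable_capped_mean[OF Z r, of m] by (intro has_bochner_integral_nn_integral) auto
  then show "(\<integral>z. capped_mean r m z \<partial>Z) = (\<Sum>i\<le>k. a i * capped r i m)"
    by (simp add: has_bochner_integral_iff)
qed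

text \<open>With the states sorted by their mean absorption times \<open>h\<close>, the chain that descends through all
  states below the current one, spending exponential times with means \<open>h\<^sub>r - h\<^sub>r\<^sub>-\<^sub>1\<close>, dominates.\<close>

lemma (in absorbing_chain) capped_le_erlang:
  assumes k: "0 < k" and r: "0 < r" and i: "i \<le> k"
  shows "capped r i m \<le> (\<integral>y. capped_mean r m (mean_time i * (\<Sum>l<k. y l)) \<partial>(\<Pi>\<^sub>M i\<in>(UNIV :: nat set). density lborel (exponential_density (real k))))"
proof -
  define xs where "xs = sort_key mean_time [0..<Suc k]"
  have len: "length xs = Suc k" and set_xs: "set xs = {..k}" and sorted: "sorted (map mean_time xs)"
    by (auto simp: xs_def)
  define h where "h s = mean_time (xs ! s)" for s
  have xs_le: "xs ! s \<le> k" if "s \<le> k" for s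
    using nth_mem[of s xs] that len set_xs by auto
  have h_mono: "h s \<le> h s'" if "s \<le> s'" "s' \<le> k" for s s'
    using sorted_nth_mono[OF sorted, of s s'] that len by (simp add: h_def)
  have "\<exists>s\<le>k. xs ! s = i" if "i \<le> k" for i
    using that set_xs len in_set_conv_nth[of i xs] by (auto simp: less_Suc_eq_le)
  then obtain rank where rank: "\<And>i. i \<le> k \<Longrightarrow> rank i \<le> k" "\<And>i. i \<le> k \<Longrightarrow> xs ! rank i = i" by metis
  have h_rank: "h (rank i) = mean_time i" if "i \<le> k" for i using rank(2)[OF that] by (simp add: h_def)
  \<comment> \<open>The absorbing state has mean time 0, so the lowest level is 0 and every level is
    the sum of the phase means below it.\<close>
  have h0: "h 0 = 0"
  proof (rule antisym)
    show "h 0 \<le> 0" using h_mono[of 0 "rank k"] rank(1)[of k] h_rank[of k] mean_time_absorbed by simp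
    show "0 \<le> h 0" unfolding h_def by (intro mean_time_nonneg xs_le) simp
  qed
  \<comment> \<open>The factor \<open>real k\<close> compensates the rate of the variables, so that
    phase \<open>l\<close> has mean \<open>h (Suc l) - h l\<close>.\<close>
  define d where "d l = (if l < k then real k * (h (Suc l) - h l) else 0)" for l
  have d_nonneg: "0 \<le> d l" for l using h_mono[of l "Suc l"] by (simp add: d_def)
  have d_sum: "(\<Sum>l<s. d l / real k) = h s" if "s \<le> k" for s
  proof -
    have "(\<Sum>l<s. d l / real k) = (\<Sum>l<s. h (Suc l) - h l)" using that k by (intro sum.cong) (auto simp: d_def)
    then show ?thesis using h0 by (simp add: sum_lessThan_telescope)
  qed
  interpret E: exponential_phases "real k" r d by unfold_locales (use k r d_nonneg in auto)
  have le: "capped r i m \<le> E.U m (rank i)"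
  proof (rule capped_le_supersolution[OF r, of "\<lambda>m i. E.U m (rank i)"])
    fix m i assume i: "i < k"
    have "(\<Sum>l\<le>k. A i l * E.U (Suc m) (rank l)) = (\<Sum>l\<le>k. A i l * (E.U (Suc m) (rank l) - E.U (Suc m) (rank i)))"
      using row_sum[of i] i by (simp add: right_diff_distrib sum_subtractf sum_distrib_right[symmetric])
    \<comment> \<open>Off the diagonal the rates are nonnegative, so the tangent at
      \<open>mean_time i\<close> bounds every increment from above.\<close>
    also have "\<dots> \<le> (\<Sum>l\<le>k. A i l * ((mean_time l - mean_time i) * E.V (Suc m) (rank i)))"
    proof (rule sum_mono)
      fix l assume l: "l \<in> {..k}"
      show "A i l * (E.U (Suc m) (rank l) - E.U (Suc m) (rank i)) \<le> A i l * ((mean_time l - mean_time i) * E.V (Suc m) (rank i))"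
      proof (cases "l = i")
        case False
        have "E.U (Suc m) (rank l) - E.U (Suc m) (rank i) \<le> (mean_time l - mean_time i) * E.V (Suc m) (rank i)"
          using E.U_le_tangent[of "Suc m" "rank l" "rank i"] d_sum[OF rank(1)] h_rank l i by simp
        then show ?thesis using offdiag[of i l] False l i by (intro mult_left_mono) auto
      qed simp
    qed
    also have "\<dots> = ((\<Sum>l\<le>k. A i l * mean_time l) - (\<Sum>l\<le>k. A i l) * mean_time i) * E.V (Suc m) (rank i)"
      by (simp only: left_diff_distrib right_diff_distrib sum_subtractf sum_distrib_right mult.assoc)
    \<comment> \<open>The generator maps the mean absorption times to -1, so what remains exactly
      cancels the arrival term, which by \<open>E.V_eq\<close> is
      \<open>E.V (Suc m) (rank i)\<close>.\<close>
    also have "\<dots> = - E.V (Suc m) (rank i)" using mean_time_eq[OF i] row_sum[of i] i by simp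
    finally show "r * (1 + E.U m (rank i) - E.U (Suc m) (rank i)) + (\<Sum>l\<le>k. A i l * E.U (Suc m) (rank l)) \<le> 0"
      unfolding E.V_eq by simp
  qed (use E.U_nonneg i in auto)
  \<comment> \<open>From level \<open>rank i\<close> only the lower phases are run; zero weights
    fill them up to \<open>k\<close> phases, the number over which the symmetrisation
    averages.\<close>
  define d' where "d' l = (if l < rank i then d l else 0)" for l
  interpret E': exponential_phases "real k" r d' by unfold_locales (use k r d_nonneg in \<open>auto simp: d'_def\<close>)
  have split: "(\<Sum>l<k. if l < rank i then f l else 0) = (\<Sum>l<rank i. f l)" for f :: "nat \<Rightarrow> real"
  proof -
    have "{..<k} \<inter> {l. l < rank i} = {..<rank i}" using rank(1)[OF i] by auto
    then show ?thesis by (simp add: sum.If_cases)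
  qed
  have "E'.tot k y = E.tot (rank i) y" for y
    unfolding E'.tot_def E.tot_def split[symmetric] by (intro sum.cong) (auto simp: d'_def)
  then have "E.U m (rank i) = E'.U m k" by (simp add: E.U_def E'.U_def)
  also have "\<dots> \<le> (\<integral>y. capped_mean r m ((\<Sum>l<k. d' l) / real k * (\<Sum>l<k. y l)) \<partial>E.W)"
    by (rule E'.U_le_equal_weights[OF k])
  also have "(\<Sum>l<k. d' l) / real k = mean_time i"
    using d_sum[OF rank(1)[OF i]] h_rank[OF i] by (simp add: d'_def split sum_divide_distrib)
  finally show ?thesis using le by simp
qed

theorem phase_type_capped_mean_le:
  assumes k: "1 \<le> k" and r: "0 < r" and Z: "mean_one_job_size Z" and pt: "phase_type k Z"
  shows "(\<integral>z. capped_mean r m z \<partial>Z) \<le> (\<integral>z. capped_mean r m z \<partial>erlang_size k)"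
proof -
  obtain Q a where Q: "rate_matrix k Q" "\<forall>i<k. transient_state Q i" "absorbing_state k Q k"
    and a: "\<forall>i\<le>k. 0 \<le> a i" "(\<Sum>i\<le>k. a i) = 1"
    and cdf: "\<forall>t. cdf Z t = (if t < 0 then 0 else \<Sum>i\<le>k. a i * transition_prob Q t i k)"
    using pt unfolding phase_type_def by blast
  define A where "A i j = Q $$ (i, j)" for i j
  have mexp: "transition_prob Q t i j = mexp k A t i j" if "i \<le> k" "j \<le> k" for t i j
    using transition_prob_eq_mexp[OF Q(1) that] by (simp add: A_def[abs_def])
  interpret absorbing_chain k A
  proof
    fix i assume i: "i < k"
    have "(\<lambda>t. transition_prob Q t i i) = (\<lambda>t. mexp k A t i i)" using mexp[of i i] i by (intro ext) simp
    then show "set_integrable lborel {0..} (\<lambda>t. mexp k A t i i)"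
      using Q(2)[rule_format, OF i] by (simp only: transient_state_def)
  qed (use Q in \<open>auto simp: rate_matrix_def absorbing_state_def A_def\<close>)
  have Z': "real_distribution Z" "AE z in Z. 0 \<le> z" "integrable Z (\<lambda>z. z)" "(\<integral>z. z \<partial>Z) = 1"
    using Z by (auto simp: mean_one_job_size_def)
  note exps = mixture_expectations[OF Z'(1,2) r, of a]
  have cdf': "cdf Z t = (\<Sum>i\<le>k. a i * mexp k A t i k)" if "0 \<le> t" for t
    using cdf that by (simp add: mexp)
  have "(\<integral>\<^sup>+z. ennreal z \<partial>Z) = ennreal 1"
    using nn_integral_eq_integral[OF Z'(3,2)] Z'(4) by simp
  then have "ennreal 1 = ennreal (\<Sum>i\<le>k. a i * mean_time i)" using exps(1)[OF _ _ cdf'] a by simp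
  then have mean: "(\<Sum>i\<le>k. a i * mean_time i) = 1"
    using a by (subst (asm) ennreal_inj) (auto intro!: sum_nonneg mult_nonneg_nonneg mean_time_nonneg)
  let ?W = "\<Pi>\<^sub>M i\<in>(UNIV :: nat set). density lborel (exponential_density (real k))"
  \<comment> \<open>This instance supplies the space \<open>E.W\<close> of independent exponential
    variables of rate \<open>k\<close>.\<close>
  interpret E: exponential_phases "real k" r "\<lambda>_. 0" by unfold_locales (use k r in auto)
  have sum_meas [measurable]: "(\<lambda>y. \<Sum>l<k. y l) \<in> borel_measurable E.W" by measurable
  have nonneg: "AE y in E.W. 0 \<le> (\<Sum>l<k. y l)"
    using E.AE_nonneg by eventually_elim (auto intro: sum_nonneg)
  have int: "integrable E.W (\<lambda>y. capped_mean r m (x * (\<Sum>l<k. y l)))" if "0 \<le> x" for x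
  proof -
    have "AE y in E.W. \<bar>capped_mean r m (x * (\<Sum>l<k. y l))\<bar> \<le> real m"
      using nonneg by eventually_elim (use capped_mean_bounds[OF r] that in auto)
    then show ?thesis by (intro E.W.integrable_const_bound[of _ "real m"]) auto
  qed
  have "(\<integral>z. capped_mean r m z \<partial>Z) = (\<Sum>i\<le>k. a i * capped r i m)" using exps(2)[OF _ _ cdf'] a by simp
  also have "\<dots> \<le> (\<Sum>i\<le>k. a i * (\<integral>y. capped_mean r m (mean_time i * (\<Sum>l<k. y l)) \<partial>E.W))"
    using a k by (intro sum_mono mult_left_mono capped_le_erlang r) auto
  also have "\<dots> = (\<integral>y. (\<Sum>i\<le>k. a i * capped_mean r m (mean_time i * (\<Sum>l<k. y l))) \<partial>E.W)"
    using int[OF mean_time_nonneg] by simp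
  also have "\<dots> \<le> (\<integral>y. capped_mean r m (1 * (\<Sum>l<k. y l)) \<partial>E.W)"
  proof (rule integral_mono_AE)
    show "integrable E.W (\<lambda>y. \<Sum>i\<le>k. a i * capped_mean r m (mean_time i * (\<Sum>l<k. y l)))"
      by (intro Bochner_Integration.integrable_sum integrable_mult_right int mean_time_nonneg) simp
    show "AE y in E.W. (\<Sum>i\<le>k. a i * capped_mean r m (mean_time i * (\<Sum>l<k. y l))) \<le> capped_mean r m (1 * (\<Sum>l<k. y l))"
      using nonneg
    proof eventually_elim
      fix y :: "nat \<Rightarrow> real" assume y: "0 \<le> (\<Sum>l<k. y l)"
      have "- capped_mean r m (\<Sum>i\<le>k. a i *\<^sub>R (mean_time i * (\<Sum>l<k. y l))) \<le> (\<Sum>i\<le>k. a i * - capped_mean r m (mean_time i * (\<Sum>l<k. y l)))"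
        using a y mean_time_nonneg r by (intro convex_on_sum[OF _ _ concave_capped_mean]) auto
      moreover have "(\<Sum>i\<le>k. a i *\<^sub>R (mean_time i * (\<Sum>l<k. y l))) = 1 * (\<Sum>l<k. y l)"
        unfolding mean[symmetric] sum_distrib_right by (simp add: mult.assoc)
      ultimately show "(\<Sum>i\<le>k. a i * capped_mean r m (mean_time i * (\<Sum>l<k. y l))) \<le> capped_mean r m (1 * (\<Sum>l<k. y l))"
        by (simp add: sum_negf)
    qed
  qed (rule int, simp)
  also have "\<dots> = (\<integral>z. capped_mean r m z \<partial>distr E.W borel (\<lambda>y. \<Sum>l<k. y l))"
    by (subst integral_distr) simp_all
  also have "distr E.W borel (\<lambda>y. \<Sum>l<k. y l) = erlang_size k"
    unfolding erlang_size_def using E.sum_erlang k by simp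
  finally show ?thesis .
qed

section \<open>Erlang job sizes\<close>

lemma real_distribution_erlang:
  assumes "1 \<le> k"
  shows "real_distribution (erlang_size k)"
proof -
  interpret prob_space "erlang_size k"
    unfolding erlang_size_def using assms by (intro prob_space_erlang_density) simp
  show ?thesis by unfold_locales (simp_all add: erlang_size_def)
qed

lemma AE_erlang_nonneg: "AE x in erlang_size k. 0 \<le> x"
  unfolding erlang_size_def by (subst AE_density) (auto simp: erlang_density_def)

lemma mean_one_erlang:
  assumes k: "1 \<le> k"
  shows "mean_one_job_size (erlang_size k)"
proof -
  have k0: "0 < real k" using k by simp
  have "(\<integral>\<^sup>+x. ennreal x \<partial>erlang_size k) = (\<integral>\<^sup>+x. ennreal (erlang_density (k - 1) (real k) x) * ennreal x \<partial>lborel)"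
    unfolding erlang_size_def by (rule nn_integral_density) simp_all
  also have "\<dots> = (\<integral>\<^sup>+x. ennreal (erlang_density (k - 1) (real k) x * x ^ 1) \<partial>lborel)"
    using k0 by (intro nn_integral_cong) (simp add: ennreal_mult'[symmetric])
  also have "\<dots> = ennreal (fact (k - 1 + 1) / (fact (k - 1) * real k ^ 1))"
    by (rule nn_integral_erlang_ith_moment[OF k0])
  also have "fact (k - 1 + 1) / (fact (k - 1) * real k ^ 1) = (1 :: real)"
    using k by (cases k) simp_all
  finally have "has_bochner_integral (erlang_size k) (\<lambda>x. x) 1"
    using AE_erlang_nonneg[of k] by (intro has_bochner_integral_nn_integral) (auto simp: erlang_size_def)
  then show ?thesis
    using real_distribution_erlang[OF k] AE_erlang_nonneg
    by (simp add: mean_one_job_size_def has_bochner_integral_iff)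
qed

text \<open>For the Erlang chain uniformized at its own rate every event leads to the next phase, so
  the powers are shifts that stop at \<open>k\<close>.\<close>

lemma mpow_shift:
  assumes R: "\<And>i j. i \<le> k \<Longrightarrow> j \<le> k \<Longrightarrow> R i j = (if j = min (Suc i) k then 1 else 0)"
  shows "i \<le> k \<Longrightarrow> j \<le> k \<Longrightarrow> mpow k R n i j = (if j = min (i + n) k then 1 else 0)"
proof (induction n arbitrary: j)
  case (Suc n)
  have "mpow k R (Suc n) i j = (\<Sum>l\<le>k. if l = min (i + n) k then R l j else 0)"
    unfolding mpow.simps using Suc by (intro sum.cong refl) simp
  also have "\<dots> = R (min (i + n) k) j" by (simp add: sum.delta)
  also have "\<dots> = (if j = min (i + Suc n) k then 1 else 0)"
    using Suc.prems by (subst R) (auto simp: min_def)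
  finally show ?case .
qed auto

definition erlang_rates :: "nat \<Rightarrow> real mat" where
  "erlang_rates k = mat (k + 1) (k + 1) (\<lambda>(i, j). if i < k then if j = i then - real k else if j = Suc i then real k else 0 else 0)"

lemma erlang_rates_index:
  "i \<le> k \<Longrightarrow> j \<le> k \<Longrightarrow> erlang_rates k $$ (i, j) = (if i < k then if j = i then - real k else if j = Suc i then real k else 0 else 0)"
  by (simp add: erlang_rates_def)

lemma rate_matrix_erlang: "rate_matrix k (erlang_rates k)"
  unfolding rate_matrix_def
proof (intro conjI allI impI)
  show "erlang_rates k \<in> carrier_mat (k + 1) (k + 1)" by (simp add: erlang_rates_def)
  fix i assume i: "i \<le> k"
  show "(\<Sum>j\<le>k. erlang_rates k $$ (i, j)) = 0"
  proof (cases "i < k")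
    case True
    have "(\<Sum>j\<le>k. erlang_rates k $$ (i, j)) = (\<Sum>j\<le>k. (if j = i then - real k else 0) + (if j = Suc i then real k else 0))"
      using True by (intro sum.cong refl) (auto simp: erlang_rates_index)
    then show ?thesis using True by (simp add: sum.distrib sum.delta)
  qed (use i in \<open>simp add: erlang_rates_index\<close>)
qed (auto simp: erlang_rates_index)

lemma transition_prob_erlang_sums:
  assumes k: "1 \<le> k" and ij: "i \<le> k" "j \<le> k"
  shows "(\<lambda>n. exp (- (real k * t)) * ((real k * t) ^ n / fact n * (if j = min (i + n) k then 1 else 0))) sums
    transition_prob (erlang_rates k) t i j"
proof -
  let ?A = "\<lambda>i j. erlang_rates k $$ (i, j)"
  have "unif (real k) ?A i j = (if j = min (Suc i) k then 1 else 0)" if "i \<le> k" "j \<le> k" for i j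
    using that k by (auto simp: unif_def erlang_rates_index min_def)
  then have "mpow k (unif (real k) ?A) n i j = (if j = min (i + n) k then 1 else 0)" for n
    using ij by (intro mpow_shift) auto
  then show ?thesis
    using mexp_unif[of "real k" i k j t ?A] k ij transition_prob_eq_mexp[OF rate_matrix_erlang ij]
    by simp
qed

lemma transition_prob_erlang_diag:
  assumes "i < k"
  shows "transition_prob (erlang_rates k) t i i = exp (- (real k * t))"
proof -
  have "(\<lambda>n. exp (- (real k * t)) * ((real k * t) ^ n / fact n * (if i = min (i + n) k then 1 else 0))) sums
      transition_prob (erlang_rates k) t i i"
    using assms by (intro transition_prob_erlang_sums) auto
  moreover have "(\<lambda>n. exp (- (real k * t)) * ((real k * t) ^ n / fact n * (if i = min (i + n) k then 1 else 0)))
      = (\<lambda>n. if n = 0 then exp (- (real k * t)) else 0)"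
    using assms by (auto simp: min_def)
  ultimately have "(\<lambda>n. if n = 0 then exp (- (real k * t)) else 0) sums transition_prob (erlang_rates k) t i i" by simp
  then show ?thesis using sums_single[of 0 "\<lambda>_. exp (- (real k * t))"] sums_unique2 by blast
qed

text \<open>Absorption by time \<open>t\<close> means at least \<open>k\<close> Poisson events of
  rate \<open>k\<close>; the complement gives the finite sum in \<open>erlang_CDF\<close>.\<close>

lemma transition_prob_erlang_absorbed:
  assumes k: "1 \<le> k" and t: "0 \<le> t"
  shows "transition_prob (erlang_rates k) t 0 k = erlang_CDF (k - 1) (real k) t"
proof -
  define f where "f n = exp (- (real k * t)) * ((real k * t) ^ n /\<^sub>R fact n)" for n
  have "f sums (exp (- (real k * t)) * exp (real k * t))" unfolding f_def by (intro sums_mult exp_converges)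
  then have "f sums 1" by (simp add: mult_exp_exp)
  moreover have "(\<lambda>n. if n \<in> {..k - 1} then f n else 0) sums (\<Sum>n\<in>{..k - 1}. f n)"
    by (rule sums_If_finite_set) simp
  ultimately have "(\<lambda>n. f n - (if n \<in> {..k - 1} then f n else 0)) sums (1 - (\<Sum>n\<in>{..k - 1}. f n))"
    by (rule sums_diff)
  moreover have "f n - (if n \<in> {..k - 1} then f n else 0) = exp (- (real k * t)) * ((real k * t) ^ n / fact n * (if k = min (0 + n) k then 1 else 0))" for n
    using k by (auto simp: f_def min_def divide_inverse)
  ultimately have "(\<lambda>n. exp (- (real k * t)) * ((real k * t) ^ n / fact n * (if k = min (0 + n) k then 1 else 0))) sums (1 - (\<Sum>n\<le>k - 1. f n))"
    by simp
  then have "transition_prob (erlang_rates k) t 0 k = 1 - (\<Sum>n\<le>k - 1. f n)"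
    using transition_prob_erlang_sums[OF k, of 0 k t] sums_unique2 by blast
  also have "\<dots> = erlang_CDF (k - 1) (real k) t"
    using t by (simp add: erlang_CDF_def f_def divide_inverse mult_ac)
  finally show ?thesis .
qed

text \<open>The chain starts in phase 0 and leaves each of its \<open>k\<close> phases at rate
  \<open>k\<close>.\<close>

lemma phase_type_erlang:
  assumes k: "1 \<le> k"
  shows "phase_type k (erlang_size k)"
  unfolding phase_type_def
proof (intro conjI exI)
  show "real_distribution (erlang_size k)" by (rule real_distribution_erlang[OF k])
  show "rate_matrix k (erlang_rates k)" by (rule rate_matrix_erlang)
  show "\<forall>i<k. transient_state (erlang_rates k) i"
  proof (intro allI impI)
    fix i assume i: "i < k"
    have "integrable lborel (\<lambda>t. exponential_density (real k) t * 1)"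
    proof -
      have "has_bochner_integral lborel (exponential_density (real k)) 1"
        using k nn_integral_erlang_density_eq_1[of "real k" 0]
        by (intro has_bochner_integral_nn_integral) auto
      then show ?thesis by (simp add: has_bochner_integral_iff)
    qed
    then have "integrable lborel (\<lambda>t. (1 / real k) * exponential_density (real k) t)" by simp
    moreover have "(1 / real k) * exponential_density (real k) t = indicator {0..} t *\<^sub>R transition_prob (erlang_rates k) t i i" for t
      using k i by (simp add: exponential_density_def transition_prob_erlang_diag indicator_def mult.commute)
    ultimately show "transient_state (erlang_rates k) i"
      by (simp add: transient_state_def set_integrable_def)
  qed
  show "absorbing_state k (erlang_rates k) k" by (simp add: absorbing_state_def erlang_rates_index)
  show "\<forall>i\<le>k. 0 \<le> (if i = 0 then 1 else 0 :: real)" by simp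
  show "(\<Sum>i\<le>k. if i = 0 then 1 else 0 :: real) = 1" by (simp add: sum.delta)
  show "\<forall>t. cdf (erlang_size k) t = (if t < 0 then 0 else \<Sum>i\<le>k. (if i = 0 then 1 else 0) * transition_prob (erlang_rates k) t i k)"
  proof
    fix t
    have "cdf (erlang_size k) t = erlang_CDF (k - 1) (real k) t"
      using emeasure_erlang_density[of "real k" "k - 1" t] k
      by (simp add: cdf_def measure_def erlang_size_def)
    moreover have "(\<Sum>i\<le>k. (if i = 0 then 1 else 0) * transition_prob (erlang_rates k) t i k)
        = (\<Sum>i\<le>k. if i = 0 then transition_prob (erlang_rates k) t i k else 0)"
      by (intro sum.cong) auto
    ultimately show "cdf (erlang_size k) t = (if t < 0 then 0 else \<Sum>i\<le>k. (if i = 0 then 1 else 0) * transition_prob (erlang_rates k) t i k)"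
      using transition_prob_erlang_absorbed[OF k, of t] by (auto simp: sum.delta erlang_CDF_def)
  qed
qed

section \<open>The queue at the cavity\<close>

text \<open>The arrival tail after rescaling time by \<open>1 - p\<close>: service times
  \<open>Z / (1 - p)\<close> at arrival rate \<open>lam\<close> see as many arrivals as job sizes
  \<open>Z\<close> at rate \<open>lam / (1 - p)\<close>.\<close>

definition job_tail :: "real \<Rightarrow> real measure \<Rightarrow> nat \<Rightarrow> real" where
  "job_tail r Z l = (\<integral>z. erlang_CDF l r z \<partial>Z)"

text \<open>Of \<open>Suc m\<close> places \<open>m\<close> are behind the first job, whence the
  index shift against \<open>served\<close>.\<close>

lemma P0_eq:
  assumes "0 < lam" "p < 1" and Z: "mean_one_job_size Z"
  shows "P0 lam p Z (Suc m) = 1 / (1 + lam / (1 - p) * served (job_tail (lam / (1 - p)) Z) m)"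
proof -
  define S where "S = distr Z borel (\<lambda>x. x / (1 - p))"
  have Z': "real_distribution Z" "AE z in Z. 0 \<le> z" "integrable Z (\<lambda>z. z)" "(\<integral>z. z \<partial>Z) = 1"
    using Z by (auto simp: mean_one_job_size_def)
  interpret Z: real_distribution Z by fact
  have scale: "(\<lambda>x. x / (1 - p)) \<in> measurable Z borel" by simp
  interpret S: prob_space S unfolding S_def by (rule Z.prob_space_distr[OF scale])
  interpret mg1n lam S "Suc m"
  proof
    show "AE x in S. 0 \<le> x" unfolding S_def using Z'(2) assms(2)
      by (subst AE_distr_iff[OF scale]) (auto elim!: eventually_mono)
    have "integrable Z (\<lambda>z. z / (1 - p))" using Z'(3) by (rule integrable_divide)
    then show "integrable S (\<lambda>x. x)"
      unfolding S_def by (simp add: integrable_distr_eq[OF scale])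
    show "0 < lam" by fact
    show "sets S = sets borel" by (simp add: S_def)
    show "1 \<le> Suc m" by simp
  qed
  have "mu = 1 / (1 - p)"
    unfolding mu_def unfolding S_def by (simp add: integral_distr[OF scale] Z'(4))
  moreover have "arrivals_tail = job_tail (lam / (1 - p)) Z"
  proof
    fix l
    have "erlang_CDF l lam (z / (1 - p)) = erlang_CDF l (lam / (1 - p)) z" for z
      using assms by (simp add: erlang_CDF_def divide_less_0_iff)
    then show "arrivals_tail l = job_tail (lam / (1 - p)) Z l"
      unfolding arrivals_tail_def job_tail_def unfolding S_def by (simp add: integral_distr[OF scale])
  qed
  ultimately show ?thesis
    using MG1n_empty_prob_eq by (simp add: P0_def S_def)
qed

context
  fixes r :: real and Z :: "real measure"
  assumes r: "0 < r" and Z: "mean_one_job_size Z"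
begin

interpretation Z: real_distribution Z using Z by (simp add: mean_one_job_size_def)

lemma job_nonneg: "AE z in Z. 0 \<le> z" and job_int: "integrable Z (\<lambda>z. z)" and job_mean: "(\<integral>z. z \<partial>Z) = 1"
  using Z by (auto simp: mean_one_job_size_def)

lemma job_tail_eq: "job_tail r Z = service_law.arrivals_tail r Z"
proof
  interpret service_law r Z by unfold_locales (use r in auto)
  show "job_tail r Z l = arrivals_tail l" for l by (simp add: job_tail_def arrivals_tail_def)
qed

lemma job_tail_0: "job_tail r Z 0 < 1" and job_tail_nonneg: "0 \<le> job_tail r Z l"
proof -
  interpret service_law r Z by unfold_locales (use r in auto)
  show "job_tail r Z 0 < 1" "0 \<le> job_tail r Z l" unfolding job_tail_eq by (rule arrivals_tail_0_less_1, rule arrivals_tail_nonneg)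
qed

lemma sum_job_tail: "(\<Sum>l<m. job_tail r Z l) = (\<integral>z. capped_mean r m z \<partial>Z)"
proof -
  interpret service_law r Z by unfold_locales (use r in auto)
  have "(\<Sum>l<m. job_tail r Z l) = (\<integral>z. (\<Sum>l<m. erlang_CDF l r z) \<partial>Z)"
    unfolding job_tail_def using erlang_CDF_int by simp
  also have "\<dots> = (\<integral>z. capped_mean r m z \<partial>Z)"
    using job_nonneg by (intro integral_cong_AE) (auto elim!: eventually_mono simp: capped_mean_eq_erlang_CDF)
  finally show ?thesis .
qed

text \<open>The tails sum to the mean number of arrivals, \<open>r\<close> times the mean job size
  1. The truncated means tend to \<open>r * z\<close>, which also dominates them.\<close>

lemma job_tail_sums: "job_tail r Z sums r"
proof -
  have rep: "has_bochner_integral lborel (\<lambda>t. capped_rate r m t * indicator {0..z} t) (capped_mean r m z)" if "0 \<le> z" for z m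
  proof -
    have cont: "isCont (capped_rate r m) t" for t
      by (cases m) (auto intro: DERIV_isCont[OF DERIV_capped_rate] simp: capped_rate_def[abs_def])
    have "has_bochner_integral lborel (\<lambda>t. capped_rate r m t * indicator {0..z} t) (capped_mean r m z - capped_mean r m 0)"
      using that by (intro has_bochner_integral_FTC_Icc_real DERIV_capped_mean cont) auto
    then show ?thesis by simp
  qed
  have le: "capped_mean r m z \<le> r * z" if "0 \<le> z" for z m
  proof -
    have "(\<integral>t. capped_rate r m t * indicator {0..z} t \<partial>lborel) \<le> (\<integral>t. r * indicator {0..z} t \<partial>lborel)"
    proof (rule integral_mono)
      show "integrable lborel (\<lambda>t. capped_rate r m t * indicator {0..z} t)"
        using rep[OF that] by (simp only: has_bochner_integral_iff)
      show "capped_rate r m t * indicator {0..z} t \<le> r * indicator {0..z} t" for t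
        using r by (auto simp: indicator_def intro: capped_rate_le)
    qed (intro integrable_mult_right integrable_real_indicator; simp add: that)
    then show ?thesis using rep[OF that, of m] that by (simp add: has_bochner_integral_iff)
  qed
  have lim: "(\<lambda>m. capped_mean r m z) \<longlonglongrightarrow> r * z" if z: "0 \<le> z" for z
  proof -
    have "(\<lambda>m. \<integral>t. capped_rate r m t * indicator {0..z} t \<partial>lborel) \<longlonglongrightarrow> (\<integral>t. r * indicator {0..z} t \<partial>lborel)"
    proof (rule integral_dominated_convergence[where w = "\<lambda>t. r * indicator {0..z} t"])
      show "AE t in lborel. (\<lambda>m. capped_rate r m t * indicator {0..z} t) \<longlonglongrightarrow> r * indicator {0..z} t"
      proof (rule AE_I2)
        fix t
        have "(\<lambda>a. (r * t) ^ a /\<^sub>R fact a) sums exp (r * t)" by (rule exp_converges)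
        then have "(\<lambda>m. r * exp (- (r * t)) * (\<Sum>a<m. (r * t) ^ a / fact a)) \<longlonglongrightarrow> r * exp (- (r * t)) * exp (r * t)"
          unfolding sums_def by (intro tendsto_intros) (simp add: divide_inverse mult.commute)
        then have "(\<lambda>m. capped_rate r m t) \<longlonglongrightarrow> r"
          by (simp add: capped_rate_def mult.assoc mult_exp_exp)
        then show "(\<lambda>m. capped_rate r m t * indicator {0..z} t) \<longlonglongrightarrow> r * indicator {0..z} t"
          by (rule tendsto_mult_right)
      qed
      show "AE t in lborel. norm (capped_rate r m t * indicator {0..z} t) \<le> r * indicator {0..z} t" for m
        using r capped_rate_le[of r _ m] capped_rate_nonneg[of r _ m] by (intro AE_I2) (auto simp: indicator_def)
      show "integrable lborel (\<lambda>t. r * indicator {0..z} t)"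
        by (intro integrable_mult_right integrable_real_indicator) (simp_all add: z)
    qed (use r in auto)
    moreover have "(\<integral>t. capped_rate r m t * indicator {0..z} t \<partial>lborel) = capped_mean r m z" for m
      using rep[OF z, of m] by (simp add: has_bochner_integral_iff)
    ultimately show ?thesis using z by simp
  qed
  have "(\<lambda>m. \<integral>z. capped_mean r m z \<partial>Z) \<longlonglongrightarrow> (\<integral>z. r * z \<partial>Z)"
  proof (rule integral_dominated_convergence[where w = "\<lambda>z. r * z"])
    show "AE z in Z. (\<lambda>m. capped_mean r m z) \<longlonglongrightarrow> r * z"
      using job_nonneg by eventually_elim (rule lim)
    show "AE z in Z. norm (capped_mean r m z) \<le> r * z" for m
      using job_nonneg by eventually_elim (use le capped_mean_bounds[OF r] in auto)
    show int: "integrable Z (\<lambda>z. r * z)" by (rule integrable_mult_right) (rule job_int)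
    show "(\<lambda>z. r * z) \<in> borel_measurable Z" by (rule borel_measurable_integrable[OF int])
    show "capped_mean r m \<in> borel_measurable Z" for m
      by (rule borel_measurable_integrable[OF integrable_capped_mean[OF Z.real_distribution_axioms job_nonneg r]])
  qed
  then show ?thesis
    unfolding sums_def sum_job_tail using job_mean by simp
qed

lemma sum_job_tail_le_deterministic: "(\<Sum>l<m. job_tail r Z l) \<le> capped_mean r m 1"
proof -
  have "(\<integral>z. capped_mean r m z \<partial>Z) \<le> (\<integral>z. capped_mean r m 1 + capped_rate r m 1 * (z - 1) \<partial>Z)"
  proof (rule integral_mono_AE)
    show "integrable Z (capped_mean r m)"
      by (rule integrable_capped_mean[OF Z.real_distribution_axioms job_nonneg r])
    show "AE z in Z. capped_mean r m z \<le> capped_mean r m 1 + capped_rate r m 1 * (z - 1)"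
      using job_nonneg by eventually_elim (use r in \<open>simp add: capped_mean_tangent\<close>)
  qed (use job_int in simp)
  also have "\<dots> = capped_mean r m 1 + capped_rate r m 1 * ((\<integral>z. z \<partial>Z) - 1)"
    using job_int by (simp add: Z.prob_space[simplified])
  finally show ?thesis unfolding sum_job_tail job_mean by simp
qed

end

lemma mean_one_deterministic: "mean_one_job_size deterministic_size"
proof -
  interpret prob_space deterministic_size unfolding deterministic_size_def by (rule prob_space_return) simp
  have "real_distribution deterministic_size"
    by unfold_locales (simp_all add: deterministic_size_def)
  moreover have "has_bochner_integral deterministic_size (\<lambda>x. x) (1 :: real)"
    unfolding deterministic_size_def
    by (rule has_bochner_integral_nn_integral) (auto simp: AE_return nn_integral_return)
  moreover have "AE x in deterministic_size. 0 \<le> x"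
    unfolding deterministic_size_def by (subst AE_return) auto
  ultimately show ?thesis
    by (simp add: mean_one_job_size_def has_bochner_integral_iff)
qed

lemma job_tail_deterministic:
  "job_tail r deterministic_size = (\<lambda>l. 1 - exp (- r) * (\<Sum>a\<le>l. r ^ a / fact a))"
proof
  fix l
  have "job_tail r deterministic_size l = erlang_CDF l r 1"
    unfolding job_tail_def deterministic_size_def by (rule integral_return) auto
  then show "job_tail r deterministic_size l = 1 - exp (- r) * (\<Sum>a\<le>l. r ^ a / fact a)"
    by (simp add: erlang_CDF_def sum_distrib_left mult.commute)
qed

text \<open>The probability of an empty queue decreases with the number of jobs per busy period,
  which increases with the partial sums.\<close>

lemma P0_le:
  assumes "0 < lam" "p < 1" "mean_one_job_size Z" "mean_one_job_size Z'"
    and le: "\<And>m. (\<Sum>l<m. job_tail (lam / (1 - p)) Z' l) \<le> (\<Sum>l<m. job_tail (lam / (1 - p)) Z l)"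
  shows "P0 lam p Z (Suc m) \<le> P0 lam p Z' (Suc m)"
proof -
  let ?r = "lam / (1 - p)"
  have r: "0 < ?r" using assms by simp
  note Z = job_tail_0[OF r assms(3)] job_tail_nonneg[OF r assms(3)]
  note Z' = job_tail_0[OF r assms(4)] job_tail_nonneg[OF r assms(4)]
  have "?r * served (job_tail ?r Z') m \<le> ?r * served (job_tail ?r Z) m"
    using r by (intro mult_left_mono served_le Z Z' le) auto
  moreover have "0 < 1 + ?r * served (job_tail ?r Z') m"
    using r served_ge_1[of "job_tail ?r Z'" m, OF Z'] by (intro add_pos_nonneg mult_nonneg_nonneg) auto
  ultimately show ?thesis
    unfolding P0_eq[OF assms(1,2,3)] P0_eq[OF assms(1,2,4)] by (intro divide_left_mono mult_pos_pos) auto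
qed

text \<open>Guarantees that the least index in \<open>max_queue_length\<close> exists.\<close>

lemma P0_eventually_small:
  assumes "0 < p" "p < lam" "lam < 1" "mean_one_job_size Z"
  shows "\<exists>m. P0 lam p Z (m + 1) < (1 - lam) / (1 - p)"
proof -
  \<comment> \<open>As \<open>(1 - p) / (1 - lam)\<close> equals \<open>1 + ?t\<close>, the bound on
    \<open>P0\<close> says that \<open>?r\<close> times \<open>served\<close> exceeds
    \<open>?t\<close>.\<close>
  let ?r = "lam / (1 - p)" and ?t = "(lam - p) / (1 - lam)"
  have r: "0 < ?r" using assms by simp
  note Z = job_tail_0[OF r assms(4)] job_tail_nonneg[OF r assms(4)]
  \<comment> \<open>The condition \<open>?t * (1 - ?r) < ?r\<close> of
    \<open>served_exceeds\<close>, with denominators cleared.\<close>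
  have "(lam - p) * (1 - p - lam) < lam * (1 - lam)"
  proof (cases "0 < 1 - p - lam")
    case True
    then show ?thesis using assms by (intro mult_strict_mono) auto
  next
    case False
    then have "(lam - p) * (1 - p - lam) \<le> 0" using assms by (intro mult_nonneg_nonpos) auto
    also have "0 < lam * (1 - lam)" using assms by (intro mult_pos_pos) auto
    finally show ?thesis .
  qed
  then have "(lam - p) * (1 - p - lam) / ((1 - lam) * (1 - p)) < lam * (1 - lam) / ((1 - lam) * (1 - p))"
    using assms by (intro divide_strict_right_mono mult_pos_pos) auto
  moreover have "?t * (1 - ?r) = (lam - p) * (1 - p - lam) / ((1 - lam) * (1 - p))"
    using assms by (simp add: field_simps)
  moreover have "?r = lam * (1 - lam) / ((1 - lam) * (1 - p))" using assms by simp
  ultimately have "?t * (1 - ?r) < ?r" by simp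
  then obtain m where m: "?t < ?r * served (job_tail ?r Z) m"
    using served_exceeds[of "job_tail ?r Z" ?r ?t, OF Z job_tail_sums[OF r assms(4)] r] by blast
  have "(1 - p) / (1 - lam) = 1 + ?t" using assms by (simp add: field_simps)
  then have "(1 - p) / (1 - lam) < 1 + ?r * served (job_tail ?r Z) m" using m by simp
  moreover have "0 < (1 - p) / (1 - lam)" using assms by (intro divide_pos_pos) auto
  ultimately have "1 / (1 + ?r * served (job_tail ?r Z) m) < 1 / ((1 - p) / (1 - lam))"
    by (intro divide_strict_left_mono mult_pos_pos) auto
  then show ?thesis using P0_eq[of lam p Z m] assms by (intro exI[of _ m]) simp
qed

lemma max_queue_length_le:
  assumes "0 < p" "p < lam" "lam < 1" "mean_one_job_size Z" "mean_one_job_size Z'"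
    and le: "\<And>m. (\<Sum>l<m. job_tail (lam / (1 - p)) Z' l) \<le> (\<Sum>l<m. job_tail (lam / (1 - p)) Z l)"
  shows "max_queue_length lam p Z \<le> max_queue_length lam p Z'"
proof -
  define m where "m = (LEAST m. P0 lam p Z' (m + 1) < (1 - lam) / (1 - p))"
  have "P0 lam p Z' (m + 1) < (1 - lam) / (1 - p)"
    unfolding m_def by (rule LeastI_ex) (rule P0_eventually_small[OF assms(1,2,3,5)])
  moreover have "P0 lam p Z (m + 1) \<le> P0 lam p Z' (m + 1)"
    using P0_le[OF _ _ assms(4,5) le, of m] assms by simp
  ultimately have "(LEAST m. P0 lam p Z (m + 1) < (1 - lam) / (1 - p)) \<le> m" by (intro Least_le) simp
  then show ?thesis by (simp add: max_queue_length_def m_def)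
qed

theorem proposition7p3:
  fixes lam p rho :: real
  assumes "0 < p" and "p < lam" and "lam < 1"
    and "rho = lam / (1 - p)"
  shows "is_arg_min (max_queue_length lam p) mean_one_job_size deterministic_size \<and>
    (\<forall>k\<ge>1. is_arg_min (max_queue_length lam p)
              (\<lambda>Z. mean_one_job_size Z \<and> phase_type k Z) (erlang_size k)) \<and>
    max_queue_length lam p deterministic_size =
      (LEAST n::nat.
        1 / (1 + rho * (\<Sum>k<n. (-1) ^ k / fact k * real (n - 1 - k) ^ k
                                 * exp (real (n - 1 - k) * rho) * rho ^ k))
          < (1 - lam) / (1 - p))"
proof (intro conjI allI impI)
  have rho: "0 < rho" using assms by simp
  have det_sum: "(\<Sum>l<m. job_tail rho deterministic_size l) = capped_mean rho m 1" for m
    unfolding job_tail_deterministic by (simp add: capped_mean_def)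
  show "is_arg_min (max_queue_length lam p) mean_one_job_size deterministic_size"
    unfolding is_arg_min_def not_ex not_less de_Morgan_conj
  proof (intro conjI allI mean_one_deterministic)
    fix Z
    show "\<not> mean_one_job_size Z \<or> max_queue_length lam p deterministic_size \<le> max_queue_length lam p Z"
      using max_queue_length_le[OF assms(1-3) mean_one_deterministic, of Z]
        sum_job_tail_le_deterministic[OF rho, of Z] det_sum assms(4) by metis
  qed
  fix k :: nat assume k: "1 \<le> k"
  show "is_arg_min (max_queue_length lam p) (\<lambda>Z. mean_one_job_size Z \<and> phase_type k Z) (erlang_size k)"
    unfolding is_arg_min_def
  proof (intro conjI notI mean_one_erlang phase_type_erlang k)
    assume "\<exists>Z. (mean_one_job_size Z \<and> phase_type k Z) \<and> max_queue_length lam p Z < max_queue_length lam p (erlang_size k)"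
    then obtain Z where Z: "mean_one_job_size Z" "phase_type k Z"
      and less: "max_queue_length lam p Z < max_queue_length lam p (erlang_size k)" by blast
    have "(\<Sum>l<m. job_tail rho Z l) \<le> (\<Sum>l<m. job_tail rho (erlang_size k) l)" for m
      unfolding sum_job_tail[OF rho Z(1)] sum_job_tail[OF rho mean_one_erlang[OF k]]
      by (rule phase_type_capped_mean_le[OF k rho Z])
    then have "max_queue_length lam p (erlang_size k) \<le> max_queue_length lam p Z"
      using assms Z by (intro max_queue_length_le mean_one_erlang k) auto
    then show False using less by simp
  qed
next
  let ?P = "\<lambda>n. 1 / (1 + rho * (\<Sum>k<n. (-1) ^ k / fact k * real (n - 1 - k) ^ k
      * exp (real (n - 1 - k) * rho) * rho ^ k)) < (1 - lam) / (1 - p)"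
  have P_Suc: "?P (Suc m) \<longleftrightarrow> P0 lam p deterministic_size (m + 1) < (1 - lam) / (1 - p)" for m
    using P0_eq[OF _ _ mean_one_deterministic, of lam p m] assms
    by (simp add: job_tail_deterministic served_deterministic lessThan_Suc_atMost)
  obtain m where "?P (Suc m)" using P0_eventually_small[OF assms(1-3) mean_one_deterministic] P_Suc by blast
  \<comment> \<open>At \<open>n = 0\<close> the sum is empty and the left side is 1, which is not
    below the threshold because \<open>p < lam\<close>. Hence the least \<open>n\<close> is one more
    than the least \<open>m\<close>, which matches the \<open>+ 1\<close> in
    \<open>max_queue_length\<close>.\<close>
  moreover have "\<not> ?P 0" using assms by simp
  ultimately have "(LEAST n. ?P n) = Suc (LEAST m. ?P (Suc m))" by (rule Least_Suc)
  then show "max_queue_length lam p deterministic_size = (LEAST n. ?P n)"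
    unfolding P_Suc by (simp add: max_queue_length_def)
qed

end
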